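(* There exist two non-isomorphic connected compact semisimple Lie groups $G^1$ and $G^2$ with the same Witten zeta-function, $\zeta_{G^1}(s)=\zeta_{G^2}(s)$; that is, such that for every positive integer $n$ the groups $G^1$ and $G^2$ have the same number of isomorphism classes of irreducible complex representations of dimension $n$.
   Context: For a compact semisimple Lie group $G$, the Witten zeta-function of $G$ is the Dirichlet series $$\zeta_G(s)=\sum_{V\ \mathrm{irreducible}}(\dim V)^{-s},$$ where $V$ runs over the isomorphism classes of irreducible finite-dimensional (continuous) complex representations of $G$. For each positive integer $n$, $G$ has only finitely many irreducible representations of dimension $n$ up to isomorphism, and the $n$th coefficient of $\zeta_G(s)$ is the number of these. *)

theory Defs
  imports
    "HOL-Analysis.Analysis"
    "HOL-Algebra.Algebra"
    "Jordan_Normal_Form.Matrix"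
begin

text \<open>
  Dimensions vary inside the statement, so \<open>\<real>\<^sup>n\<close> is \<^term>\<open>Euclidean_space n\<close>:
  the functions \<^typ>\<open>nat \<Rightarrow> real\<close> that vanish from index \<open>n\<close> on, with the product topology.
\<close>

section \<open>Smooth maps and manifolds\<close>

definition partial_deriv :: "nat \<Rightarrow> ((nat \<Rightarrow> real) \<Rightarrow> real) \<Rightarrow> (nat \<Rightarrow> real) \<Rightarrow> real" where
  "partial_deriv i g = (\<lambda>x. deriv (\<lambda>t. g (x(i := t))) (x i))"

text \<open>\<open>C_on n k S g\<close>: \<open>g\<close> is of class \<open>C\<^sup>k\<close> on \<open>S\<close>, for \<open>S\<close> open in \<open>\<real>\<^sup>n\<close>.\<close>

primrec C_on :: "nat \<Rightarrow> nat \<Rightarrow> (nat \<Rightarrow> real) set \<Rightarrow> ((nat \<Rightarrow> real) \<Rightarrow> real) \<Rightarrow> bool" where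
  "C_on n 0 S g \<longleftrightarrow>
     continuous_map (subtopology (Euclidean_space n) S) euclideanreal g"
| "C_on n (Suc k) S g \<longleftrightarrow>
     continuous_map (subtopology (Euclidean_space n) S) euclideanreal g \<and>
     (\<forall>i<n. (\<forall>x\<in>S. (\<lambda>t. g (x(i := t))) field_differentiable at (x i)) \<and>
            C_on n k S (partial_deriv i g))"

definition smooth_on :: "nat \<Rightarrow> (nat \<Rightarrow> real) set \<Rightarrow> ((nat \<Rightarrow> real) \<Rightarrow> real) \<Rightarrow> bool" where
  "smooth_on n S g \<longleftrightarrow> (\<forall>k. C_on n k S g)"

type_synonym 'a chart = "'a set \<times> ('a \<Rightarrow> nat \<Rightarrow> real)"

text \<open>The atlas need not be maximal; it stands for the smooth structure that it generates.\<close>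

record 'a manifold =
  mtop :: "'a topology"
  mdim :: nat
  atlas :: "'a chart set"

definition is_chart :: "'a topology \<Rightarrow> nat \<Rightarrow> 'a chart \<Rightarrow> bool" where
  "is_chart T n c \<longleftrightarrow> (case c of (U, \<phi>) \<Rightarrow>
     openin T U \<and> openin (Euclidean_space n) (\<phi> ` U) \<and>
     homeomorphic_map (subtopology T U) (subtopology (Euclidean_space n) (\<phi> ` U)) \<phi>)"

definition smooth_manifold :: "'a manifold \<Rightarrow> bool" where
  "smooth_manifold M \<longleftrightarrow>
     Hausdorff_space (mtop M) \<and> second_countable (mtop M) \<and>
     (\<forall>c\<in>atlas M. is_chart (mtop M) (mdim M) c) \<and>
     (\<Union>(U, \<phi>)\<in>atlas M. U) = topspace (mtop M) \<and>
     (\<forall>(U, \<phi>)\<in>atlas M. \<forall>(V, \<psi>)\<in>atlas M. \<forall>i<mdim M.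
        smooth_on (mdim M) (\<phi> ` (U \<inter> V)) (\<lambda>y. \<psi> (inv_into U \<phi> y) i))"

definition smooth_map :: "'a manifold \<Rightarrow> 'b manifold \<Rightarrow> ('a \<Rightarrow> 'b) \<Rightarrow> bool" where
  "smooth_map M N f \<longleftrightarrow>
     continuous_map (mtop M) (mtop N) f \<and>
     (\<forall>(U, \<phi>)\<in>atlas M. \<forall>(V, \<psi>)\<in>atlas N. \<forall>i<mdim N.
        smooth_on (mdim M) (\<phi> ` {x \<in> U. f x \<in> V}) (\<lambda>y. \<psi> (f (inv_into U \<phi> y)) i))"

definition prod_chart :: "nat \<Rightarrow> nat \<Rightarrow> 'a chart \<Rightarrow> 'b chart \<Rightarrow> ('a \<times> 'b) chart" where
  "prod_chart m n c d = (case (c, d) of ((U, \<phi>), (V, \<psi>)) \<Rightarrow>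
     (U \<times> V, \<lambda>(a, b) i. if i < m then \<phi> a i else if i < m + n then \<psi> b (i - m) else 0))"

definition prod_manifold :: "'a manifold \<Rightarrow> 'b manifold \<Rightarrow> ('a \<times> 'b) manifold" where
  "prod_manifold M N =
     \<lparr> mtop = prod_topology (mtop M) (mtop N),
       mdim = mdim M + mdim N,
       atlas = {prod_chart (mdim M) (mdim N) c d | c d. c \<in> atlas M \<and> d \<in> atlas N} \<rparr>"

section \<open>Lie groups\<close>

definition lie_group :: "'a monoid \<Rightarrow> 'a manifold \<Rightarrow> bool" where
  "lie_group G M \<longleftrightarrow>
     group G \<and> smooth_manifold M \<and> topspace (mtop M) = carrier G \<and>
     smooth_map (prod_manifold M M) M (\<lambda>(x, y). x \<otimes>\<^bsub>G\<^esub> y) \<and>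
     smooth_map M M (\<lambda>x. inv\<^bsub>G\<^esub> x)"

definition lie_group_isomorphic ::
    "'a monoid \<Rightarrow> 'a manifold \<Rightarrow> 'b monoid \<Rightarrow> 'b manifold \<Rightarrow> bool" where
  "lie_group_isomorphic G M H N \<longleftrightarrow>
     (\<exists>f \<in> iso G H. smooth_map M N f \<and> smooth_map N M (inv_into (carrier G) f))"

text \<open>
  The Lie algebra of \<open>G\<close> is the tangent space at \<open>1\<close>, identified with \<open>\<real>\<^sup>n\<close> by a chart \<open>(U, \<phi>)\<close>
  around \<open>1\<close>. A vector \<open>v\<close> is represented by the curve that is \<open>t \<mapsto> \<phi> 1 + t v\<close> in the chart. The bracket is
  \<open>[u, v] = ad u v\<close>, where \<open>ad\<close> is the derivative at \<open>1\<close> of \<open>Ad\<close> and \<open>Ad g\<close> is the derivative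
  at \<open>1\<close> of conjugation by \<open>g\<close>.
\<close>

definition chart_curve ::
    "'a monoid \<Rightarrow> 'a chart \<Rightarrow> (nat \<Rightarrow> real) \<Rightarrow> real \<Rightarrow> 'a" where
  "chart_curve G c v t = (case c of (U, \<phi>) \<Rightarrow> inv_into U \<phi> (\<lambda>i. \<phi> \<one>\<^bsub>G\<^esub> i + t * v i))"

definition lie_bracket ::
    "'a monoid \<Rightarrow> nat \<Rightarrow> 'a chart \<Rightarrow> (nat \<Rightarrow> real) \<Rightarrow> (nat \<Rightarrow> real) \<Rightarrow> nat \<Rightarrow> real" where
  "lie_bracket G n c u v =
     (\<lambda>k. if k < n then
        deriv (\<lambda>s. deriv (\<lambda>t. snd c (chart_curve G c u s \<otimes>\<^bsub>G\<^esub> chart_curve G c v t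
                                   \<otimes>\<^bsub>G\<^esub> inv\<^bsub>G\<^esub> chart_curve G c u s) k) 0) 0
      else 0)"

definition lin_subspace :: "nat \<Rightarrow> (nat \<Rightarrow> real) set \<Rightarrow> bool" where
  "lin_subspace n W \<longleftrightarrow>
     W \<subseteq> topspace (Euclidean_space n) \<and> (\<lambda>i. 0) \<in> W \<and>
     (\<forall>x\<in>W. \<forall>y\<in>W. (\<lambda>i. x i + y i) \<in> W) \<and>
     (\<forall>a. \<forall>x\<in>W. (\<lambda>i. a * x i) \<in> W)"

definition lie_ideal ::
    "nat \<Rightarrow> ((nat \<Rightarrow> real) \<Rightarrow> (nat \<Rightarrow> real) \<Rightarrow> nat \<Rightarrow> real) \<Rightarrow> (nat \<Rightarrow> real) set \<Rightarrow> bool" where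
  "lie_ideal n br I \<longleftrightarrow>
     lin_subspace n I \<and> (\<forall>x\<in>topspace (Euclidean_space n). \<forall>y\<in>I. br x y \<in> I)"

definition derived_algebra ::
    "nat \<Rightarrow> ((nat \<Rightarrow> real) \<Rightarrow> (nat \<Rightarrow> real) \<Rightarrow> nat \<Rightarrow> real) \<Rightarrow> (nat \<Rightarrow> real) set \<Rightarrow> (nat \<Rightarrow> real) set" where
  "derived_algebra n br I = lin_subspace n hull {br x y | x y. x \<in> I \<and> y \<in> I}"

definition lie_solvable ::
    "nat \<Rightarrow> ((nat \<Rightarrow> real) \<Rightarrow> (nat \<Rightarrow> real) \<Rightarrow> nat \<Rightarrow> real) \<Rightarrow> (nat \<Rightarrow> real) set \<Rightarrow> bool" where
  "lie_solvable n br I \<longleftrightarrow> (\<exists>k. (derived_algebra n br ^^ k) I = {\<lambda>i. 0})"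

definition lie_algebra_semisimple ::
    "nat \<Rightarrow> ((nat \<Rightarrow> real) \<Rightarrow> (nat \<Rightarrow> real) \<Rightarrow> nat \<Rightarrow> real) \<Rightarrow> bool" where
  "lie_algebra_semisimple n br \<longleftrightarrow>
     (\<forall>I. lie_ideal n br I \<and> lie_solvable n br I \<longrightarrow> I = {\<lambda>i. 0})"

text \<open>Different charts around \<open>1\<close> give isomorphic Lie algebras, so the choice is immaterial.\<close>

definition semisimple_lie_group :: "'a monoid \<Rightarrow> 'a manifold \<Rightarrow> bool" where
  "semisimple_lie_group G M \<longleftrightarrow>
     lie_group G M \<and>
     (\<exists>c\<in>atlas M. \<one>\<^bsub>G\<^esub> \<in> fst c \<and> lie_algebra_semisimple (mdim M) (lie_bracket G (mdim M) c))"

definition connected_compact_semisimple_lie_group :: "'a monoid \<Rightarrow> 'a manifold \<Rightarrow> bool" where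
  "connected_compact_semisimple_lie_group G M \<longleftrightarrow>
     semisimple_lie_group G M \<and> compact_space (mtop M) \<and> connected_space (mtop M)"

section \<open>Representations and the Witten zeta-function\<close>

definition representation ::
    "'a monoid \<Rightarrow> 'a manifold \<Rightarrow> nat \<Rightarrow> ('a \<Rightarrow> complex mat) \<Rightarrow> bool" where
  "representation G M n \<rho> \<longleftrightarrow>
     (\<forall>x\<in>carrier G. \<rho> x \<in> carrier_mat n n) \<and>
     \<rho> \<one>\<^bsub>G\<^esub> = 1\<^sub>m n \<and>
     (\<forall>x\<in>carrier G. \<forall>y\<in>carrier G. \<rho> (x \<otimes>\<^bsub>G\<^esub> y) = \<rho> x * \<rho> y) \<and>
     (\<forall>i<n. \<forall>j<n. continuous_map (mtop M) euclidean (\<lambda>x. \<rho> x $$ (i, j)))"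

definition vec_subspace :: "nat \<Rightarrow> complex vec set \<Rightarrow> bool" where
  "vec_subspace n W \<longleftrightarrow>
     W \<subseteq> carrier_vec n \<and> 0\<^sub>v n \<in> W \<and>
     (\<forall>v\<in>W. \<forall>w\<in>W. v + w \<in> W) \<and> (\<forall>a. \<forall>v\<in>W. a \<cdot>\<^sub>v v \<in> W)"

definition irreducible_rep ::
    "'a monoid \<Rightarrow> 'a manifold \<Rightarrow> nat \<Rightarrow> ('a \<Rightarrow> complex mat) \<Rightarrow> bool" where
  "irreducible_rep G M n \<rho> \<longleftrightarrow>
     representation G M n \<rho> \<and> n > 0 \<and>
     (\<forall>W. vec_subspace n W \<and> (\<forall>x\<in>carrier G. \<forall>w\<in>W. \<rho> x *\<^sub>v w \<in> W) \<longrightarrow>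
          W = {0\<^sub>v n} \<or> W = carrier_vec n)"

definition rep_isomorphic ::
    "'a monoid \<Rightarrow> nat \<Rightarrow> ('a \<Rightarrow> complex mat) \<Rightarrow> ('a \<Rightarrow> complex mat) \<Rightarrow> bool" where
  "rep_isomorphic G n \<rho> \<sigma> \<longleftrightarrow>
     (\<exists>P\<in>carrier_mat n n. invertible_mat P \<and> (\<forall>x\<in>carrier G. P * \<rho> x = \<sigma> x * P))"

definition irr_classes ::
    "'a monoid \<Rightarrow> 'a manifold \<Rightarrow> nat \<Rightarrow> ('a \<Rightarrow> complex mat) set set" where
  "irr_classes G M n =
     {\<rho>. irreducible_rep G M n \<rho>} //
     {(\<rho>, \<sigma>). irreducible_rep G M n \<rho> \<and> irreducible_rep G M n \<sigma> \<and> rep_isomorphic G n \<rho> \<sigma>}"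

text \<open>
  The sum over all isomorphism classes \<open>V\<close>, each paired with its dimension. The value is
  the junk value \<open>0\<close> of \<^const>\<open>infsum\<close> where the series does not converge absolutely.
\<close>

definition witten_zeta :: "'a monoid \<Rightarrow> 'a manifold \<Rightarrow> complex \<Rightarrow> complex" where
  "witten_zeta G M s = (\<Sum>\<^sub>\<infinity>(n, V)\<in>(SIGMA n:UNIV. irr_classes G M n). of_nat n powr (- s))"

text \<open>
  A Lie group has at most the cardinality of the continuum, so every Lie group is isomorphic to
  one whose elements belong to the following type; the choice of type is a matter of convenience.
  It accommodates quotients of groups of tuples of matrices.
\<close>

type_synonym lie_elem = "(nat \<Rightarrow> complex mat) set"

end

theory Submission
  imports Defs "Jordan_Normal_Form.Char_Poly"
begin

text \<open>
  Both groups are quotients of \<open>SU(2)\<^sup>6\<close> by a subgroup \<open>C\<close> of its centre \<open>{1, -1}\<^sup>6\<close>. The irreducible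
  representations of \<open>SU(2)\<^sup>6/C\<close> are those of \<open>SU(2)\<^sup>6\<close> whose central character, a word in \<open>{0, 1}\<^sup>6\<close>,
  belongs to the dual code of \<open>C\<close>. Permuting the six factors preserves dimensions, so two codes whose
  duals have equally many words of each weight give the same numbers of irreducible representations
  of each dimension. There are two inequivalent codes of this kind, and the quotients differ in the
  conjugacy of those \<open>g\<close> with \<open>g\<^sup>2 = 1\<close> that are conjugate to \<open>g z\<close> for all central \<open>z\<close>.

  Finiteness needs no Lie theory. An \<open>n\<close>-dimensional representation of \<open>SU(2)\<close> has at most \<open>n\<close> weights,
  so by the pigeonhole principle some element of the circle, away from \<open>1\<close> in terms of \<open>n\<close> only, acts almost
  trivially in an invariant norm. Then so do all products of two conjugates of it, in particular a whole arc
  at \<open>1\<close>, which bounds the weights in terms of \<open>n\<close>. As \<open>SU(2)\<^sup>6\<close> is a product of finitely many circles,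
  the matrix coefficients of all \<open>n\<close>-dimensional representations lie in a single space of finite dimension,
  whereas those of pairwise inequivalent irreducible representations are linearly independent.
\<close>

section \<open>Unit quaternions\<close>

text \<open>Both dual codes have the weight enumerator (1 + y^2)^3. One is three copies of the
  repetition code {00, 11}; the other consists of the words p q r t t t with t = p + q + r. Every
  word of one is therefore a permutation of a word of the other, but as the codes are inequivalent,
  no single permutation serves all words. Hence representations are matched one central character at
  a time, by a permutation that depends on it. The two groups have the same Lie algebra, so the
  invariant that separates them has to see the centre. Elements conjugate to all their central
  multiples reveal, inside the abstract group, how the code ties the coordinates together. The
  matching produces injections in both directions, and these give equal numbers only once the
  numbers are known to be finite. The obstacle there is uniformity: each representation has finitely
  many weights, but a single finite set of functions has to serve all representations of dimension
  n. This is why the bound on the weights may use n only.\<close>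

text \<open>The pair \<open>(z, w)\<close> is the quaternion \<open>z + w j\<close>, so \<open>SU(2)\<close> is the unit sphere.\<close>

type_synonym quat = "complex \<times> complex"

text \<open>The product (z + w j) (z' + w' j), expanded with the rule that moving j past a complex
  number conjugates it, and j^2 = -1.\<close>

definition qm :: "quat \<Rightarrow> quat \<Rightarrow> quat" where
  "qm p q = (fst p * fst q - snd p * cnj (snd q), fst p * snd q + snd p * cnj (fst q))"

definition qcnj :: "quat \<Rightarrow> quat" where
  "qcnj p = (cnj (fst p), - snd p)"

abbreviation SU2 :: "quat set" where
  "SU2 \<equiv> sphere 0 1"

lemma qm_Pair: "qm (a, b) (c, d) = (a * c - b * cnj d, a * d + b * cnj c)"
  by (simp add: qm_def)

lemma qm_assoc: "qm (qm p q) r = qm p (qm q r)"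
  by (simp add: qm_def algebra_simps)

lemma qm_one [simp]: "qm (1, 0) p = p" "qm p (1, 0) = p"
  by (simp_all add: qm_def)

lemma qcnj_one [simp]: "qcnj (1, 0) = (1, 0)"
  by (simp add: qcnj_def)

lemma qcnj_qcnj [simp]: "qcnj (qcnj p) = p"
  by (simp add: qcnj_def)

lemma qcnj_qm: "qcnj (qm p q) = qm (qcnj q) (qcnj p)"
  by (simp add: qm_def qcnj_def algebra_simps)

lemma qm_scaleR [simp]: "qm (c *\<^sub>R p) q = c *\<^sub>R qm p q" "qm p (c *\<^sub>R q) = c *\<^sub>R qm p q"
  by (simp_all add: qm_def scaleR_conv_of_real algebra_simps)

lemma qm_add: "qm (p + p') q = qm p q + qm p' q" "qm p (q + q') = qm p q + qm p q'"
  by (simp_all add: qm_def algebra_simps)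

lemma qm_uminus [simp]: "qm (- p) q = - qm p q" "qm p (- q) = - qm p q"
  by (simp_all add: qm_def)

lemma qcnj_scaleR [simp]: "qcnj (c *\<^sub>R p) = c *\<^sub>R qcnj p"
  by (simp add: qcnj_def scaleR_conv_of_real)

lemma norm_quat: "(norm (p :: quat))\<^sup>2 = (cmod (fst p))\<^sup>2 + (cmod (snd p))\<^sup>2"
  by (simp add: norm_prod_def)

lemma of_real_norm_quat: "complex_of_real ((norm (p :: quat))\<^sup>2) = fst p * cnj (fst p) + snd p * cnj (snd p)"
  by (simp only: norm_quat of_real_add complex_norm_square)

lemma qm_qcnj: "qm p (qcnj p) = (complex_of_real ((norm p)\<^sup>2), 0)" "qm (qcnj p) p = (complex_of_real ((norm p)\<^sup>2), 0)"
  by (simp_all only: of_real_norm_quat) (simp_all add: qm_def qcnj_def algebra_simps)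

lemma norm_qcnj [simp]: "norm (qcnj p) = norm p"
  by (simp add: qcnj_def norm_prod_def)

lemma norm_qm: "norm (qm p q) = norm p * norm q"
proof -
  have "complex_of_real ((norm (qm p q))\<^sup>2) = complex_of_real ((norm p)\<^sup>2) * complex_of_real ((norm q)\<^sup>2)"
    unfolding of_real_norm_quat by (simp add: qm_def algebra_simps)
  then have "(norm (qm p q))\<^sup>2 = (norm p * norm q)\<^sup>2"
    by (simp add: power_mult_distrib flip: of_real_mult of_real_power)
  then show ?thesis
    by (simp add: power2_eq_iff_nonneg)
qed

lemma SU2_closed [intro, simp]:
  "(1, 0) \<in> SU2" "p \<in> SU2 \<Longrightarrow> q \<in> SU2 \<Longrightarrow> qm p q \<in> SU2" "p \<in> SU2 \<Longrightarrow> qcnj p \<in> SU2"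
  by (auto simp: norm_qm norm_Pair)

lemma SU2_inverse [simp]: "norm p = 1 \<Longrightarrow> qm p (qcnj p) = (1, 0)" "norm p = 1 \<Longrightarrow> qm (qcnj p) p = (1, 0)"
  by (simp_all add: qm_qcnj)

lemma qm_cancel [simp]:
  "norm p = 1 \<Longrightarrow> qm p (qm (qcnj p) q) = q" "norm p = 1 \<Longrightarrow> qm (qcnj p) (qm p q) = q"
  by (simp_all flip: qm_assoc)

lemma continuous_on_qm [continuous_intros]:
  "continuous_on A f \<Longrightarrow> continuous_on A g \<Longrightarrow> continuous_on A (\<lambda>x. qm (f x) (g x))"
  unfolding qm_def by (intro continuous_intros)

lemma continuous_on_qcnj [continuous_intros]:
  "continuous_on A f \<Longrightarrow> continuous_on A (\<lambda>x. qcnj (f x))"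
  unfolding qcnj_def by (intro continuous_intros)

definition circ :: "real \<Rightarrow> quat" where
  "circ t = (cis t, 0)"

lemma circ_SU2 [simp]: "norm (circ t) = 1"
  by (simp add: circ_def norm_prod_def)

lemma circ_add: "circ (s + t) = qm (circ s) (circ t)"
  by (simp add: circ_def qm_def cis_mult)

lemma circ_0 [simp]: "circ 0 = (1, 0)"
  by (simp add: circ_def)

text \<open>With c = \<open>circ t\<close>, the imaginary parts P of p and K of c satisfy P^2 = K^2,
  hence p (P + K) = (P + K) c. The factor P + K vanishes only if p is the conjugate of c, and then j
  conjugates one into the other.\<close>

lemma SU2_conj_circ:
  assumes p: "norm p = 1" and t: "Re (fst p) = cos t"
  obtains u where "norm u = 1" "p = qm u (qm (circ t) (qcnj u))"
proof -
  define a where "a = Im (fst p)"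
  define w where "w = snd p"
  have p_eq: "p = (Complex (cos t) a, w)"
    using t by (simp add: prod_eq_iff complex_eq_iff a_def w_def)
  have n: "a\<^sup>2 + (cmod w)\<^sup>2 = (sin t)\<^sup>2"
  proof -
    have "(cos t)\<^sup>2 + a\<^sup>2 + (cmod w)\<^sup>2 = 1"
      using p norm_quat[of p] by (simp add: p_eq cmod_power2)
    then show ?thesis
      using sin_cos_squared_add[of t] by linarith
  qed
  have "\<exists>q. q \<noteq> 0 \<and> qm p q = qm q (circ t)"
  proof (cases "a = - sin t \<and> w = 0")
    case True
    then have "qm p (0, 1) = qm (0, 1) (circ t)"
      by (simp add: p_eq qm_def circ_def complex_eq_iff)
    then show ?thesis
      by (intro exI[of _ "(0, 1)"]) (simp add: zero_prod_def)
  next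
    case False
    let ?q = "(Complex 0 (a + sin t), w) :: quat"
    have "a * a + Re w * Re w + Im w * Im w = sin t * sin t"
      using n unfolding cmod_power2 by (simp add: power2_eq_square)
    then have "qm p ?q = qm ?q (circ t)"
      by (simp add: p_eq qm_def circ_def complex_eq_iff algebra_simps)
    moreover have "?q \<noteq> 0"
      using False by (auto simp: zero_prod_def complex_eq_iff)
    ultimately show ?thesis
      by blast
  qed
  then obtain q where q: "q \<noteq> 0" "qm p q = qm q (circ t)"
    by blast
  define u where "u = (1 / norm q) *\<^sub>R q"
  have u: "norm u = 1"
    using q by (simp add: u_def)
  have "qm p u = qm u (circ t)"
    using q by (simp add: u_def)
  then have "qm (qm p u) (qcnj u) = qm (qm u (circ t)) (qcnj u)"
    by simp
  then have "p = qm u (qm (circ t) (qcnj u))"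
    using u by (simp add: qm_assoc)
  then show ?thesis
    using u that by blast
qed

text \<open>The trace, which is twice this real part, is a complete invariant of conjugacy: both
  elements are conjugate to the same \<open>circ t\<close>.\<close>

lemma SU2_conj_if_Re_eq:
  assumes "norm p = 1" "norm q = 1" "Re (fst p) = Re (fst q)"
  obtains u where "norm u = 1" "p = qm u (qm q (qcnj u))"
proof -
  have "\<bar>Re (fst p)\<bar> \<le> 1"
    using abs_Re_le_cmod[of "fst p"] norm_fst_le[of "fst p" "snd p"] assms(1) by simp
  then obtain t where t: "Re (fst p) = cos t"
    using cos_arccos_abs by metis
  obtain u where u: "norm u = 1" "p = qm u (qm (circ t) (qcnj u))"
    using SU2_conj_circ[OF assms(1) t] .
  obtain v where v: "norm v = 1" "q = qm v (qm (circ t) (qcnj v))"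
    using SU2_conj_circ[OF assms(2) t[unfolded assms(3)]] .
  have "p = qm (qm u (qcnj v)) (qm q (qcnj (qm u (qcnj v))))"
    using v(1) by (subst u(2), subst v(2)) (simp add: qcnj_qm qm_assoc)
  then show ?thesis
    using that[of "qm u (qcnj v)"] u v by (simp add: norm_qm)
qed

text \<open>The one-parameter group exp(t j), the middle factor of the Euler decomposition.\<close>

definition rot :: "real \<Rightarrow> quat" where
  "rot t = (complex_of_real (cos t), complex_of_real (sin t))"

lemma norm_rot [simp]: "norm (rot t) = 1"
  by (simp add: rot_def norm_prod_def)

lemma rot_conj_circ: "\<exists>u. norm u = 1 \<and> (\<forall>t. rot t = qm u (qm (circ t) (qcnj u)))"
proof -
  \<comment> \<open>The quaternion 1 + k satisfies j (1 + k) = (1 + k) i, so one u serves all t.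
    That u does not depend on t is what later carries the frequencies along \<open>circ\<close> over
    to \<open>rot\<close>.\<close>
  let ?q = "(1, \<i>) :: quat"
  define u where "u = (1 / norm ?q) *\<^sub>R ?q"
  have q: "norm ?q \<noteq> 0"
    by (simp add: zero_prod_def)
  then have u: "norm u = 1"
    unfolding u_def norm_scaleR by simp
  have "rot t = qm u (qm (circ t) (qcnj u))" for t
  proof -
    have "qm (rot t) ?q = qm ?q (circ t)"
      by (simp add: rot_def circ_def qm_def complex_eq_iff)
    then have "qm (rot t) u = qm u (circ t)"
      unfolding u_def qm_scaleR by simp
    then have "qm (qm (rot t) u) (qcnj u) = qm (qm u (circ t)) (qcnj u)"
      by simp
    then show ?thesis
      using u by (simp add: qm_assoc)
  qed
  with u show ?thesis
    by blast
qed

lemma SU2_euler: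
  assumes "norm p = 1"
  obtains a b c where "p = qm (circ a) (qm (rot b) (circ c))"
proof -
  let ?z = "fst p" and ?w = "snd p"
  have "(cmod ?z)\<^sup>2 + (cmod ?w)\<^sup>2 = 1"
    using assms norm_quat[of p] by simp
  then obtain b where b: "cmod ?z = cos b" "cmod ?w = sin b"
    using sincos_total_2pi by metis
  \<comment> \<open>The product has the coordinates exp(i (a + c)) cos b and exp(i (a - c)) sin b. A
    vanishing coordinate has modulus 0, so the value of \<open>Arg\<close> at 0 is
    immaterial.\<close>
  define a where "a = (Arg ?z + Arg ?w) / 2"
  define c where "c = (Arg ?z - Arg ?w) / 2"
  have ac: "a + c = Arg ?z" "a - c = Arg ?w"
    by (simp_all add: a_def c_def field_simps)
  have z: "?z = cis (a + c) * cos b"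
    unfolding ac b(1)[symmetric] using rcis_cmod_Arg[of ?z] by (simp add: rcis_def mult.commute)
  have w: "?w = cis (a - c) * sin b"
    unfolding ac b(2)[symmetric] using rcis_cmod_Arg[of ?w] by (simp add: rcis_def mult.commute)
  have "cis (a - c) = cis a * cnj (cis c)"
    by (simp add: cis_cnj cis_mult)
  then have "p = qm (circ a) (qm (rot b) (circ c))"
    by (simp add: prod_eq_iff z w circ_def rot_def qm_def flip: cis_mult)
  then show ?thesis
    using that by blast
qed

section \<open>Tuples of unit quaternions\<close>

text \<open>Pinning the coordinates from 6 on to 1 makes SU(2)^6 a subset of a function type, with
  pointwise products.\<close>

definition tuples :: "(nat \<Rightarrow> quat) set" where
  "tuples = {x. (\<forall>i<6. norm (x i) = 1) \<and> (\<forall>i\<ge>6. x i = (1, 0))}"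

definition tmul :: "(nat \<Rightarrow> quat) \<Rightarrow> (nat \<Rightarrow> quat) \<Rightarrow> nat \<Rightarrow> quat" where
  "tmul x y = (\<lambda>i. qm (x i) (y i))"

definition tinv :: "(nat \<Rightarrow> quat) \<Rightarrow> nat \<Rightarrow> quat" where
  "tinv x = (\<lambda>i. qcnj (x i))"

definition tone :: "nat \<Rightarrow> quat" where
  "tone = (\<lambda>_. (1, 0))"

lemma norm_tuples: "x \<in> tuples \<Longrightarrow> norm (x i) = 1"
  by (cases "i < 6") (auto simp: tuples_def norm_prod_def)

lemma tuples_closed [intro, simp]:
  "tone \<in> tuples" "x \<in> tuples \<Longrightarrow> y \<in> tuples \<Longrightarrow> tmul x y \<in> tuples" "x \<in> tuples \<Longrightarrow> tinv x \<in> tuples"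
  by (auto simp: tuples_def tone_def tmul_def tinv_def norm_qm norm_Pair)

lemma tmul_assoc: "tmul (tmul x y) z = tmul x (tmul y z)"
  by (simp add: tmul_def qm_assoc)

lemma tmul_one [simp]: "tmul tone x = x" "tmul x tone = x"
  by (simp_all add: tmul_def tone_def)

lemma tmul_inv [simp]: "x \<in> tuples \<Longrightarrow> tmul x (tinv x) = tone" "x \<in> tuples \<Longrightarrow> tmul (tinv x) x = tone"
  by (simp_all add: tmul_def tinv_def tone_def norm_tuples)

lemma tuples_PiE: "tuples = PiE UNIV (\<lambda>i. if i < 6 then SU2 else {(1, 0)})"
  by (auto simp: tuples_def PiE_def Pi_def not_less split: if_splits)

lemma compact_tuples: "compact tuples"
proof -
  have "compactin (product_topology (\<lambda>i. euclidean) UNIV) tuples"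
    unfolding tuples_PiE compactin_PiE by auto
  then show ?thesis
    by (simp add: euclidean_product_topology)
qed

lemma connected_tuples: "connected tuples"
proof -
  have "connected SU2"
    by (rule connected_sphere) (simp add: DIM_complex)
  then have "connectedin (product_topology (\<lambda>i. euclidean) UNIV) tuples"
    unfolding tuples_PiE connectedin_PiE by auto
  then show ?thesis
    by (simp add: euclidean_product_topology)
qed

section \<open>Weights of representations of \<open>SU(2)\<close>\<close>

text \<open>The characters of the cyclic group of order N. Sampling the circle at the N-th roots of
  unity turns integrals over it into finite sums.\<close>

definition rou :: "nat \<Rightarrow> int \<Rightarrow> complex" where
  "rou N a = cis (2 * pi * of_int a / real N)"

lemma rou_add: "rou N (a + b) = rou N a * rou N b"
  by (simp add: rou_def cis_mult add_divide_distrib distrib_left)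

lemma rou_0 [simp]: "rou N 0 = 1"
  by (simp add: rou_def)

lemma norm_rou [simp]: "cmod (rou N a) = 1"
  by (simp add: rou_def)

lemma rou_mult_self [simp]: "rou N (int N * a) = 1"
  using cis_multiple_2pi[of "of_int a"] by (cases "N = 0") (simp_all add: rou_def mult.assoc)

lemma rou_mod: "rou N (a mod int N) = rou N a"
proof -
  have "rou N a = rou N (int N * (a div int N) + a mod int N)"
    by simp
  also have "\<dots> = rou N (a mod int N)"
    by (simp only: rou_add) simp
  finally show ?thesis ..
qed

lemma rou_eq_1:
  assumes "N > 0" "rou N a = 1"
  shows "int N dvd a"
proof -
  have "cos (2 * pi * of_int a / real N) = 1"
    using assms(2) by (simp add: rou_def complex_eq_iff)
  then obtain n :: int where "2 * pi * of_int a / real N = of_int n * 2 * pi"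
    by (auto simp: cos_one_2pi_int)
  then have "real_of_int a = real_of_int (n * int N)"
    using assms(1) by (simp add: field_simps)
  then have "a = n * int N"
    by (simp only: of_int_eq_iff)
  then show ?thesis
    by simp
qed

lemma sum_periodic_shift:
  fixes f :: "int \<Rightarrow> 'a::comm_monoid_add"
  assumes "N > 0" and f: "\<And>j. f (j mod int N) = f j"
  shows "(\<Sum>j\<in>{0..<int N}. f (j + m)) = (\<Sum>j\<in>{0..<int N}. f j)"
proof -
  have "bij_betw (\<lambda>j. (j + m) mod int N) {0..<int N} {0..<int N}"
    using assms(1) by (intro bij_betw_byWitness[where f' = "\<lambda>j. (j - m) mod int N"]) (auto simp: mod_simps)
  from sum.reindex_bij_betw[OF this, of f] show ?thesis
    by (simp add: f)
qed

lemma sum_periodic_interval: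
  fixes f :: "int \<Rightarrow> 'a::comm_monoid_add"
  assumes "N > 0" and f: "\<And>j. f (j mod int N) = f j"
  shows "(\<Sum>j\<in>{a..<a + int N}. f j) = (\<Sum>j\<in>{0..<int N}. f j)"
proof -
  have "(\<Sum>j\<in>{a..<a + int N}. f j) = (\<Sum>j\<in>{0..<int N}. f (j + a))"
    by (rule sum.reindex_bij_witness[of _ "\<lambda>j. j + a" "\<lambda>j. j - a"]) auto
  also have "\<dots> = (\<Sum>j\<in>{0..<int N}. f j)"
    using assms(1) f by (rule sum_periodic_shift)
  finally show ?thesis .
qed

text \<open>Orthogonality of characters: shifting the index multiplies the sum by
  \<open>rou N d\<close>, so the sum is 0 unless this factor is 1. The interval may begin anywhere,
  since the frequencies will later be centred at 0.\<close>

lemma sum_rou: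
  assumes "N > 0"
  shows "(\<Sum>k\<in>{a..<a + int N}. rou N (k * d)) = (if int N dvd d then of_nat N else 0)"
proof (cases "int N dvd d")
  case True
  then obtain c where "d = int N * c"
    by auto
  then have "rou N (k * d) = 1" for k
    using rou_mult_self[of N "k * c"] by (simp add: mult.left_commute)
  then show ?thesis
    using True by simp
next
  case False
  have f: "rou N (j mod int N * d) = rou N (j * d)" for j
    by (metis rou_mod mod_mult_left_eq)
  let ?S = "\<Sum>k\<in>{0..<int N}. rou N (k * d)"
  have "?S = (\<Sum>k\<in>{0..<int N}. rou N ((k + 1) * d))"
    using sum_periodic_shift[OF assms, of "\<lambda>k. rou N (k * d)" 1] f by simp
  also have "\<dots> = rou N d * ?S"
    by (simp add: distrib_right rou_add sum_distrib_left mult.commute[of _ "rou N d"])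
  finally have "?S = 0"
    using False rou_eq_1[OF assms] by auto
  then show ?thesis
    using False sum_periodic_interval[OF assms, of "\<lambda>k. rou N (k * d)" a] f by simp
qed

lemma circ_periodic [simp]: "circ (2 * pi * real_of_int a) = (1, 0)"
  by (simp add: circ_def)

lemma cmod_cis_minus_1: "(cmod (cis x - 1))\<^sup>2 = 2 - 2 * cos x"
proof -
  have "(cmod (cis x - 1))\<^sup>2 = (cos x - 1)\<^sup>2 + (sin x)\<^sup>2"
    by (simp add: cmod_power2)
  also have "\<dots> = 2 - 2 * cos x"
    using sin_cos_squared_add[of x] by (simp add: power2_eq_square algebra_simps)
  finally show ?thesis .
qed

lemma cmod_cis_minus_1_le: "cmod (cis x - 1) \<le> \<bar>x\<bar>"
  using dist_exp_i_1[of x] abs_sin_x_le_abs_x[of "x / 2"] by (simp add: cis_conv_exp mult.commute)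

locale SU2_rep =
  fixes n :: nat and \<rho> :: "quat \<Rightarrow> complex mat"
  assumes carrier: "p \<in> SU2 \<Longrightarrow> \<rho> p \<in> carrier_mat n n"
    and one: "\<rho> (1, 0) = 1\<^sub>m n"
    and mult: "p \<in> SU2 \<Longrightarrow> q \<in> SU2 \<Longrightarrow> \<rho> (qm p q) = \<rho> p * \<rho> q"
    and cont: "i < n \<Longrightarrow> j < n \<Longrightarrow> continuous_on SU2 (\<lambda>p. \<rho> p $$ (i, j))"
begin

section \<open>An invariant norm\<close>

definition l1 :: "complex vec \<Rightarrow> real" where
  "l1 v = (\<Sum>i<n. cmod (v $ i))"

text \<open>A supremum over the compact group, which yields an invariant norm without integration
  over the group.\<close>

definition inorm :: "complex vec \<Rightarrow> real" where
  "inorm v = (SUP p\<in>SU2. l1 (\<rho> p *\<^sub>v v))"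

lemma act_index: "p \<in> SU2 \<Longrightarrow> v \<in> carrier_vec n \<Longrightarrow> i < n \<Longrightarrow> (\<rho> p *\<^sub>v v) $ i = (\<Sum>l<n. \<rho> p $$ (i, l) * v $ l)"
  using carrier[of p] by (simp add: scalar_prod_def lessThan_atLeast0 del: mem_sphere_0)

lemma act_carrier [simp]: "p \<in> SU2 \<Longrightarrow> v \<in> carrier_vec n \<Longrightarrow> \<rho> p *\<^sub>v v \<in> carrier_vec n"
  using carrier by (rule mult_mat_vec_carrier)

lemma act_mult: "p \<in> SU2 \<Longrightarrow> q \<in> SU2 \<Longrightarrow> v \<in> carrier_vec n \<Longrightarrow> \<rho> (qm p q) *\<^sub>v v = \<rho> p *\<^sub>v (\<rho> q *\<^sub>v v)"
  using carrier by (simp add: mult del: mem_sphere_0) (meson assoc_mult_mat_vec carrier)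

lemma act_inverse [simp]:
  "p \<in> SU2 \<Longrightarrow> v \<in> carrier_vec n \<Longrightarrow> \<rho> p *\<^sub>v (\<rho> (qcnj p) *\<^sub>v v) = v"
  "p \<in> SU2 \<Longrightarrow> v \<in> carrier_vec n \<Longrightarrow> \<rho> (qcnj p) *\<^sub>v (\<rho> p *\<^sub>v v) = v"
  by (simp_all add: one flip: act_mult)

lemma l1_act_bdd:
  assumes "v \<in> carrier_vec n"
  shows "bdd_above ((\<lambda>p. l1 (\<rho> p *\<^sub>v v)) ` SU2)"
proof -
  have "continuous_on SU2 (\<lambda>p. \<Sum>i<n. cmod (\<Sum>l<n. \<rho> p $$ (i, l) * v $ l))"
    by (intro continuous_intros cont) auto
  then have "continuous_on SU2 (\<lambda>p. l1 (\<rho> p *\<^sub>v v))"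
    unfolding l1_def by (rule continuous_on_eq) (simp add: act_index assms del: mem_sphere_0)
  then have "bounded ((\<lambda>p. l1 (\<rho> p *\<^sub>v v)) ` SU2)"
    by (intro compact_imp_bounded compact_continuous_image) auto
  then show ?thesis
    by (rule bounded_imp_bdd_above)
qed

lemma l1_act_le_inorm: "v \<in> carrier_vec n \<Longrightarrow> p \<in> SU2 \<Longrightarrow> l1 (\<rho> p *\<^sub>v v) \<le> inorm v"
  unfolding inorm_def by (rule cSUP_upper) (auto intro: l1_act_bdd)

lemma l1_le_inorm: "v \<in> carrier_vec n \<Longrightarrow> l1 v \<le> inorm v"
  using l1_act_le_inorm[of v "(1, 0)"] by (simp add: one norm_Pair)

lemma inorm_leI: "(\<And>p. p \<in> SU2 \<Longrightarrow> l1 (\<rho> p *\<^sub>v v) \<le> b) \<Longrightarrow> inorm v \<le> b"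
  unfolding inorm_def by (rule cSUP_least) (use SU2_closed(1) in blast)+

lemma inorm_nonneg [simp]: "v \<in> carrier_vec n \<Longrightarrow> 0 \<le> inorm v"
  using l1_le_inorm[of v] by (rule order_trans[rotated]) (auto simp: l1_def intro: sum_nonneg)

lemma inorm_pos:
  assumes "v \<in> carrier_vec n" "v \<noteq> 0\<^sub>v n"
  shows "0 < inorm v"
proof -
  obtain i where "i < n" "v $ i \<noteq> 0"
    using assms by (auto simp: vec_eq_iff)
  then have "0 < l1 v"
    unfolding l1_def by (intro sum_pos2[of _ i]) auto
  then show ?thesis
    using l1_le_inorm[OF assms(1)] by simp
qed

text \<open>Composing with p stays within the same supremum, which gives one inequality; the inverse
  of p gives the other.\<close>

lemma inorm_act [simp]:
  assumes v: "v \<in> carrier_vec n" and p: "p \<in> SU2"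
  shows "inorm (\<rho> p *\<^sub>v v) = inorm v"
proof -
  have le: "inorm (\<rho> p *\<^sub>v v) \<le> inorm v" if v: "v \<in> carrier_vec n" and p: "p \<in> SU2" for v p
  proof (rule inorm_leI)
    fix q assume q: "q \<in> SU2"
    have "\<rho> q *\<^sub>v (\<rho> p *\<^sub>v v) = \<rho> (qm q p) *\<^sub>v v"
      using act_mult[OF q p v] by simp
    then show "l1 (\<rho> q *\<^sub>v (\<rho> p *\<^sub>v v)) \<le> inorm v"
      using l1_act_le_inorm[OF v SU2_closed(2)[OF q p]] by simp
  qed
  have "inorm v = inorm (\<rho> (qcnj p) *\<^sub>v (\<rho> p *\<^sub>v v))"
    using v p by simp
  also have "\<dots> \<le> inorm (\<rho> p *\<^sub>v v)"
    using v p by (intro le) auto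
  finally show ?thesis
    using le[OF v p] by simp
qed

lemma inorm_add:
  assumes "v \<in> carrier_vec n" "w \<in> carrier_vec n"
  shows "inorm (v + w) \<le> inorm v + inorm w"
proof (rule inorm_leI)
  fix p assume p: "p \<in> SU2"
  have "\<rho> p *\<^sub>v (v + w) = \<rho> p *\<^sub>v v + \<rho> p *\<^sub>v w"
    using carrier[OF p] assms by (rule mult_add_distrib_mat_vec)
  then have "l1 (\<rho> p *\<^sub>v (v + w)) \<le> l1 (\<rho> p *\<^sub>v v) + l1 (\<rho> p *\<^sub>v w)"
    using carrier[OF p] unfolding l1_def
    by (auto simp: sum.distrib[symmetric] simp del: index_mult_mat_vec intro!: sum_mono norm_triangle_ineq)
  then show "l1 (\<rho> p *\<^sub>v (v + w)) \<le> inorm v + inorm w"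
    using l1_act_le_inorm[OF assms(1) p] l1_act_le_inorm[OF assms(2) p] by simp
qed

lemma inorm_smult:
  assumes v: "v \<in> carrier_vec n"
  shows "inorm (c \<cdot>\<^sub>v v) = cmod c * inorm v"
proof -
  have le: "inorm (c \<cdot>\<^sub>v v) \<le> cmod c * inorm v" if v: "v \<in> carrier_vec n" for c v
  proof (rule inorm_leI)
    fix p assume p: "p \<in> SU2"
    have "\<rho> p *\<^sub>v (c \<cdot>\<^sub>v v) = c \<cdot>\<^sub>v (\<rho> p *\<^sub>v v)"
      using carrier[OF p] v by (rule mult_mat_vec)
    then have "l1 (\<rho> p *\<^sub>v (c \<cdot>\<^sub>v v)) = cmod c * l1 (\<rho> p *\<^sub>v v)"
      using carrier[OF p] unfolding l1_def by (simp add: sum_distrib_left norm_mult del: index_mult_mat_vec)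
    then show "l1 (\<rho> p *\<^sub>v (c \<cdot>\<^sub>v v)) \<le> cmod c * inorm v"
      using l1_act_le_inorm[OF v p] by (simp add: mult_left_mono)
  qed
  show ?thesis
  proof (cases "c = 0")
    case True
    then show ?thesis
      using le[OF v, of 0] inorm_nonneg[of "0 \<cdot>\<^sub>v v"] v by (simp del: inorm_nonneg)
  next
    case False
    have "inorm v = inorm (inverse c \<cdot>\<^sub>v (c \<cdot>\<^sub>v v))"
      using False v by (simp add: smult_smult_assoc)
    also have "\<dots> \<le> cmod (inverse c) * inorm (c \<cdot>\<^sub>v v)"
      using v by (intro le) simp
    finally show ?thesis
      using le[OF v, of c] False by (simp add: norm_inverse norm_divide field_simps)
  qed
qed

lemma inorm_sum:
  assumes "finite A" "\<And>k. k \<in> A \<Longrightarrow> f k \<in> carrier_vec n"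
  shows "inorm (vec n (\<lambda>i. \<Sum>k\<in>A. f k $ i)) \<le> (\<Sum>k\<in>A. inorm (f k))"
  using assms
proof (induction A)
  case empty
  have "inorm (0 \<cdot>\<^sub>v 0\<^sub>v n) = 0"
    by (subst inorm_smult) auto
  then have "inorm (vec n (\<lambda>i. 0)) = 0"
    by (simp add: zero_vec_def smult_vec_def)
  then show ?case
    by simp
next
  case (insert a A)
  have "vec n (\<lambda>i. \<Sum>k\<in>insert a A. f k $ i) = f a + vec n (\<lambda>i. \<Sum>k\<in>A. f k $ i)"
    using insert by (auto simp: vec_eq_iff)
  then show ?case
    using insert inorm_add[of "f a" "vec n (\<lambda>i. \<Sum>k\<in>A. f k $ i)"] by force
qed

text \<open>A bound on the operator norm of \<open>\<rho> p\<close> - 1. Invariance of the norm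
  makes the bound depend only on the conjugacy class of p and makes it subadditive under products;
  the estimates below rest on these two properties.\<close>

definition near1 :: "quat \<Rightarrow> real \<Rightarrow> bool" where
  "near1 p e \<longleftrightarrow> (\<forall>v\<in>carrier_vec n. inorm (\<rho> p *\<^sub>v v - v) \<le> e * inorm v)"

lemma near1_conj:
  assumes "near1 p e" and p: "p \<in> SU2" and u: "u \<in> SU2"
  shows "near1 (qm u (qm p (qcnj u))) e"
  unfolding near1_def
proof
  fix v :: "complex vec" assume v: "v \<in> carrier_vec n"
  let ?w = "\<rho> (qcnj u) *\<^sub>v v"
  have w: "?w \<in> carrier_vec n"
    using v u by simp
  have "\<rho> (qm u (qm p (qcnj u))) *\<^sub>v v - v = \<rho> u *\<^sub>v (\<rho> p *\<^sub>v ?w) - \<rho> u *\<^sub>v ?w"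
    using v p u by (simp add: act_mult norm_qm)
  also have "\<dots> = \<rho> u *\<^sub>v (\<rho> p *\<^sub>v ?w - ?w)"
    using mult_minus_distrib_mat_vec[OF carrier[OF u], of "\<rho> p *\<^sub>v ?w" ?w] w p by simp
  finally have "inorm (\<rho> (qm u (qm p (qcnj u))) *\<^sub>v v - v) = inorm (\<rho> p *\<^sub>v ?w - ?w)"
    using u w p by simp
  also have "\<dots> \<le> e * inorm ?w"
    using assms(1) w unfolding near1_def by blast
  finally show "inorm (\<rho> (qm u (qm p (qcnj u))) *\<^sub>v v - v) \<le> e * inorm v"
    using v u by simp
qed

lemma near1_mult:
  assumes "near1 p a" "near1 q b" and p: "p \<in> SU2" and q: "q \<in> SU2"
  shows "near1 (qm p q) (a + b)"
  unfolding near1_def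
proof
  fix v :: "complex vec" assume v: "v \<in> carrier_vec n"
  have "\<rho> (qm p q) *\<^sub>v v - v = \<rho> p *\<^sub>v (\<rho> q *\<^sub>v v - v) + (\<rho> p *\<^sub>v v - v)"
    using v p q carrier[OF p] carrier[OF q] mult_minus_distrib_mat_vec[OF carrier[OF p], of "\<rho> q *\<^sub>v v" v]
    by (auto simp: act_mult vec_eq_iff simp del: index_mult_mat_vec)
  then have "inorm (\<rho> (qm p q) *\<^sub>v v - v) \<le> inorm (\<rho> p *\<^sub>v (\<rho> q *\<^sub>v v - v)) + inorm (\<rho> p *\<^sub>v v - v)"
    using v p q inorm_add[of "\<rho> p *\<^sub>v (\<rho> q *\<^sub>v v - v)" "\<rho> p *\<^sub>v v - v"] by simp
  also have "\<dots> \<le> b * inorm v + a * inorm v"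
    using v p q assms(1,2) unfolding near1_def by (intro add_mono) simp_all
  finally show "inorm (\<rho> (qm p q) *\<^sub>v v - v) \<le> (a + b) * inorm v"
    by (simp add: algebra_simps)
qed

text \<open>Every \<open>circ s\<close> with \<open>0 \<le> s \<le> t \<le> 1\<close> is a product of two conjugates of \<open>circ t\<close>.\<close>

lemma near1_circ_le:
  assumes "near1 (circ t) e" "0 \<le> s" "s \<le> t" "t \<le> 1"
  shows "near1 (circ s) (e + e)"
proof -
  have pi: "pi > 3"
    by (rule pi_gt3)
  \<comment> \<open>The first factor p gets the real part cos t and the first imaginary coordinate
    a. The second factor, the conjugate of p times \<open>circ s\<close>, then has the real part cos
    t cos s + a sin s, and this choice of a makes it cos t as well.\<close>
  define a where "a = cos t * tan (s / 2)"
  have ct: "cos t > 0"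
    using assms pi by (intro cos_gt_zero_pi) auto
  have cs: "cos (s / 2) > 0"
    using assms pi by (intro cos_gt_zero_pi) auto
  have a0: "0 \<le> a"
    unfolding a_def using ct assms pi tan_gt_zero[of "s / 2"]
    by (cases "s = 0") (auto intro!: mult_nonneg_nonneg less_imp_le)
  have "tan (s / 2) \<le> tan t"
    using assms pi by (cases "s / 2 = t") (auto intro!: less_imp_le tan_monotone)
  then have "a \<le> sin t"
    using ct unfolding a_def by (simp add: tan_def field_simps)
  then have a2: "a\<^sup>2 \<le> (sin t)\<^sup>2"
    using a0 by (intro power_mono)
  \<comment> \<open>The remaining coordinate gives p the norm 1. The square root is of a nonnegative
    number because a \<le> sin t, that is tan (s / 2) \<le> tan t.\<close>
  define p where "p = (Complex (cos t) a, complex_of_real (sqrt ((sin t)\<^sup>2 - a\<^sup>2)))"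
  have "(norm p)\<^sup>2 = 1"
    using a2 by (simp add: p_def norm_quat cmod_power2)
  then have p: "norm p = 1"
    using power2_eq_iff_nonneg[of "norm p" 1] by simp
  define q where "q = qm (qcnj p) (circ s)"
  have q: "norm q = 1"
    using p by (simp add: q_def norm_qm)
  have "Re (fst q) = cos t * cos s + a * sin s"
    by (simp add: q_def p_def qm_def qcnj_def circ_def)
  also have "\<dots> = cos t * (cos s + tan (s / 2) * sin s)"
    by (simp add: a_def algebra_simps)
  also have "cos s + tan (s / 2) * sin s = 1"
  proof -
    have "sin s = 2 * sin (s / 2) * cos (s / 2)" "cos s = 1 - 2 * (sin (s / 2))\<^sup>2"
      using sin_double[of "s / 2"] cos_double_sin[of "s / 2"] by simp_all
    then show ?thesis
      using cs by (simp add: tan_def power2_eq_square)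
  qed
  finally have Req: "Re (fst q) = cos t"
    by simp
  obtain u where u: "norm u = 1" "p = qm u (qm (circ t) (qcnj u))"
    using SU2_conj_circ[OF p, of t] by (auto simp: p_def)
  obtain v where v: "norm v = 1" "q = qm v (qm (circ t) (qcnj v))"
    using SU2_conj_circ[OF q Req] by auto
  have "near1 p e"
    using near1_conj[OF assms(1), of u] u(1) unfolding u(2)[symmetric] by simp
  moreover have "near1 q e"
    using near1_conj[OF assms(1), of v] v(1) unfolding v(2)[symmetric] by simp
  ultimately have "near1 (qm p q) (e + e)"
    using p q by (intro near1_mult) auto
  then show ?thesis
    using p by (simp add: q_def)
qed

section \<open>Fourier components along the circle\<close>

definition grid :: "nat \<Rightarrow> int \<Rightarrow> complex vec \<Rightarrow> complex vec" where
  "grid N j v = \<rho> (circ (2 * pi * of_int j / real N)) *\<^sub>v v"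

text \<open>The projection of v to the eigenspace where \<open>circ (2 * pi / N)\<close> acts as
  \<open>rou N k\<close>: a discrete Fourier coefficient of the orbit of v. It depends on k modulo N
  only.\<close>

definition weight_comp :: "nat \<Rightarrow> int \<Rightarrow> complex vec \<Rightarrow> complex vec" where
  "weight_comp N k v = vec n (\<lambda>i. (\<Sum>j\<in>{0..<int N}. rou N (- k * j) * grid N j v $ i) / of_nat N)"

lemma grid_carrier [simp]: "v \<in> carrier_vec n \<Longrightarrow> grid N j v \<in> carrier_vec n"
  by (simp add: grid_def)

lemma dim_grid [simp]: "v \<in> carrier_vec n \<Longrightarrow> dim_vec (grid N j v) = n"
  using carrier_vecD grid_carrier by blast

lemma weight_comp_carrier [simp]: "weight_comp N k v \<in> carrier_vec n"
  by (simp add: weight_comp_def)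

lemma grid_add: "v \<in> carrier_vec n \<Longrightarrow> grid N (j + m) v = grid N j (grid N m v)"
  unfolding grid_def by (subst act_mult[symmetric]) (simp_all add: circ_add[symmetric] add_divide_distrib distrib_left)

lemma grid_mult_self: "v \<in> carrier_vec n \<Longrightarrow> grid N (int N * j) v = v"
  by (cases "N = 0") (simp_all add: grid_def mult.assoc[symmetric] one)

lemma grid_mod: "v \<in> carrier_vec n \<Longrightarrow> grid N (j mod int N) v = grid N j v"
  using grid_add[of v N "int N * (j div int N)" "j mod int N"] grid_mult_self[of "grid N (j mod int N) v" N "j div int N"]
  by simp

lemma grid_index: "v \<in> carrier_vec n \<Longrightarrow> i < n \<Longrightarrow>
    grid N j v $ i = (\<Sum>l<n. \<rho> (circ (2 * pi * of_int j / real N)) $$ (i, l) * v $ l)"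
  unfolding grid_def by (rule act_index) auto

lemma rou_grid_periodic:
  assumes "v \<in> carrier_vec n"
  shows "rou N (- k * (j mod int N)) * grid N (j mod int N) v $ i = rou N (- k * j) * grid N j v $ i"
proof -
  have "rou N (- k * (j mod int N)) = rou N (- k * j)"
    by (metis rou_mod[of N "- k * (j mod int N)"] rou_mod[of N "- k * j"] mod_mult_right_eq)
  then show ?thesis
    using assms by (simp add: grid_mod)
qed

text \<open>The action of \<open>grid N m\<close> shifts the index of the sum by m, and the summands
  are periodic in this index.\<close>

lemma grid_weight_comp:
  assumes v: "v \<in> carrier_vec n" and N: "N > 0"
  shows "grid N m (weight_comp N k v) = rou N (k * m) \<cdot>\<^sub>v weight_comp N k v"
proof (rule eq_vecI)
  fix i assume "i < dim_vec (rou N (k * m) \<cdot>\<^sub>v weight_comp N k v)"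
  then have i: "i < n"
    by (simp add: weight_comp_def)
  let ?a = "\<lambda>l. \<rho> (circ (2 * pi * of_int m / real N)) $$ (i, l)"
  have "grid N m (weight_comp N k v) $ i =
      (\<Sum>l<n. ?a l * ((\<Sum>j\<in>{0..<int N}. rou N (- k * j) * grid N j v $ l) / of_nat N))"
    using i by (simp add: grid_index) (simp add: weight_comp_def)
  also have "\<dots> = (\<Sum>l<n. \<Sum>j\<in>{0..<int N}. rou N (- k * j) * (?a l * grid N j v $ l)) / of_nat N"
    by (simp add: sum_divide_distrib sum_distrib_left mult.left_commute)
  also have "\<dots> = (\<Sum>j\<in>{0..<int N}. rou N (- k * j) * (\<Sum>l<n. ?a l * grid N j v $ l)) / of_nat N"
    by (subst sum.swap) (simp add: sum_distrib_left)
  also have "\<dots> = (\<Sum>j\<in>{0..<int N}. rou N (- k * j) * grid N (j + m) v $ i) / of_nat N"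
    using v i by (simp add: grid_index[symmetric] grid_add[symmetric] add.commute)
  also have "\<dots> = (\<Sum>j\<in>{0..<int N}. rou N (k * m) * (rou N (- k * (j + m)) * grid N (j + m) v $ i)) / of_nat N"
  proof -
    have "rou N (k * m) * (rou N (- k * (j + m)) * x) = rou N (- k * j) * x" for j x
      by (simp add: mult.assoc[symmetric] rou_add[symmetric]) (simp add: algebra_simps)
    then show ?thesis
      by (simp only:)
  qed
  also have "\<dots> = rou N (k * m) * ((\<Sum>j\<in>{0..<int N}. rou N (- k * (j + m)) * grid N (j + m) v $ i) / of_nat N)"
    by (simp add: sum_distrib_left)
  also have "(\<Sum>j\<in>{0..<int N}. rou N (- k * (j + m)) * grid N (j + m) v $ i) =
      (\<Sum>j\<in>{0..<int N}. rou N (- k * j) * grid N j v $ i)"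
    by (rule sum_periodic_shift[OF N, of "\<lambda>j. rou N (- k * j) * grid N j v $ i"]) (rule rou_grid_periodic[OF v])
  finally show "grid N m (weight_comp N k v) $ i = (rou N (k * m) \<cdot>\<^sub>v weight_comp N k v) $ i"
    using i by (simp add: weight_comp_def)
qed (simp add: weight_comp_def grid_def carrier_matD[OF carrier])

text \<open>Fourier inversion on the cyclic group of order N, with any N consecutive
  frequencies.\<close>

lemma sum_weight_comp:
  assumes v: "v \<in> carrier_vec n" and N: "N > 0" and i: "i < n"
  shows "grid N m v $ i = (\<Sum>k\<in>{a..<a + int N}. rou N (k * m) * weight_comp N k v $ i)"
proof -
  have "(\<Sum>k\<in>{a..<a + int N}. rou N (k * m) * weight_comp N k v $ i) =
     (\<Sum>k\<in>{a..<a + int N}. \<Sum>j\<in>{0..<int N}. rou N (k * (m - j)) * grid N j v $ i) / of_nat N"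
  proof -
    have "rou N (k * m) * rou N (- (k * j)) = rou N (k * (m - j))" for k j
      by (simp add: rou_add[symmetric] algebra_simps)
    then show ?thesis
      using i by (simp add: weight_comp_def sum_divide_distrib sum_distrib_left mult.assoc[symmetric])
  qed
  also have "\<dots> = (\<Sum>j\<in>{0..<int N}. (\<Sum>k\<in>{a..<a + int N}. rou N (k * (m - j))) * grid N j v $ i) / of_nat N"
    by (subst sum.swap) (simp add: sum_distrib_right)
  also have "\<dots> = (\<Sum>j\<in>{0..<int N}. if j = m mod int N then of_nat N * grid N j v $ i else 0) / of_nat N"
  proof -
    have "int N dvd m - j \<longleftrightarrow> j = m mod int N" if "j \<in> {0..<int N}" for j
      using that by (simp add: mod_eq_dvd_iff[symmetric]) auto
    then show ?thesis
      by (intro arg_cong2[where f = "(/)"] sum.cong refl) (simp add: sum_rou[OF N])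
  qed
  also have "\<dots> = grid N m v $ i"
    using N v by (simp add: grid_mod)
  finally show ?thesis ..
qed

text \<open>The component is an average of N vectors, each of which is a translate of v times a
  phase and so has the norm of v.\<close>

lemma inorm_weight_comp_le:
  assumes v: "v \<in> carrier_vec n" and N: "N > 0"
  shows "inorm (weight_comp N k v) \<le> inorm v"
proof -
  have "weight_comp N k v = vec n (\<lambda>i. \<Sum>j\<in>{0..<int N}. ((rou N (- k * j) / of_nat N) \<cdot>\<^sub>v grid N j v) $ i)"
    using v by (auto simp: weight_comp_def vec_eq_iff sum_divide_distrib)
  then have "inorm (weight_comp N k v) \<le> (\<Sum>j\<in>{0..<int N}. inorm ((rou N (- k * j) / of_nat N) \<cdot>\<^sub>v grid N j v))"
    using v by (simp only:) (intro inorm_sum, auto)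
  also have "\<dots> = (\<Sum>j\<in>{0..<int N}. inorm v / real N)"
  proof (rule sum.cong[OF refl])
    fix j
    have "inorm (grid N j v) = inorm v"
      using v by (simp add: grid_def)
    then show "inorm ((rou N (- k * j) / of_nat N) \<cdot>\<^sub>v grid N j v) = inorm v / real N"
      using v by (simp add: inorm_smult norm_divide)
  qed
  also have "\<dots> = inorm v"
    using N by simp
  finally show ?thesis .
qed

definition weights :: "nat \<Rightarrow> int set" where
  "weights N = {k. \<exists>v\<in>carrier_vec n. weight_comp N k v \<noteq> 0\<^sub>v n}"

text \<open>Distinct weights modulo \<open>N\<close> give distinct roots of the characteristic polynomial of \<open>\<rho> (circ (2\<pi>/N))\<close>.\<close>

lemma card_weights:
  assumes N: "N > 0"
  shows "card (weights N \<inter> {0..<int N}) \<le> n"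
proof -
  let ?A = "\<rho> (circ (2 * pi / real N))"
  have A: "?A \<in> carrier_mat n n"
    by (intro carrier) simp
  have "rou N k \<in> {x. poly (char_poly ?A) x = 0}" if k: "k \<in> weights N" for k
  proof -
    obtain v where v: "v \<in> carrier_vec n" "weight_comp N k v \<noteq> 0\<^sub>v n"
      using k by (auto simp: weights_def)
    have "?A *\<^sub>v weight_comp N k v = rou N k \<cdot>\<^sub>v weight_comp N k v"
      using grid_weight_comp[OF v(1) N, of 1 k] by (simp add: grid_def)
    then have "eigenvalue ?A (rou N k)"
      using v(2) carrier_matD[OF A] unfolding eigenvalue_def eigenvector_def by (metis weight_comp_carrier)
    then show ?thesis
      using eigenvalue_root_char_poly[OF A] by simp
  qed
  moreover have "inj_on (rou N) (weights N \<inter> {0..<int N})"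
  proof (rule inj_onI)
    fix a b assume ab: "a \<in> weights N \<inter> {0..<int N}" "b \<in> weights N \<inter> {0..<int N}" "rou N a = rou N b"
    have "rou N a = rou N (a - b) * rou N b"
      by (simp flip: rou_add)
    then have "rou N (a - b) = 1"
      using ab(3) norm_rou[of N b] by (metis mult_cancel_right1 norm_zero zero_neq_one)
    then have "int N dvd a - b"
      by (rule rou_eq_1[OF N])
    then show "a = b"
      using ab by (auto simp: mod_eq_dvd_iff[symmetric])
  qed
  moreover have "char_poly ?A \<noteq> 0" "Polynomial.degree (char_poly ?A) = n"
    using degree_monic_char_poly[OF A] by auto
  ultimately have "card (weights N \<inter> {0..<int N}) \<le> card {x. poly (char_poly ?A) x = 0}"
    using poly_roots_finite[of "char_poly ?A"] by (intro card_inj_on_le[of "rou N"]) auto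
  also have "\<dots> \<le> n"
    using card_poly_roots_bound[OF \<open>char_poly ?A \<noteq> 0\<close>] \<open>Polynomial.degree (char_poly ?A) = n\<close> by simp
  finally show ?thesis .
qed

end

lemma angle_cancel:
  "M > 0 \<Longrightarrow> 2 * pi * of_int (int M * j) / real (M * N) = 2 * pi * of_int j / real N"
  by simp

lemma rou_cancel: "M > 0 \<Longrightarrow> rou (M * N) (k * (int M * j)) = rou N (k * j)"
  by (simp add: rou_def mult.assoc)

lemma rou_eq_cis: "rou N (k * j) = cis (of_int k * (2 * pi * of_int j / real N))"
  by (simp add: rou_def mult.left_commute)

lemma le_mult_self: "q > 0 \<Longrightarrow> m \<le> q * (m :: nat)"
  by simp

section \<open>A bound on the weights in terms of the dimension\<close>

context SU2_rep
begin

text \<open>Dirichlet's simultaneous approximation for the at most n phases: two multiples of the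
  angle put every phase into the same arc of length 2 pi / M, so their difference moves each of the
  at most n components by at most 2 pi / M times the norm of the vector.\<close>

lemma near1_recurrence:
  assumes M: "M > 0" and N: "N > M ^ n"
  obtains j where "1 \<le> j" "j \<le> M ^ n" "near1 (circ (2 * pi * real j / real N)) (real n * (2 * pi / real M))"
proof -
  let ?X = "weights N \<inter> {0..<int N}"
  have N0: "N > 0"
    using N by simp
  \<comment> \<open>The circle is cut into M arcs, and f j records for each weight k the arc that
    contains its phase after j steps. There are at most M^n such records for M^n + 1 values of
    j.\<close>
  define f where "f j = restrict (\<lambda>k. nat \<lfloor>real M * frac (real_of_int k * real j / real N)\<rfloor>) ?X" for j :: nat
  have fin: "finite ?X"
    by simp
  have "f ` {0..M ^ n} \<subseteq> PiE ?X (\<lambda>_. {..<M})"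
  proof -
    have "nat \<lfloor>real M * frac x\<rfloor> < M" for x :: real
    proof -
      have "real M * frac x < real M"
        using M frac_lt_1[of x] by simp
      then have "\<lfloor>real M * frac x\<rfloor> < int M"
        by (simp add: floor_less_iff)
      then show ?thesis
        using M by simp
    qed
    then show ?thesis
      by (intro image_subsetI PiE_I) (simp_all only: f_def restrict_apply if_True if_False lessThan_iff)
  qed
  then have "card (f ` {0..M ^ n}) \<le> card (PiE ?X (\<lambda>_. {..<M}))"
    by (intro card_mono finite_PiE fin) auto
  also have "\<dots> = M ^ card ?X"
    using fin by (simp add: card_PiE)
  also have "\<dots> \<le> M ^ n"
    using M card_weights[OF N0] by (intro power_increasing) auto
  finally have "\<not> inj_on f {0..M ^ n}"
    by (intro pigeonhole) simp
  then obtain a b where ab: "a < b" "b \<le> M ^ n" "f a = f b"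
    unfolding inj_on_def by (metis atLeastAtMost_iff linorder_neqE_nat)
  define j where "j = b - a"
  have close: "cmod (rou N (k * int j) - 1) \<le> 2 * pi / real M" if k: "k \<in> ?X" for k
  proof -
    define x where "x = real_of_int k * real a / real N"
    define y where "y = real_of_int k * real b / real N"
    have "nat \<lfloor>real M * frac x\<rfloor> = nat \<lfloor>real M * frac y\<rfloor>"
      using fun_cong[OF ab(3), of k] k by (simp add: f_def x_def y_def)
    moreover have "0 \<le> \<lfloor>real M * frac x\<rfloor>" "0 \<le> \<lfloor>real M * frac y\<rfloor>"
      by auto
    ultimately have "\<lfloor>real M * frac x\<rfloor> = \<lfloor>real M * frac y\<rfloor>"
      by (metis int_nat_eq)
    then have "\<bar>real M * frac y - real M * frac x\<bar> < 1"
      by linarith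
    then have "real M * \<bar>frac y - frac x\<bar> < 1"
      by (simp add: abs_mult flip: right_diff_distrib)
    then have d: "\<bar>frac y - frac x\<bar> \<le> 1 / real M"
      using M by (simp add: field_simps)
    have "y - x = real_of_int (k * int j) / real N"
      using ab by (simp add: x_def y_def j_def of_nat_diff diff_divide_distrib right_diff_distrib)
    then have "rou N (k * int j) = cis (2 * pi * (y - x))"
      by (simp add: rou_def)
    also have "\<dots> = cis (2 * pi * (frac y - frac x) + 2 * pi * real_of_int (\<lfloor>y\<rfloor> - \<lfloor>x\<rfloor>))"
      by (simp add: frac_def algebra_simps)
    also have "\<dots> = cis (2 * pi * (frac y - frac x))"
      by (simp only: cis_mult[symmetric] cis_multiple_2pi Ints_of_int mult_1_right)
    finally have "cmod (rou N (k * int j) - 1) \<le> \<bar>2 * pi * (frac y - frac x)\<bar>"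
      using cmod_cis_minus_1_le by simp
    also have "\<dots> \<le> 2 * pi * (1 / real M)"
      using mult_left_mono[OF d, of "2 * pi"] by (simp add: abs_mult)
    finally show ?thesis
      by simp
  qed
  have "near1 (circ (2 * pi * real j / real N)) (real n * (2 * pi / real M))"
    unfolding near1_def
  proof
    fix v :: "complex vec" assume v: "v \<in> carrier_vec n"
    have w0: "weight_comp N k v $ i = 0" if "k \<notin> weights N" "i < n" for k i
      using that v by (auto simp: weights_def)
    have "grid N (int j) v - v = vec n (\<lambda>i. \<Sum>k\<in>?X. ((rou N (k * int j) - 1) \<cdot>\<^sub>v weight_comp N k v) $ i)"
    proof (rule eq_vecI)
      fix i assume "i < dim_vec (vec n (\<lambda>i. \<Sum>k\<in>?X. ((rou N (k * int j) - 1) \<cdot>\<^sub>v weight_comp N k v) $ i))"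
      then have i: "i < n"
        by simp
      have "(grid N (int j) v - v) $ i = grid N (int j) v $ i - grid N 0 v $ i"
        using v i grid_mult_self[OF v, of N 0] by simp
      also have "\<dots> = (\<Sum>k\<in>{0..<int N}. (rou N (k * int j) - 1) * weight_comp N k v $ i)"
        using sum_weight_comp[OF v N0 i, of _ 0] by (simp add: sum_subtractf left_diff_distrib)
      also have "\<dots> = (\<Sum>k\<in>?X. (rou N (k * int j) - 1) * weight_comp N k v $ i)"
        using w0 i by (intro sum.mono_neutral_right) auto
      also have "\<dots> = (\<Sum>k\<in>?X. ((rou N (k * int j) - 1) \<cdot>\<^sub>v weight_comp N k v) $ i)"
        using i by (simp add: weight_comp_def)
      finally show "(grid N (int j) v - v) $ i =
          vec n (\<lambda>i. \<Sum>k\<in>?X. ((rou N (k * int j) - 1) \<cdot>\<^sub>v weight_comp N k v) $ i) $ i"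
        using i by simp
    qed (use v in simp)
    then have "inorm (grid N (int j) v - v) \<le> (\<Sum>k\<in>?X. inorm ((rou N (k * int j) - 1) \<cdot>\<^sub>v weight_comp N k v))"
      by (simp only:) (rule inorm_sum, auto)
    also have "\<dots> \<le> (\<Sum>k\<in>?X. 2 * pi / real M * inorm v)"
    proof (rule sum_mono)
      fix k assume k: "k \<in> ?X"
      have "cmod (rou N (k * int j) - 1) * inorm (weight_comp N k v) \<le> 2 * pi / real M * inorm v"
        using close[OF k] inorm_weight_comp_le[OF v N0] by (intro mult_mono) auto
      then show "inorm ((rou N (k * int j) - 1) \<cdot>\<^sub>v weight_comp N k v) \<le> 2 * pi / real M * inorm v"
        by (simp add: inorm_smult)
    qed
    also have "\<dots> = real (card ?X) * (2 * pi / real M * inorm v)"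
      by simp
    also have "\<dots> \<le> real n * (2 * pi / real M * inorm v)"
      using card_weights[OF N0] v by (intro mult_right_mono) auto
    finally show "inorm (\<rho> (circ (2 * pi * real j / real N)) *\<^sub>v v - v) \<le> real n * (2 * pi / real M) * inorm v"
      by (simp add: grid_def mult.assoc)
  qed
  then show ?thesis
    using ab that[of j] by (simp add: j_def)
qed

text \<open>The point is that this bound depends only on \<open>n\<close>.\<close>

definition weight_bound :: nat where
  "weight_bound = 7 * (26 * n + 1) ^ n"

lemma weight_bound_pos: "weight_bound > 0"
  by (simp add: weight_bound_def)

text \<open>The origin of the constants in \<open>weight_bound\<close>: since 26 > 8 pi, the choice
  M = 26 n + 1 makes the recurrence bound n 2 pi / M at most 1/4, which the passage to the whole arc
  doubles; since 7 > 2 pi, the recurrence angle 2 pi j / (7 M^n) is at most 1, as that passage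
  requires.\<close>

lemma near1_small_angle:
  assumes "0 \<le> s" "s \<le> 2 * pi / real weight_bound"
  shows "near1 (circ s) (1 / 2)"
proof -
  let ?N = weight_bound
  define M where "M = 26 * n + 1"
  define L where "L = M ^ n"
  have M0: "M > 0"
    by (simp add: M_def)
  have NL: "?N = 7 * L"
    unfolding weight_bound_def L_def M_def ..
  have "L > 0"
    using M0 by (simp add: L_def)
  then have "M ^ n < ?N"
    unfolding NL L_def[symmetric] by simp
  from near1_recurrence[OF M0 this] obtain j where j: "1 \<le> j" "j \<le> L"
      and near: "near1 (circ (2 * pi * real j / real ?N)) (real n * (2 * pi / real M))"
    unfolding L_def by blast
  define t where "t = 2 * pi * real j / real ?N"
  have "s \<le> t"
    using assms(2) j(1) weight_bound_pos unfolding t_def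
    by (elim order_trans) (intro divide_right_mono, auto)
  have "real j * 7 \<le> real ?N"
    using j(2) unfolding NL by simp
  moreover have "2 * pi < 7"
    using pi_less_4 pi_approx by simp
  ultimately have "2 * pi * real j \<le> real ?N"
    using mult_right_mono[of "2 * pi" 7 "real j"] by simp
  then have "t \<le> 1"
    using weight_bound_pos by (simp add: t_def field_simps)
  have "near1 (circ t) (1 / 4)"
  proof -
    have "real n * (2 * pi / real M) \<le> 1 / 4"
    proof -
      have "8 * pi < 26"
        using pi_approx by simp
      then have "real n * (8 * pi) \<le> real n * 26"
        by (intro mult_left_mono) auto
      then show ?thesis
        by (simp add: M_def field_simps)
    qed
    then have "real n * (2 * pi / real M) * inorm v \<le> 1 / 4 * inorm v" if "v \<in> carrier_vec n" for v
      using that by (intro mult_right_mono) auto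
    then show ?thesis
      using near unfolding near1_def t_def by (meson order_trans)
  qed
  from near1_circ_le[OF this assms(1) \<open>s \<le> t\<close> \<open>t \<le> 1\<close>] show ?thesis
    by simp
qed

text \<open>A weight k beyond the bound would turn too fast: some angle of at most 2 pi /
  \<open>weight_bound\<close> moves its eigenvector by between a quarter and three quarters of a
  turn, hence by at least sqrt 2 times its norm, whereas \<open>near1\<close> allows only
  1/2.\<close>

lemma weights_bounded:
  assumes k: "k \<in> weights N" and N: "N > 0" and kN: "2 * \<bar>k\<bar> \<le> int N"
  shows "\<bar>k\<bar> < int weight_bound"
proof (rule ccontr)
  assume "\<not> \<bar>k\<bar> < int weight_bound"
  then have large: "real weight_bound \<le> \<bar>real_of_int k\<bar>"
    by linarith
  define s where "s = 2 * pi * \<bar>real_of_int k\<bar> / real N"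
  have k0: "\<bar>real_of_int k\<bar> > 0"
    using large weight_bound_pos by linarith
  then have s0: "s > 0"
    using N by (simp add: s_def)
  have "2 * \<bar>real_of_int k\<bar> \<le> real N"
    using kN by linarith
  then have s_le: "s \<le> pi"
    using N unfolding s_def by (simp add: field_simps)
  \<comment> \<open>The least number of grid steps that brings the phase to a quarter turn. One step
    advances it by s \<le> pi, which is where 2 |k| \<le> N enters, so the phase stays below three
    quarters of a turn.\<close>
  define j where "j = nat \<lceil>(pi / 2) / s\<rceil>"
  have "0 \<le> pi / 2 / s"
    using s0 by simp
  then have "real j \<ge> pi / 2 / s" "real j < pi / 2 / s + 1"
    unfolding j_def by linarith+
  then have js: "real j * s \<ge> pi / 2" "real j * s < pi / 2 + s"
    using s0 by (simp_all add: field_simps)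
  define t where "t = 2 * pi * real j / real N"
  have kt: "\<bar>real_of_int k\<bar> * t = real j * s"
    by (simp add: t_def s_def)
  have "near1 (circ t) (1 / 2)"
  proof (rule near1_small_angle)
    show "0 \<le> t"
      by (simp add: t_def)
    have "\<bar>real_of_int k\<bar> * t \<le> 2 * pi"
      using js s_le kt by simp
    then have "real weight_bound * t \<le> 2 * pi"
      using mult_right_mono[OF large \<open>0 \<le> t\<close>] by simp
    then show "t \<le> 2 * pi / real weight_bound"
      using weight_bound_pos by (simp add: field_simps)
  qed
  obtain v where v: "v \<in> carrier_vec n" "weight_comp N k v \<noteq> 0\<^sub>v n"
    using k by (auto simp: weights_def)
  let ?w = "weight_comp N k v"
  have "grid N (int j) ?w - ?w = (cis (real_of_int k * t) - 1) \<cdot>\<^sub>v ?w"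
    using grid_weight_comp[OF v(1) N, of "int j" k]
    by (auto simp: vec_eq_iff left_diff_distrib rou_def t_def mult.assoc mult.left_commute)
  moreover have "inorm (grid N (int j) ?w - ?w) \<le> 1 / 2 * inorm ?w"
    using \<open>near1 (circ t) (1 / 2)\<close> unfolding near1_def t_def grid_def by simp
  ultimately have "cmod (cis (real_of_int k * t) - 1) * inorm ?w \<le> 1 / 2 * inorm ?w"
    by (simp add: inorm_smult)
  then have "cmod (cis (real_of_int k * t) - 1) \<le> 1 / 2"
    using inorm_pos[OF weight_comp_carrier v(2)] by (rule mult_right_le_imp_le)
  then have "(cmod (cis (real_of_int k * t) - 1))\<^sup>2 \<le> (1 / 2)\<^sup>2"
    by (intro power_mono) auto
  then have "2 - 2 * cos (real_of_int k * t) \<le> 1 / 4"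
    unfolding cmod_cis_minus_1 by (simp add: power2_eq_square)
  moreover have "cos (real_of_int k * t) = cos (real j * s)"
    unfolding kt[symmetric] by (auto simp: abs_if)
  moreover have "cos (real j * s) \<le> 0"
  proof -
    have "0 \<le> cos (real j * s - pi)"
      using js s_le by (intro cos_ge_zero) auto
    then show ?thesis
      by simp
  qed
  ultimately show False
    by simp
qed

text \<open>Frequencies of absolute value up to \<open>weight_bound\<close> differ by at most half
  of this N, so they are distinct modulo N and a grid of N points separates them.\<close>

definition wcomp :: "int \<Rightarrow> complex vec \<Rightarrow> complex vec" where
  "wcomp = weight_comp (4 * weight_bound)"

text \<open>Inversion over the window centred at 0. There 2 |k| \<le> N, so
  \<open>weights_bounded\<close> removes every frequency beyond the bound.\<close>

lemma grid_expansion: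
  assumes v: "v \<in> carrier_vec n" and N: "N \<ge> 4 * weight_bound" and i: "i < n"
  shows "grid N m v $ i = (\<Sum>k\<in>{- int weight_bound..int weight_bound}. rou N (k * m) * weight_comp N k v $ i)"
proof -
  have N0: "N > 0"
    using N weight_bound_pos by simp
  let ?a = "- int (N div 2)"
  have zero: "weight_comp N k v $ i = 0" if "k \<notin> {- int weight_bound..int weight_bound}" "2 * \<bar>k\<bar> \<le> int N" for k
  proof -
    have "k \<notin> weights N"
      using weights_bounded[of k N] N0 that by auto
    then show ?thesis
      using v i by (auto simp: weights_def)
  qed
  have "grid N m v $ i = (\<Sum>k\<in>{?a..<?a + int N}. rou N (k * m) * weight_comp N k v $ i)"
    by (rule sum_weight_comp[OF v N0 i])
  also have "\<dots> = (\<Sum>k\<in>{- int weight_bound..int weight_bound}. rou N (k * m) * weight_comp N k v $ i)"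
    using zero N weight_bound_pos by (intro sum.mono_neutral_right) auto
  finally show ?thesis .
qed

text \<open>The coarse grid is contained in the fine one. Expanding on the fine grid and then taking
  the coarse Fourier coefficient returns the fine component, because bounded frequencies do not
  alias. So the components are independent of the grid.\<close>

lemma weight_comp_refine:
  assumes v: "v \<in> carrier_vec n" and q: "q > 0" and l: "\<bar>l\<bar> \<le> int weight_bound" and i: "i < n"
  shows "weight_comp (q * (4 * weight_bound)) l v $ i = wcomp l v $ i"
proof -
  let ?N = "4 * weight_bound" and ?K = "{- int weight_bound..int weight_bound}"
  have N0: "?N > 0"
    using weight_bound_pos by simp
  have grid_eq: "grid (q * ?N) (int q * j) v = grid ?N j v" for j
    unfolding grid_def angle_cancel[OF q] ..
  have expand: "grid ?N j v $ i = (\<Sum>k\<in>?K. rou ?N (k * j) * weight_comp (q * ?N) k v $ i)" for j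
    using grid_expansion[OF v le_mult_self[OF q] i, of "int q * j"] unfolding grid_eq rou_cancel[OF q] .
  have "wcomp l v $ i = (\<Sum>j\<in>{0..<int ?N}. rou ?N (- l * j) * grid ?N j v $ i) / of_nat ?N"
    using i by (simp add: wcomp_def weight_comp_def)
  also have "\<dots> = (\<Sum>j\<in>{0..<int ?N}. rou ?N (- l * j) *
      (\<Sum>k\<in>?K. rou ?N (k * j) * weight_comp (q * ?N) k v $ i)) / of_nat ?N"
    by (simp only: expand)
  also have "\<dots> = (\<Sum>j\<in>{0..<int ?N}. \<Sum>k\<in>?K. rou ?N (j * (k - l)) * weight_comp (q * ?N) k v $ i) / of_nat ?N"
  proof -
    have "rou ?N (- l * j) * (rou ?N (k * j) * x) = rou ?N (j * (k - l)) * x" for j k x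
      by (simp add: mult.assoc[symmetric] rou_add[symmetric]) (simp add: algebra_simps)
    then show ?thesis
      by (simp only: sum_distrib_left)
  qed
  also have "\<dots> = (\<Sum>k\<in>?K. (\<Sum>j\<in>{0..<0 + int ?N}. rou ?N (j * (k - l))) * weight_comp (q * ?N) k v $ i) / of_nat ?N"
    by (subst sum.swap) (simp add: sum_distrib_right)
  also have "\<dots> = (\<Sum>k\<in>?K. if k = l then of_nat ?N * weight_comp (q * ?N) k v $ i else 0) / of_nat ?N"
  proof -
    have "int ?N dvd k - l \<longleftrightarrow> k = l" if "k \<in> ?K" for k
    proof
      assume "int ?N dvd k - l"
      moreover have "\<bar>k - l\<bar> < int ?N"
        using that l weight_bound_pos by auto
      ultimately show "k = l"
        using zdvd_imp_le[of "int ?N" "\<bar>k - l\<bar>"] by auto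
    qed simp
    then show ?thesis
      unfolding sum_rou[OF N0] by (intro arg_cong2[where f = "(/)"] sum.cong refl) simp
  qed
  also have "\<dots> = weight_comp (q * ?N) l v $ i"
    using l weight_bound_pos by (auto simp: sum.delta)
  finally show ?thesis
    by simp
qed

text \<open>The angle 2 pi a / q is a point of the grid with 4 q \<open>weight_bound\<close>
  points.\<close>

lemma circ_expansion_rat:
  assumes v: "v \<in> carrier_vec n" and q: "q > 0" and i: "i < n"
  shows "(\<rho> (circ (2 * pi * of_int a / real q)) *\<^sub>v v) $ i =
    (\<Sum>k\<in>{- int weight_bound..int weight_bound}. cis (of_int k * (2 * pi * of_int a / real q)) * wcomp k v $ i)"
proof -
  let ?N = "4 * weight_bound"
  have N0: "?N > 0"
    using weight_bound_pos by simp
  have "(\<rho> (circ (2 * pi * of_int a / real q)) *\<^sub>v v) $ i = grid (?N * q) (int ?N * a) v $ i"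
    unfolding grid_def angle_cancel[OF N0] ..
  also have "\<dots> = (\<Sum>k\<in>{- int weight_bound..int weight_bound}. rou (?N * q) (k * (int ?N * a)) * weight_comp (?N * q) k v $ i)"
    using le_mult_self[OF q, of ?N] unfolding mult.commute[of q] by (intro grid_expansion v i)
  also have "\<dots> = (\<Sum>k\<in>{- int weight_bound..int weight_bound}. cis (of_int k * (2 * pi * of_int a / real q)) * wcomp k v $ i)"
  proof (rule sum.cong[OF refl])
    fix k assume "k \<in> {- int weight_bound..int weight_bound}"
    then have "weight_comp (?N * q) k v $ i = wcomp k v $ i"
      using weight_comp_refine[OF v q _ i, of k] unfolding mult.commute[of q] by auto
    then show "rou (?N * q) (k * (int ?N * a)) * weight_comp (?N * q) k v $ i =
        cis (of_int k * (2 * pi * of_int a / real q)) * wcomp k v $ i"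
      unfolding rou_eq_cis angle_cancel[OF N0] by (simp only:)
  qed
  finally show ?thesis .
qed

text \<open>Both sides are continuous in t and agree at the rational multiples of 2 pi, which
  approximate every t.\<close>

lemma circ_expansion:
  assumes v: "v \<in> carrier_vec n" and i: "i < n"
  shows "(\<rho> (circ t) *\<^sub>v v) $ i = (\<Sum>k\<in>{- int weight_bound..int weight_bound}. cis (of_int k * t) * wcomp k v $ i)"
proof -
  define D where "D t = (\<rho> (circ t) *\<^sub>v v) $ i -
    (\<Sum>k\<in>{- int weight_bound..int weight_bound}. cis (of_int k * t) * wcomp k v $ i)" for t
  have circ: "continuous_on UNIV circ"
    unfolding circ_def by (intro continuous_intros)
  have "continuous_on UNIV (\<lambda>t. \<Sum>l<n. \<rho> (circ t) $$ (i, l) * v $ l)"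
    using i by (intro continuous_intros continuous_on_compose2[OF cont circ]) auto
  then have "continuous_on UNIV (\<lambda>t. (\<rho> (circ t) *\<^sub>v v) $ i)"
    by (rule continuous_on_eq) (simp add: act_index[OF _ v i])
  then have "continuous_on UNIV D"
    unfolding D_def by (intro continuous_intros)
  then have "isCont D t"
    using continuous_on_eq_continuous_at[OF open_UNIV] by blast
  moreover have "(\<lambda>m. 2 * pi * of_int \<lfloor>real m * (t / (2 * pi))\<rfloor> / real m) \<longlonglongrightarrow> t"
  proof -
    have "(\<lambda>m. of_int \<lfloor>real m * (t / (2 * pi))\<rfloor> / real m) \<longlonglongrightarrow> t / (2 * pi)"
    proof (rule tendsto_sandwich)
      show "\<forall>\<^sub>F m in sequentially. t / (2 * pi) - 1 / real m \<le> of_int \<lfloor>real m * (t / (2 * pi))\<rfloor> / real m"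
        using eventually_gt_at_top[of "0 :: nat"]
      proof eventually_elim
        case (elim m)
        have "real m * (t / (2 * pi)) - 1 \<le> of_int \<lfloor>real m * (t / (2 * pi))\<rfloor>"
          using real_of_int_floor_add_one_ge[of "real m * (t / (2 * pi))"] by simp
        then have "(real m * (t / (2 * pi)) - 1) / real m \<le> of_int \<lfloor>real m * (t / (2 * pi))\<rfloor> / real m"
          by (rule divide_right_mono) simp
        then show ?case
          using elim by (simp add: diff_divide_distrib)
      qed
      show "\<forall>\<^sub>F m in sequentially. of_int \<lfloor>real m * (t / (2 * pi))\<rfloor> / real m \<le> t / (2 * pi)"
        using eventually_gt_at_top[of "0 :: nat"]
      proof eventually_elim
        case (elim m)
        have "of_int \<lfloor>real m * (t / (2 * pi))\<rfloor> / real m \<le> (real m * (t / (2 * pi))) / real m"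
          by (rule divide_right_mono) simp_all
        then show ?case
          using elim by simp
      qed
      show "(\<lambda>m. t / (2 * pi) - 1 / real m) \<longlonglongrightarrow> t / (2 * pi)"
        using tendsto_diff[OF tendsto_const lim_1_over_n] by simp
    qed simp
    from tendsto_mult[OF tendsto_const[of "2 * pi"] this] show ?thesis
      by simp
  qed
  ultimately have lim: "(\<lambda>m. D (2 * pi * of_int \<lfloor>real m * (t / (2 * pi))\<rfloor> / real m)) \<longlonglongrightarrow> D t"
    by (rule isCont_tendsto_compose)
  have "\<forall>\<^sub>F m in sequentially. D (2 * pi * of_int \<lfloor>real m * (t / (2 * pi))\<rfloor> / real m) = 0"
    using eventually_gt_at_top[of "0 :: nat"]
    by eventually_elim (simp only: D_def circ_expansion_rat[OF v _ i] diff_self)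
  from tendsto_unique[OF sequentially_bot lim tendsto_eventually[OF this]] have "D t = 0" .
  then show ?thesis
    by (simp add: D_def)
qed

end

unbundle no vec_syntax

section \<open>Independence of matrix coefficients\<close>

lemma rep_carrier: "representation G M n \<rho> \<Longrightarrow> x \<in> carrier G \<Longrightarrow> \<rho> x \<in> carrier_mat n n"
  and rep_one: "representation G M n \<rho> \<Longrightarrow> \<rho> \<one>\<^bsub>G\<^esub> = 1\<^sub>m n"
  and rep_mult: "representation G M n \<rho> \<Longrightarrow> x \<in> carrier G \<Longrightarrow> y \<in> carrier G \<Longrightarrow> \<rho> (x \<otimes>\<^bsub>G\<^esub> y) = \<rho> x * \<rho> y"
  by (simp_all add: representation_def)

lemma invertible_mat_if_inverses:
  "A \<in> carrier_mat n n \<Longrightarrow> B \<in> carrier_mat n n \<Longrightarrow> A * B = 1\<^sub>m n \<Longrightarrow> B * A = 1\<^sub>m n \<Longrightarrow> invertible_mat A"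
  unfolding invertible_mat_def inverts_mat_def by auto

lemma invertible_mat_obtain_inverse:
  assumes "A \<in> carrier_mat n n" "invertible_mat A"
  obtains B where "B \<in> carrier_mat n n" "A * B = 1\<^sub>m n" "B * A = 1\<^sub>m n"
proof -
  obtain B where B: "A * B = 1\<^sub>m n" "B * A = 1\<^sub>m (dim_row B)"
    using assms unfolding invertible_mat_def inverts_mat_def by auto
  have "dim_col B = n" "dim_row B = n"
    using arg_cong[OF B(1), of dim_col] arg_cong[OF B(2), of dim_col] assms(1) by simp_all
  then show ?thesis
    using that[of B] B by auto
qed

lemma invertible_mat_if_inj:
  fixes A :: "complex mat"
  assumes A: "A \<in> carrier_mat n n" and inj: "\<And>v. v \<in> carrier_vec n \<Longrightarrow> A *\<^sub>v v = 0\<^sub>v n \<Longrightarrow> v = 0\<^sub>v n"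
  shows "invertible_mat A"
proof -
  have "det A \<noteq> 0"
    using det_0_iff_vec_prod_zero[OF A] inj by auto
  from det_non_zero_imp_unit[OF A this, of "()"] show ?thesis
    using A by (auto simp: Units_def ring_mat_def intro: invertible_mat_if_inverses)
qed

lemma eq_mat_if_mult_vec_eq:
  fixes A B :: "complex mat"
  assumes A: "A \<in> carrier_mat n n" and B: "B \<in> carrier_mat n n"
    and eq: "\<And>v. v \<in> carrier_vec n \<Longrightarrow> A *\<^sub>v v = B *\<^sub>v v"
  shows "A = B"
proof (rule eq_matI)
  fix i j assume ij: "i < dim_row B" "j < dim_col B"
  have "(A *\<^sub>v unit_vec n j) $ i = (B *\<^sub>v unit_vec n j) $ i"
    using eq by simp
  then show "A $$ (i, j) = B $$ (i, j)"
    using A B ij by simp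
qed (use A B in auto)

lemma rep_isomorphic_refl:
  assumes "representation G M n \<rho>"
  shows "rep_isomorphic G n \<rho> \<rho>"
proof -
  have "invertible_mat (1\<^sub>m n :: complex mat)"
    by (rule invertible_mat_if_inverses[of _ n "1\<^sub>m n"]) auto
  then show ?thesis
    using left_mult_one_mat[OF rep_carrier[OF assms]] right_mult_one_mat[OF rep_carrier[OF assms]]
    unfolding rep_isomorphic_def by (intro bexI[of _ "1\<^sub>m n"]) simp_all
qed

lemma rep_isomorphic_sym:
  assumes iso: "rep_isomorphic G n \<rho> \<sigma>" and \<rho>: "representation G M n \<rho>" and \<sigma>: "representation G M n \<sigma>"
  shows "rep_isomorphic G n \<sigma> \<rho>"
proof -
  obtain P where P: "P \<in> carrier_mat n n" "invertible_mat P" "\<And>x. x \<in> carrier G \<Longrightarrow> P * \<rho> x = \<sigma> x * P"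
    using iso unfolding rep_isomorphic_def by auto
  obtain Q where Q: "Q \<in> carrier_mat n n" "P * Q = 1\<^sub>m n" "Q * P = 1\<^sub>m n"
    using invertible_mat_obtain_inverse[OF P(1,2)] .
  have "Q * \<sigma> x = \<rho> x * Q" if x: "x \<in> carrier G" for x
  proof -
    note c = P(1) Q(1) rep_carrier[OF \<rho> x] rep_carrier[OF \<sigma> x]
    have "Q * \<sigma> x = Q * \<sigma> x * (P * Q)"
      using Q c by simp
    also have "\<dots> = Q * (\<sigma> x * P) * Q"
      using c by (simp add: assoc_mult_mat[of _ n n _ n _ n])
    also have "\<dots> = (Q * P) * \<rho> x * Q"
      using assoc_mult_mat[OF c(2,1,3)] P(3)[OF x] by simp
    also have "\<dots> = \<rho> x * Q"
      using c Q by simp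
    finally show ?thesis .
  qed
  then show ?thesis
    using Q P invertible_mat_if_inverses[of Q n P] unfolding rep_isomorphic_def by blast
qed

lemma rep_isomorphic_trans:
  assumes 1: "rep_isomorphic G n \<rho> \<sigma>" and 2: "rep_isomorphic G n \<sigma> \<tau>"
    and \<rho>: "representation G M n \<rho>" and \<sigma>: "representation G M n \<sigma>" and \<tau>: "representation G M n \<tau>"
  shows "rep_isomorphic G n \<rho> \<tau>"
proof -
  obtain P where P: "P \<in> carrier_mat n n" "invertible_mat P" "\<And>x. x \<in> carrier G \<Longrightarrow> P * \<rho> x = \<sigma> x * P"
    using 1 unfolding rep_isomorphic_def by auto
  obtain Q where Q: "Q \<in> carrier_mat n n" "invertible_mat Q" "\<And>x. x \<in> carrier G \<Longrightarrow> Q * \<sigma> x = \<tau> x * Q"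
    using 2 unfolding rep_isomorphic_def by auto
  have "Q * P * \<rho> x = \<tau> x * (Q * P)" if x: "x \<in> carrier G" for x
  proof -
    note c = P(1) Q(1) rep_carrier[OF \<rho> x] rep_carrier[OF \<sigma> x] rep_carrier[OF \<tau> x]
    have "Q * P * \<rho> x = Q * (\<sigma> x * P)"
      using assoc_mult_mat[OF c(2,1,3)] P(3)[OF x] by simp
    also have "\<dots> = (\<tau> x * Q) * P"
      using assoc_mult_mat[OF c(2,4,1)] Q(3)[OF x] by simp
    finally show ?thesis
      using assoc_mult_mat[OF c(5,2,1)] by simp
  qed
  moreover
  obtain P' where P': "P' \<in> carrier_mat n n" "P * P' = 1\<^sub>m n" "P' * P = 1\<^sub>m n"
    using invertible_mat_obtain_inverse[OF P(1,2)] .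
  obtain Q' where Q': "Q' \<in> carrier_mat n n" "Q * Q' = 1\<^sub>m n" "Q' * Q = 1\<^sub>m n"
    using invertible_mat_obtain_inverse[OF Q(1,2)] .
  note inv = P' Q'
  have "P * (P' * Q') = Q'" "Q' * (Q * P) = P"
    using assoc_mult_mat[OF P(1) P'(1) Q'(1)] assoc_mult_mat[OF Q'(1) Q(1) P(1)] P(1) P' Q' by simp_all
  then have "(Q * P) * (P' * Q') = 1\<^sub>m n" "(P' * Q') * (Q * P) = 1\<^sub>m n"
    using assoc_mult_mat[OF Q(1) P(1) mult_carrier_mat[OF P'(1) Q'(1)]]
      assoc_mult_mat[OF P'(1) Q'(1) mult_carrier_mat[OF Q(1) P(1)]] P' Q' by simp_all
  then have "invertible_mat (Q * P)"
    using inv P(1) Q(1) by (intro invertible_mat_if_inverses[of _ n "P' * Q'"]) auto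
  ultimately show ?thesis
    using P(1) Q(1) unfolding rep_isomorphic_def by (intro bexI[of _ "Q * P"]) auto
qed

abbreviation irr_iso :: "'a monoid \<Rightarrow> 'a manifold \<Rightarrow> nat \<Rightarrow> (('a \<Rightarrow> complex mat) \<times> ('a \<Rightarrow> complex mat)) set" where
  "irr_iso G M n \<equiv> {(\<rho>, \<sigma>). irreducible_rep G M n \<rho> \<and> irreducible_rep G M n \<sigma> \<and> rep_isomorphic G n \<rho> \<sigma>}"

lemma irreducible_rep_imp_rep: "irreducible_rep G M n \<rho> \<Longrightarrow> representation G M n \<rho>"
  by (simp add: irreducible_rep_def)

lemma equiv_irr_iso: "equiv {\<rho>. irreducible_rep G M n \<rho>} (irr_iso G M n)"
proof (rule equivI)
  show "irr_iso G M n \<subseteq> {\<rho>. irreducible_rep G M n \<rho>} \<times> {\<rho>. irreducible_rep G M n \<rho>}"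
    by auto
  show "refl_on {\<rho>. irreducible_rep G M n \<rho>} (irr_iso G M n)"
    by (auto simp: refl_on_def intro: rep_isomorphic_refl irreducible_rep_imp_rep)
  show "sym (irr_iso G M n)"
    by (auto simp: sym_on_def intro: rep_isomorphic_sym irreducible_rep_imp_rep)
  show "trans (irr_iso G M n)"
    unfolding trans_on_def using rep_isomorphic_trans irreducible_rep_imp_rep by blast
qed

lemma irreducible_rep_subspace:
  assumes "irreducible_rep G M n \<rho>" "vec_subspace n W"
    and "\<And>x w. x \<in> carrier G \<Longrightarrow> w \<in> W \<Longrightarrow> \<rho> x *\<^sub>v w \<in> W"
  shows "W = {0\<^sub>v n} \<or> W = carrier_vec n"
proof -
  have "\<forall>x\<in>carrier G. \<forall>w\<in>W. \<rho> x *\<^sub>v w \<in> W"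
    using assms(3) by blast
  then show ?thesis
    using assms(1,2) unfolding irreducible_rep_def by presburger
qed

lemma mult_mat_vec_index_linear:
  fixes A :: "complex mat"
  assumes A: "A \<in> carrier_mat n n" and i: "i < n"
  shows "v \<in> carrier_vec n \<Longrightarrow> w \<in> carrier_vec n \<Longrightarrow> (A *\<^sub>v (v + w)) $ i = (A *\<^sub>v v) $ i + (A *\<^sub>v w) $ i"
    and "v \<in> carrier_vec n \<Longrightarrow> (A *\<^sub>v (c \<cdot>\<^sub>v v)) $ i = c * (A *\<^sub>v v) $ i"
    and "(A *\<^sub>v 0\<^sub>v n) $ i = 0"
  using A i by (auto simp: scalar_prod_add_distrib[of _ n])

text \<open>The vectors whose translates all vanish at coordinate 0 form an invariant subspace. It
  does not contain the first unit vector, so it is zero.\<close>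

lemma irr_coeff_nonzero:
  assumes G: "group G" and irr: "irreducible_rep G M n \<rho>" and v: "v \<in> carrier_vec n"
    and zero: "\<And>g. g \<in> carrier G \<Longrightarrow> (\<rho> g *\<^sub>v v) $ 0 = 0"
  shows "v = 0\<^sub>v n"
proof -
  interpret group G by (rule G)
  note rep = irreducible_rep_imp_rep[OF irr]
  have n: "n > 0"
    using irr by (simp add: irreducible_rep_def)
  let ?W = "{w \<in> carrier_vec n. \<forall>g\<in>carrier G. (\<rho> g *\<^sub>v w) $ 0 = 0}"
  note lin = mult_mat_vec_index_linear[OF rep_carrier[OF rep] n]
  have subspace: "vec_subspace n ?W"
    unfolding vec_subspace_def using lin by (auto simp del: index_mult_mat_vec)
  have invariant: "\<rho> x *\<^sub>v w \<in> ?W" if x: "x \<in> carrier G" and w: "w \<in> ?W" for x w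
  proof -
    have "\<rho> g *\<^sub>v (\<rho> x *\<^sub>v w) = \<rho> (g \<otimes>\<^bsub>G\<^esub> x) *\<^sub>v w" if g: "g \<in> carrier G" for g
      using assoc_mult_mat_vec[OF rep_carrier[OF rep g] rep_carrier[OF rep x]] w by (simp add: rep_mult[OF rep g x])
    then show ?thesis
      using w x mult_mat_vec_carrier[OF rep_carrier[OF rep x]] by (auto simp del: index_mult_mat_vec)
  qed
  have "?W = {0\<^sub>v n} \<or> ?W = carrier_vec n"
    using irr subspace invariant by (rule irreducible_rep_subspace)
  moreover have "unit_vec n 0 \<notin> ?W"
    using n rep_one[OF rep] by (auto intro!: bexI[of _ "\<one>\<^bsub>G\<^esub>"])
  ultimately have "?W = {0\<^sub>v n}"
    by auto
  then show ?thesis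
    using v zero by blast
qed

text \<open>
  In a minimal linear relation between coefficient functions of irreducible representations,
  the vectors occurring at one representation determine those at another one. This
  correspondence is an isomorphism.
\<close>

lemma irr_coeffs_independent:
  fixes I :: "'i set"
  assumes G: "group G" and "finite I"
    and irr: "\<And>i. i \<in> I \<Longrightarrow> irreducible_rep G M n (\<rho> i)"
    and non_iso: "\<And>i j. i \<in> I \<Longrightarrow> j \<in> I \<Longrightarrow> i \<noteq> j \<Longrightarrow> \<not> rep_isomorphic G n (\<rho> i) (\<rho> j)"
    and v: "\<And>i. i \<in> I \<Longrightarrow> v i \<in> carrier_vec n"
    and rel: "\<And>g. g \<in> carrier G \<Longrightarrow> (\<Sum>i\<in>I. (\<rho> i g *\<^sub>v v i) $ 0) = 0"
    and "a \<in> I"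
  shows "v a = 0\<^sub>v n"
  using assms(2-)
proof (induction "card I" arbitrary: I v a rule: less_induct)
  case less
  interpret group G by (rule G)
  \<comment> \<open>All relations over the index set I. As g runs through the whole group, R is
    closed under translating all components at once, which is the fact \<open>act\<close>
    below.\<close>
  define R where "R = {w. (\<forall>i\<in>I. w i \<in> carrier_vec n) \<and> (\<forall>g\<in>carrier G. (\<Sum>i\<in>I. (\<rho> i g *\<^sub>v w i) $ 0) = 0)}"
  \<comment> \<open>A relation that vanishes at j is a relation over the smaller set without j,
    where the induction hypothesis applies.\<close>
  have minimal: "w i = 0\<^sub>v n" if w: "w \<in> R" and i: "i \<in> I" and j: "j \<in> I" "w j = 0\<^sub>v n" for w i j
  proof (cases "i = j")
    case False
    have "(\<Sum>i\<in>I - {j}. (\<rho> i g *\<^sub>v w i) $ 0) = 0" if g: "g \<in> carrier G" for g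
    proof -
      have rj: "representation G M n (\<rho> j)" and n: "n > 0"
        using less.prems(2)[OF j(1)] by (simp_all add: irreducible_rep_def)
      have "(\<Sum>i\<in>I. (\<rho> i g *\<^sub>v w i) $ 0) = 0"
        using w g unfolding R_def by blast
      moreover have "(\<rho> j g *\<^sub>v w j) $ 0 = 0"
        unfolding j(2) by (rule mult_mat_vec_index_linear(3)[OF rep_carrier[OF rj g] n])
      ultimately show ?thesis
        by (simp only: sum.remove[OF less.prems(1) j(1)] add_0)
    qed
    moreover have "card (I - {j}) < card I"
      using j less.prems(1) by (meson card_Diff1_less)
    ultimately show ?thesis
      using less.prems(1-3) w i False by (intro less.hyps[of "I - {j}" w i]) (simp_all add: R_def del: index_mult_mat_vec)
  qed (use j in simp)
  note rep = irreducible_rep_imp_rep[OF less.prems(2)]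
  have n: "n > 0"
    using less.prems(2)[OF less.prems(6)] by (simp add: irreducible_rep_def)
  \<comment> \<open>One closure property for several uses: m = 0, 2, 1 show that a projection of R
    is a subspace, m = 2 also gives differences, and m = n gives the map F.\<close>
  have comb: "(\<lambda>i. vec n (\<lambda>r. \<Sum>l<m. u $ l * w l i $ r)) \<in> R" if "\<And>l. l < m \<Longrightarrow> w l \<in> R" for w :: "nat \<Rightarrow> 'i \<Rightarrow> complex vec" and m u
  proof -
    have "(\<Sum>i\<in>I. (\<rho> i g *\<^sub>v vec n (\<lambda>r. \<Sum>l<m. u $ l * w l i $ r)) $ 0) = 0" if g: "g \<in> carrier G" for g
    proof -
      have "(\<rho> i g *\<^sub>v vec n (\<lambda>r. \<Sum>l<m. u $ l * w l i $ r)) $ 0 = (\<Sum>l<m. u $ l * (\<rho> i g *\<^sub>v w l i) $ 0)" if i: "i \<in> I" for i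
      proof -
        have c: "\<rho> i g \<in> carrier_mat n n"
          using rep_carrier[OF rep[OF i] g] .
        have wc: "dim_vec (w l i) = n" if "l < m" for l
          using \<open>\<And>l. l < m \<Longrightarrow> w l \<in> R\<close>[OF that] i by (auto simp: R_def)
        have "(\<rho> i g *\<^sub>v vec n (\<lambda>r. \<Sum>l<m. u $ l * w l i $ r)) $ 0 =
            (\<Sum>r\<in>{0..<n}. \<Sum>l<m. u $ l * (\<rho> i g $$ (0, r) * w l i $ r))"
          using c n by (simp add: scalar_prod_def sum_distrib_left mult.left_commute)
        also have "\<dots> = (\<Sum>l<m. u $ l * (\<Sum>r\<in>{0..<n}. \<rho> i g $$ (0, r) * w l i $ r))"
          by (subst sum.swap) (simp add: sum_distrib_left)
        also have "\<dots> = (\<Sum>l<m. u $ l * (\<rho> i g *\<^sub>v w l i) $ 0)"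
          using c n wc by (intro sum.cong refl) (simp add: scalar_prod_def)
        finally show ?thesis .
      qed
      then have "(\<Sum>i\<in>I. (\<rho> i g *\<^sub>v vec n (\<lambda>r. \<Sum>l<m. u $ l * w l i $ r)) $ 0) =
          (\<Sum>i\<in>I. \<Sum>l<m. u $ l * (\<rho> i g *\<^sub>v w l i) $ 0)"
        by (intro sum.cong refl)
      also have "\<dots> = (\<Sum>l<m. u $ l * (\<Sum>i\<in>I. (\<rho> i g *\<^sub>v w l i) $ 0))"
        by (subst sum.swap) (simp add: sum_distrib_left del: index_mult_mat_vec)
      also have "\<dots> = 0"
        using \<open>\<And>l. l < m \<Longrightarrow> w l \<in> R\<close> g by (intro sum.neutral) (auto simp: R_def simp del: index_mult_mat_vec)
      finally show ?thesis .
    qed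
    then show ?thesis
      by (simp add: R_def del: index_mult_mat_vec)
  qed
  have act: "(\<lambda>i. \<rho> i x *\<^sub>v w i) \<in> R" if w: "w \<in> R" and x: "x \<in> carrier G" for w x
  proof -
    have eq: "\<rho> i g *\<^sub>v (\<rho> i x *\<^sub>v w i) = \<rho> i (g \<otimes>\<^bsub>G\<^esub> x) *\<^sub>v w i" if "i \<in> I" "g \<in> carrier G" for i g
      using assoc_mult_mat_vec[OF rep_carrier[OF rep that(2)] rep_carrier[OF rep x]] that w
      by (simp add: rep_mult[OF rep that(2) x] R_def)
    show ?thesis
      unfolding R_def
    proof (intro CollectI conjI ballI)
      fix i assume "i \<in> I"
      then show "\<rho> i x *\<^sub>v w i \<in> carrier_vec n"
        using w mult_mat_vec_carrier[OF rep_carrier[OF rep x]] by (simp add: R_def)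
    next
      fix g assume g: "g \<in> carrier G"
      have "(\<Sum>i\<in>I. (\<rho> i g *\<^sub>v (\<rho> i x *\<^sub>v w i)) $ 0) = (\<Sum>i\<in>I. (\<rho> i (g \<otimes>\<^bsub>G\<^esub> x) *\<^sub>v w i) $ 0)"
        using eq g by (intro sum.cong refl) (simp only:)
      also have "\<dots> = 0"
        using w m_closed[OF g x] unfolding R_def by blast
      finally show "(\<Sum>i\<in>I. (\<rho> i g *\<^sub>v (\<rho> i x *\<^sub>v w i)) $ 0) = 0" .
    qed
  qed
  have Rdim: "dim_vec (z i) = n" if "z \<in> R" "i \<in> I" for z i
    using that by (simp add: R_def)
  have vR: "v \<in> R"
    using less.prems(4,5) by (simp add: R_def del: index_mult_mat_vec)
  show ?case
  proof (rule ccontr)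
    assume va: "v a \<noteq> 0\<^sub>v n"
    show False
    proof (cases "I = {a}")
      case True
      have "(\<rho> a g *\<^sub>v v a) $ 0 = 0" if "g \<in> carrier G" for g
        using less.prems(5)[OF that] unfolding True by (simp del: index_mult_mat_vec)
      then have "v a = 0\<^sub>v n"
        using irr_coeff_nonzero[OF G less.prems(2)[OF less.prems(6)] less.prems(4)[OF less.prems(6)]] by blast
      then show False
        using va by contradiction
    next
      case False
      then obtain b where b: "b \<in> I" "b \<noteq> a"
        using less.prems(6) by blast
      note ra = rep[OF less.prems(6)] and rb = rep[OF b(1)]
      \<comment> \<open>The components at a of all relations form an invariant subspace. It contains
        v a, which is not zero, so it is the whole space.\<close>
      let ?U = "(\<lambda>w. w a) ` R"
      have subspace: "vec_subspace n ?U"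
        unfolding vec_subspace_def
      proof (intro conjI ballI allI)
        show "?U \<subseteq> carrier_vec n"
          using less.prems(6) by (auto simp: R_def)
        have "(\<lambda>i. vec n (\<lambda>r. \<Sum>l<0. 0\<^sub>v 0 $ l * v i $ r)) \<in> R"
          by (rule comb[of 0 "\<lambda>_. v" "0\<^sub>v 0"]) simp
        then have "vec n (\<lambda>r. \<Sum>l<0. 0\<^sub>v 0 $ l * v a $ r) \<in> ?U"
          by (rule rev_image_eqI) simp
        then show "0\<^sub>v n \<in> ?U"
          by (simp add: zero_vec_def)
      next
        fix p q assume "p \<in> ?U" "q \<in> ?U"
        then obtain w z where wz: "w \<in> R" "p = w a" "z \<in> R" "q = z a"
          by auto
        have "(\<lambda>i. vec n (\<lambda>r. \<Sum>l<2. vec 2 (\<lambda>_. 1) $ l * (if l = 0 then w else z) i $ r)) \<in> R"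
          by (rule comb[of 2 "\<lambda>l. if l = 0 then w else z" "vec 2 (\<lambda>_. 1)"]) (use wz in auto)
        then have "vec n (\<lambda>r. \<Sum>l<2. vec 2 (\<lambda>_. 1) $ l * (if l = 0 then w else z) a $ r) \<in> ?U"
          by (rule rev_image_eqI) simp
        moreover have "vec n (\<lambda>r. \<Sum>l<2. vec 2 (\<lambda>_. 1) $ l * (if l = 0 then w else z) a $ r) = p + q"
          unfolding wz(2,4) using Rdim[OF wz(1) less.prems(6)] Rdim[OF wz(3) less.prems(6)]
          by (intro eq_vecI) (simp_all add: numeral_2_eq_2)
        ultimately show "p + q \<in> ?U"
          by simp
      next
        fix c p assume "p \<in> ?U"
        then obtain w where w: "w \<in> R" "p = w a"
          by auto
        have "(\<lambda>i. vec n (\<lambda>r. \<Sum>l<1. vec 1 (\<lambda>_. c) $ l * w i $ r)) \<in> R"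
          by (rule comb[of 1 "\<lambda>l. w" "vec 1 (\<lambda>_. c)"]) (use w in auto)
        then have "vec n (\<lambda>r. \<Sum>l<1. vec 1 (\<lambda>_. c) $ l * w a $ r) \<in> ?U"
          by (rule rev_image_eqI) simp
        moreover have "vec n (\<lambda>r. \<Sum>l<1. vec 1 (\<lambda>_. c) $ l * w a $ r) = c \<cdot>\<^sub>v p"
          unfolding w(2) using Rdim[OF w(1) less.prems(6)] by (intro eq_vecI) simp_all
        ultimately show "c \<cdot>\<^sub>v p \<in> ?U"
          by simp
      qed
      have invariant: "\<rho> a x *\<^sub>v w \<in> ?U" if "x \<in> carrier G" "w \<in> ?U" for x w
        using act that by (auto intro: rev_image_eqI)
      have "?U = {0\<^sub>v n} \<or> ?U = carrier_vec n"
        using less.prems(2)[OF less.prems(6)] subspace invariant by (rule irreducible_rep_subspace)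
      then have U: "?U = carrier_vec n"
        using vR va by blast
      have "\<exists>w. w \<in> R \<and> w a = unit_vec n l" for l
      proof -
        have "unit_vec n l \<in> ?U"
          unfolding U by simp
        then show ?thesis
          by (metis (no_types, lifting) imageE)
      qed
      then obtain w where w: "\<And>l. w l \<in> R" "\<And>l. w l a = unit_vec n l"
        by metis
      \<comment> \<open>F u is a relation with the component u at a, and P u is its component at
        b.\<close>
      define F where "F u = (\<lambda>i. vec n (\<lambda>r. \<Sum>l<n. u $ l * w l i $ r))" for u
      define P where "P = mat n n (\<lambda>(i, l). w l b $ i)"
      have P: "P \<in> carrier_mat n n"
        by (simp add: P_def)
      have F: "F u \<in> R" for u
        unfolding F_def using w(1) by (intro comb)
      have Fa: "F u a = u" if "u \<in> carrier_vec n" for u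
        using that by (intro eq_vecI) (simp_all add: F_def w(2) unit_vec_def if_distrib cong: if_cong)
      have Fb: "F u b = P *\<^sub>v u" if "u \<in> carrier_vec n" for u
        using that by (intro eq_vecI) (simp_all add: F_def P_def scalar_prod_def lessThan_atLeast0 mult.commute)
      \<comment> \<open>By minimality a relation is determined by its component at a, so P yields
        the component at b of every relation. Since R is invariant, P is an intertwiner.\<close>
      have PR: "z b = P *\<^sub>v z a" if z: "z \<in> R" for z
      proof -
        have za: "z a \<in> carrier_vec n" and zb: "z b \<in> carrier_vec n"
          using z less.prems(6) b by (auto simp: R_def)
        define d where "d = (\<lambda>i. vec n (\<lambda>r. \<Sum>l<2. vec 2 (\<lambda>l. if l = 0 then 1 else - 1) $ l * (if l = 0 then z else F (z a)) i $ r))"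
        have d: "d \<in> R"
          unfolding d_def by (rule comb) (use z F in auto)
        have "d a = 0\<^sub>v n"
          using za by (intro eq_vecI) (simp_all add: d_def Fa numeral_2_eq_2)
        then have "d b = 0\<^sub>v n"
          using minimal[OF d b(1) less.prems(6)] by simp
        then have "d b $ i = 0" if "i < n" for i
          using that by simp
        then have "z b $ i = F (z a) b $ i" if "i < n" for i
          using that by (simp add: d_def numeral_2_eq_2)
        then show ?thesis
          unfolding Fb[OF za, symmetric] using Rdim[OF z b(1)] Rdim[OF F b(1)] by (intro eq_vecI) simp_all
      qed
      have "P * \<rho> a x = \<rho> b x * P" if x: "x \<in> carrier G" for x
      proof (rule eq_mat_if_mult_vec_eq[of _ n])
        fix u :: "complex vec" assume u: "u \<in> carrier_vec n"
        have "\<rho> b x *\<^sub>v F u b = P *\<^sub>v (\<rho> a x *\<^sub>v F u a)"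
          using PR[OF act[OF F x]] .
        then show "(P * \<rho> a x) *\<^sub>v u = (\<rho> b x * P) *\<^sub>v u"
          unfolding Fa[OF u] Fb[OF u] assoc_mult_mat_vec[OF P rep_carrier[OF ra x] u]
            assoc_mult_mat_vec[OF rep_carrier[OF rb x] P u] by (rule sym)
      qed (use P rep_carrier[OF ra x] rep_carrier[OF rb x] in auto)
      \<comment> \<open>Minimality with the roles of a and b exchanged: a relation that vanishes at
        b vanishes at a.\<close>
      moreover have "invertible_mat P"
      proof (rule invertible_mat_if_inj[OF P])
        fix u assume u: "u \<in> carrier_vec n" "P *\<^sub>v u = 0\<^sub>v n"
        then show "u = 0\<^sub>v n"
          using minimal[OF F less.prems(6) b(1)] Fa[OF u(1)] Fb[OF u(1)] by metis
      qed
      ultimately have "rep_isomorphic G n (\<rho> a) (\<rho> b)"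
        using P unfolding rep_isomorphic_def by blast
      then show False
        using less.prems(3,6) b by blast
    qed
  qed
qed

section \<open>Finiteness of the number of irreducible representations\<close>

inductive fspan :: "('x \<Rightarrow> complex) set \<Rightarrow> ('x \<Rightarrow> complex) \<Rightarrow> bool" for B where
  zero: "fspan B (\<lambda>_. 0)"
| step: "fspan B f \<Longrightarrow> b \<in> B \<Longrightarrow> fspan B (\<lambda>x. f x + c * b x)"

lemma fspan_base: "b \<in> B \<Longrightarrow> fspan B (\<lambda>x. c * b x)"
  using fspan.step[OF fspan.zero, of b B c] by simp

lemma fspan_add: "fspan B g \<Longrightarrow> fspan B f \<Longrightarrow> fspan B (\<lambda>x. f x + g x)"
proof (induction rule: fspan.induct)
  case (step g b c)
  then show ?case
    using fspan.step[of B "\<lambda>x. f x + g x" b c] by (simp add: add.assoc)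
qed simp

lemma fspan_scale: "fspan B f \<Longrightarrow> fspan B (\<lambda>x. a * f x)"
proof (induction rule: fspan.induct)
  case (step f b c)
  then show ?case
    using fspan.step[of B "\<lambda>x. a * f x" b "a * c"] by (simp add: distrib_left mult.assoc)
qed (simp add: fspan.zero)

lemma fspan_sum: "finite A \<Longrightarrow> (\<And>i. i \<in> A \<Longrightarrow> fspan B (f i)) \<Longrightarrow> fspan B (\<lambda>x. \<Sum>i\<in>A. f i x)"
proof (induction A rule: finite_induct)
  case (insert a A)
  then show ?case
    using fspan_add[of B "\<lambda>x. \<Sum>i\<in>A. f i x" "f a"] by simp
qed (simp add: fspan.zero)

text \<open>Pairwise products span all products of two spans, so a finite spanning set for the
  entries survives matrix multiplication.\<close>

definition fprod :: "('x \<Rightarrow> complex) set \<Rightarrow> ('x \<Rightarrow> complex) set \<Rightarrow> ('x \<Rightarrow> complex) set" where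
  "fprod B C = (\<lambda>(b, c) x. b x * c x) ` (B \<times> C)"

lemma finite_fprod [simp]: "finite B \<Longrightarrow> finite C \<Longrightarrow> finite (fprod B C)"
  by (simp add: fprod_def)

lemma fspan_mult: "fspan C g \<Longrightarrow> fspan B f \<Longrightarrow> fspan (fprod B C) (\<lambda>x. f x * g x)"
proof (induction rule: fspan.induct)
  case (step g c a)
  from step.prems step.hyps(2) have "fspan (fprod B C) (\<lambda>x. f x * c x)"
  proof (induction rule: fspan.induct)
    case (step f b d)
    then have "(\<lambda>x. b x * c x) \<in> fprod B C"
      by (auto simp: fprod_def)
    with step show ?case
      using fspan.step[of "fprod B C" "\<lambda>x. f x * c x" "\<lambda>x. b x * c x" d] by (simp add: distrib_right mult.assoc)
  qed (simp add: fspan.zero)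
  from fspan_add[OF fspan_scale[OF this, of a] step.IH[OF step.prems]] show ?case
    by (simp add: distrib_left mult_ac)
qed (simp add: fspan.zero)

lemma fspan_coeffs:
  assumes "finite B" "fspan B f"
  shows "\<exists>c. \<forall>x. f x = (\<Sum>b\<in>B. c b * b x)"
  using assms(2)
proof (induction rule: fspan.induct)
  case zero
  show ?case
    by (intro exI[of _ "\<lambda>_. 0"]) simp
next
  case (step f b a)
  then obtain c where c: "f x = (\<Sum>b\<in>B. c b * b x)" for x
    by auto
  have "f x + a * b x = (\<Sum>b'\<in>B. (c(b := c b + a)) b' * b' x)" for x
    using assms(1) step.hyps(2) by (simp add: c sum.remove[of B b] distrib_right)
  then show ?case
    by blast
qed

text \<open>Gaussian elimination: the equation b is solved for the unknown at a pivot j and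
  substituted into the others, which leaves one equation and one unknown fewer.\<close>

lemma underdetermined_system:
  fixes c :: "'i \<Rightarrow> 'b \<Rightarrow> complex"
  assumes "finite B" "finite I" "card B < card I"
  shows "\<exists>l. (\<exists>i\<in>I. l i \<noteq> 0) \<and> (\<forall>b\<in>B. (\<Sum>i\<in>I. l i * c i b) = 0)"
  using assms
proof (induction B arbitrary: I c rule: finite_induct)
  case empty
  then have "I \<noteq> {}"
    by auto
  then show ?case
    by (intro exI[of _ "\<lambda>_. 1"]) auto
next
  case (insert b B)
  show ?case
  proof (cases "\<forall>i\<in>I. c i b = 0")
    case True
    obtain l where "\<exists>i\<in>I. l i \<noteq> 0" "\<forall>b\<in>B. (\<Sum>i\<in>I. l i * c i b) = 0"
      using insert.IH[of I c] insert.prems insert.hyps by auto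
    with True show ?thesis
      by (intro exI[of _ l]) auto
  next
    case False
    then obtain j where j: "j \<in> I" "c j b \<noteq> 0"
      by auto
    define d where "d i b' = c i b' - c i b / c j b * c j b'" for i b'
    have "card B < card (I - {j})"
      using insert.prems insert.hyps j(1) by simp
    then obtain l where l: "\<exists>i\<in>I - {j}. l i \<noteq> 0" "\<forall>b'\<in>B. (\<Sum>i\<in>I - {j}. l i * d i b') = 0"
      using insert.IH[of "I - {j}" d] insert.prems by auto
    define s where "s = - (\<Sum>i\<in>I - {j}. l i * c i b) / c j b"
    define m where "m = l(j := s)"
    have split: "(\<Sum>i\<in>I. m i * c i b') = s * c j b' + (\<Sum>i\<in>I - {j}. l i * c i b')" for b'
      unfolding sum.remove[OF insert.prems(1) j(1)] by (simp add: m_def)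
    have "(\<Sum>i\<in>I. m i * c i b') = 0" if b': "b' \<in> insert b B" for b'
    proof (cases "b' = b")
      case True
      then show ?thesis
        using j(2) by (simp add: split s_def)
    next
      case False
      have "(\<Sum>i\<in>I - {j}. l i * d i b') =
          (\<Sum>i\<in>I - {j}. l i * c i b') - (\<Sum>i\<in>I - {j}. l i * c i b) / c j b * c j b'"
        by (simp add: d_def right_diff_distrib sum_subtractf sum_distrib_right sum_divide_distrib mult.assoc)
      then show ?thesis
        using l(2) b' False by (simp add: split s_def)
    qed
    moreover have "\<exists>i\<in>I. m i \<noteq> 0"
      using l(1) by (auto simp: m_def)
    ultimately show ?thesis
      by blast
  qed
qed

section \<open>Matrix coefficients as functions of Euler angles\<close>

definition mspan :: "nat \<Rightarrow> ('x \<Rightarrow> complex) set \<Rightarrow> ('x \<Rightarrow> complex mat) \<Rightarrow> bool" where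
  "mspan n B A \<longleftrightarrow> (\<forall>x. A x \<in> carrier_mat n n) \<and> (\<forall>i<n. \<forall>j<n. fspan B (\<lambda>x. A x $$ (i, j)))"

lemma mspan_mult:
  assumes "mspan n B A" "mspan n C A'"
  shows "mspan n (fprod B C) (\<lambda>x. A x * A' x)"
proof -
  have c: "A x \<in> carrier_mat n n" "A' x \<in> carrier_mat n n" for x
    using assms by (auto simp: mspan_def)
  have "fspan (fprod B C) (\<lambda>x. (A x * A' x) $$ (i, j))" if ij: "i < n" "j < n" for i j
  proof -
    have "fspan (fprod B C) (\<lambda>x. \<Sum>l<n. A x $$ (i, l) * A' x $$ (l, j))"
      using assms ij unfolding mspan_def by (intro fspan_sum fspan_mult) auto
    moreover have "(A x * A' x) $$ (i, j) = (\<Sum>l<n. A x $$ (i, l) * A' x $$ (l, j))" for x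
      using c[of x] ij by (simp add: scalar_prod_def lessThan_atLeast0)
    ultimately show ?thesis
      by simp
  qed
  moreover have "A x * A' x \<in> carrier_mat n n" for x
    using c by (rule mult_carrier_mat)
  ultimately show ?thesis
    by (simp add: mspan_def)
qed

lemma fspan_const: "fspan {\<lambda>_. 1} (\<lambda>_. c)"
  using fspan_base[of "\<lambda>_. 1" "{\<lambda>_. 1}" c] by simp

lemma mspan_const: "A \<in> carrier_mat n n \<Longrightarrow> mspan n {\<lambda>_. 1} (\<lambda>_. A)"
  by (simp add: mspan_def fspan_const)

text \<open>The frequencies that \<open>weight_bound\<close> admits, in the angle with index m. The
  set is determined by n and m alone and so is common to all representations of dimension n.\<close>

definition trig_funs :: "nat \<Rightarrow> nat \<Rightarrow> ((nat \<Rightarrow> real) \<Rightarrow> complex) set" where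
  "trig_funs n m = (\<lambda>k x. cis (of_int k * x m)) ` {- int (SU2_rep.weight_bound n)..int (SU2_rep.weight_bound n)}"

lemma finite_trig_funs [simp]: "finite (trig_funs n m)"
  by (simp add: trig_funs_def)

context SU2_rep
begin

lemma mspan_circ: "mspan n (trig_funs n m) (\<lambda>x. \<rho> (circ (x m)))"
proof -
  have "fspan (trig_funs n m) (\<lambda>x. \<rho> (circ (x m)) $$ (i, j))" if "i < n" "j < n" for i j
  proof -
    have "\<rho> (circ (x m)) $$ (i, j) = (\<Sum>k\<in>{- int weight_bound..int weight_bound}. wcomp k (unit_vec n j) $ i * cis (of_int k * x m))" for x :: "nat \<Rightarrow> real"
    proof -
      have "\<rho> (circ (x m)) $$ (i, j) = (\<rho> (circ (x m)) *\<^sub>v unit_vec n j) $ i"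
        using carrier[of "circ (x m)"] that by simp
      then show ?thesis
        using circ_expansion[of "unit_vec n j" i "x m"] that by (simp add: mult.commute)
    qed
    moreover have "fspan (trig_funs n m) (\<lambda>x. \<Sum>k\<in>{- int weight_bound..int weight_bound}. wcomp k (unit_vec n j) $ i * cis (of_int k * x m))"
      by (intro fspan_sum fspan_base) (auto simp: trig_funs_def)
    ultimately show ?thesis
      by simp
  qed
  moreover have "\<rho> (circ (x m)) \<in> carrier_mat n n" for x :: "nat \<Rightarrow> real"
    by (rule carrier) simp
  ultimately show ?thesis
    by (simp add: mspan_def)
qed

text \<open>Conjugation by the fixed element u carries \<open>circ\<close> to \<open>rot\<close>;
  the two factors {1} span the constant entries of \<open>\<rho> u\<close> and
  \<open>\<rho> (qcnj u)\<close>.\<close>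

lemma mspan_rot: "mspan n (fprod (fprod {\<lambda>_. 1} (trig_funs n m)) {\<lambda>_. 1}) (\<lambda>x. \<rho> (rot (x m)))"
proof -
  obtain u where u: "norm u = 1" "\<And>t. rot t = qm u (qm (circ t) (qcnj u))"
    using rot_conj_circ by auto
  have "\<rho> (rot t) = \<rho> u * \<rho> (circ t) * \<rho> (qcnj u)" for t
    unfolding u(2) qm_assoc[symmetric] using u(1) by (simp add: mult norm_qm)
  moreover have "mspan n (fprod (fprod {\<lambda>_. 1} (trig_funs n m)) {\<lambda>_. 1}) (\<lambda>x. \<rho> u * \<rho> (circ (x m)) * \<rho> (qcnj u))"
    using u(1) by (intro mspan_mult mspan_circ mspan_const carrier) auto
  ultimately show ?thesis
    by simp
qed

lemma mspan_euler:
  "mspan n (fprod (trig_funs n a) (fprod (fprod (fprod {\<lambda>_. 1} (trig_funs n b)) {\<lambda>_. 1}) (trig_funs n c)))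
    (\<lambda>x. \<rho> (qm (circ (x a)) (qm (rot (x b)) (circ (x c)))))"
proof -
  have "\<rho> (qm (circ s) (qm (rot t) (circ r))) = \<rho> (circ s) * (\<rho> (rot t) * \<rho> (circ r))" for r s t
    by (simp add: mult norm_qm)
  then show ?thesis
    by (simp only:) (intro mspan_mult mspan_circ mspan_rot)
qed

end

definition tuple_group :: "(nat \<Rightarrow> quat) monoid" where
  "tuple_group = \<lparr>carrier = tuples, mult = tmul, one = tone\<rparr>"

text \<open>Representations depend only on the topology of a manifold, so the atlas can be left empty.\<close>

definition tuple_space :: "(nat \<Rightarrow> quat) manifold" where
  "tuple_space = \<lparr>mtop = top_of_set tuples, mdim = 0, atlas = {}\<rparr>"

lemma tuple_group_simps [simp]:
  "carrier tuple_group = tuples" "mult tuple_group = tmul" "one tuple_group = tone"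
  by (simp_all add: tuple_group_def)

lemma group_tuple_group: "group tuple_group"
proof (rule groupI)
  fix x assume "x \<in> carrier tuple_group"
  then show "\<exists>y\<in>carrier tuple_group. y \<otimes>\<^bsub>tuple_group\<^esub> x = \<one>\<^bsub>tuple_group\<^esub>"
    by (intro bexI[of _ "tinv x"]) auto
qed (auto simp: tmul_assoc)

definition coord :: "nat \<Rightarrow> quat \<Rightarrow> nat \<Rightarrow> quat" where
  "coord c p = (\<lambda>i. if i = c then p else (1, 0))"

lemma coord_tuples [simp]: "c < 6 \<Longrightarrow> norm p = 1 \<Longrightarrow> coord c p \<in> tuples"
  by (auto simp: coord_def tuples_def norm_Pair)

lemma coord_one [simp]: "coord c (1, 0) = tone"
  by (auto simp: coord_def tone_def)

lemma coord_mult: "coord c (qm p q) = tmul (coord c p) (coord c q)"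
  by (auto simp: coord_def tmul_def)

lemma SU2_rep_coord:
  assumes rep: "representation tuple_group tuple_space n \<rho>" and c: "c < 6"
  shows "SU2_rep n (\<lambda>p. \<rho> (coord c p))"
proof
  show "\<rho> (coord c (1, 0)) = 1\<^sub>m n"
    using rep_one[OF rep] by simp
  show "\<rho> (coord c p) \<in> carrier_mat n n" if "p \<in> SU2" for p
    using rep_carrier[OF rep, of "coord c p"] that c by simp
  show "\<rho> (coord c (qm p q)) = \<rho> (coord c p) * \<rho> (coord c q)" if "p \<in> SU2" "q \<in> SU2" for p q
    using rep_mult[OF rep, of "coord c p" "coord c q"] that c by (simp add: coord_mult)
  show "continuous_on SU2 (\<lambda>p. \<rho> (coord c p) $$ (i, j))" if "i < n" "j < n" for i j
  proof -
    have "continuous_on tuples (\<lambda>x. \<rho> x $$ (i, j))"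
      using rep that by (simp add: representation_def tuple_space_def)
    moreover have "continuous_on SU2 (coord c)"
    proof (rule continuous_on_coordinatewise_then_product)
      show "continuous_on SU2 (\<lambda>p. coord c p i)" for i
        by (cases "i = c") (simp_all add: coord_def continuous_on_id)
    qed
    ultimately show ?thesis
      by (rule continuous_on_compose2) (use c in auto)
  qed
qed

text \<open>Three Euler angles for each factor. Filling only the first m factors allows an induction
  on m.\<close>

definition euler_tuple :: "nat \<Rightarrow> (nat \<Rightarrow> real) \<Rightarrow> nat \<Rightarrow> quat" where
  "euler_tuple m x = (\<lambda>i. if i < m then qm (circ (x (3 * i))) (qm (rot (x (3 * i + 1))) (circ (x (3 * i + 2)))) else (1, 0))"

lemma euler_tuple_tuples: "m \<le> 6 \<Longrightarrow> euler_tuple m x \<in> tuples"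
  by (auto simp: euler_tuple_def tuples_def norm_qm norm_Pair)

lemma euler_tuple_Suc:
  "euler_tuple (Suc m) x = tmul (euler_tuple m x) (coord m (qm (circ (x (3 * m))) (qm (rot (x (3 * m + 1))) (circ (x (3 * m + 2))))))"
  by (auto simp: euler_tuple_def coord_def tmul_def less_Suc_eq)

lemma euler_tuple_surj:
  assumes "y \<in> tuples"
  obtains x where "y = euler_tuple 6 x"
proof -
  have "\<exists>a b c. y i = qm (circ a) (qm (rot b) (circ c))" for i
    using SU2_euler[OF norm_tuples[OF assms, of i]] by metis
  then obtain a b c where abc: "\<And>i. y i = qm (circ (a i)) (qm (rot (b i)) (circ (c i)))"
    by metis
  define x where "x m = (if m mod 3 = 0 then a (m div 3) else if m mod 3 = 1 then b (m div 3) else c (m div 3))" for m :: nat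
  have "x (3 * i) = a i" "x (3 * i + 1) = b i" "x (3 * i + 2) = c i" for i
  proof -
    have "(3 * i + 1) mod 3 = 1" "(3 * i + 2) mod 3 = 2" "(3 * i + 1) div 3 = i" "(3 * i + 2) div 3 = i"
      by presburger+
    then show "x (3 * i) = a i" "x (3 * i + 1) = b i" "x (3 * i + 2) = c i"
      unfolding x_def by simp_all
  qed
  then have "y = euler_tuple 6 x"
    using assms by (auto simp: euler_tuple_def abc[symmetric] tuples_def)
  then show ?thesis
    by (rule that)
qed

text \<open>The order of the quantifiers is the point: one finite set B serves all representations
  of dimension n at once.\<close>

lemma ex_mspan_euler_tuple:
  assumes "m \<le> 6"
  shows "\<exists>B. finite B \<and> (\<forall>\<rho>. representation tuple_group tuple_space n \<rho> \<longrightarrow> mspan n B (\<lambda>x. \<rho> (euler_tuple m x)))"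
  using assms
proof (induction m)
  case 0
  have "mspan n {\<lambda>_. 1} (\<lambda>x. \<rho> (euler_tuple 0 x))" if "representation tuple_group tuple_space n \<rho>" for \<rho>
    using mspan_const[OF rep_carrier[OF that, of tone]] by (simp add: euler_tuple_def tone_def[symmetric])
  then show ?case
    by (intro exI[of _ "{\<lambda>_. 1}"]) auto
next
  case (Suc m)
  then obtain B where B: "finite B" "\<And>\<rho>. representation tuple_group tuple_space n \<rho> \<Longrightarrow> mspan n B (\<lambda>x. \<rho> (euler_tuple m x))"
    by auto
  let ?C = "fprod (trig_funs n (3 * m)) (fprod (fprod (fprod {\<lambda>_. 1} (trig_funs n (3 * m + 1))) {\<lambda>_. 1}) (trig_funs n (3 * m + 2)))"
  have "mspan n (fprod B ?C) (\<lambda>x. \<rho> (euler_tuple (Suc m) x))" if rep: "representation tuple_group tuple_space n \<rho>" for \<rho>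
  proof -
    have "\<rho> (euler_tuple (Suc m) x) = \<rho> (euler_tuple m x) *
        \<rho> (coord m (qm (circ (x (3 * m))) (qm (rot (x (3 * m + 1))) (circ (x (3 * m + 2))))))" for x
      unfolding euler_tuple_Suc using rep_mult[OF rep, of "euler_tuple m x"] Suc.prems
      by (simp add: euler_tuple_tuples norm_qm)
    moreover have "mspan n (fprod B ?C) (\<lambda>x. \<rho> (euler_tuple m x) *
        \<rho> (coord m (qm (circ (x (3 * m))) (qm (rot (x (3 * m + 1))) (circ (x (3 * m + 2)))))))"
      using Suc.prems by (intro mspan_mult B(2)[OF rep] SU2_rep.mspan_euler[OF SU2_rep_coord[OF rep]]) simp
    ultimately show ?thesis
      by simp
  qed
  then show ?case
    using B(1) by (intro exI[of _ "fprod B ?C"]) auto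
qed

text \<open>Among card B + 1 pairwise inequivalent representations, the corner entries, expanded in
  B as functions of the angles, satisfy a nontrivial linear relation. The Euler angles reach every
  tuple, so this is a relation on the group and contradicts independence.\<close>

lemma finite_irr_classes_tuple_group: "finite (irr_classes tuple_group tuple_space n)"
proof (rule ccontr)
  let ?irr = "irreducible_rep tuple_group tuple_space n"
  assume inf: "infinite (irr_classes tuple_group tuple_space n)"
  obtain B where B: "finite B" "\<And>\<rho>. representation tuple_group tuple_space n \<rho> \<Longrightarrow> mspan n B (\<lambda>x. \<rho> (euler_tuple 6 x))"
    using ex_mspan_euler_tuple[of 6 n] by auto
  obtain \<C> where \<C>: "finite \<C>" "card \<C> = Suc (card B)" "\<C> \<subseteq> irr_classes tuple_group tuple_space n"
    using infinite_arbitrarily_large[OF inf] by metis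
  define \<rho> where "\<rho> V = (SOME \<rho>. \<rho> \<in> V)" for V :: "((nat \<Rightarrow> quat) \<Rightarrow> complex mat) set"
  have \<rho>: "\<rho> V \<in> V" if "V \<in> \<C>" for V
  proof -
    have "V \<noteq> {}"
      using \<C>(3) that in_quotient_imp_non_empty[OF equiv_irr_iso] unfolding irr_classes_def by blast
    then show ?thesis
      unfolding \<rho>_def by (simp add: some_in_eq)
  qed
  have irr: "?irr (\<rho> V)" if "V \<in> \<C>" for V
    using in_quotient_imp_subset[OF equiv_irr_iso] \<C>(3) \<rho>[OF that] that unfolding irr_classes_def by blast
  have non_iso: "\<not> rep_isomorphic tuple_group n (\<rho> V) (\<rho> W)" if VW: "V \<in> \<C>" "W \<in> \<C>" "V \<noteq> W" for V W
  proof
    assume "rep_isomorphic tuple_group n (\<rho> V) (\<rho> W)"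
    then have "(\<rho> V, \<rho> W) \<in> irr_iso tuple_group tuple_space n"
      using irr VW by simp
    then have "V = W"
      using quotient_eqI[OF equiv_irr_iso] \<C>(3) VW \<rho> unfolding irr_classes_def by blast
    then show False
      using VW by simp
  qed
  have n: "n > 0"
  proof -
    obtain V where "V \<in> \<C>"
      using \<C>(2) by fastforce
    then show ?thesis
      using irr by (auto simp: irreducible_rep_def)
  qed
  have "fspan B (\<lambda>x. \<rho> V (euler_tuple 6 x) $$ (0, 0))" if "V \<in> \<C>" for V
    using B(2)[OF irreducible_rep_imp_rep[OF irr[OF that]]] n by (simp add: mspan_def)
  then have "\<forall>V. \<exists>c. V \<in> \<C> \<longrightarrow> (\<forall>x. \<rho> V (euler_tuple 6 x) $$ (0, 0) = (\<Sum>b\<in>B. c b * b x))"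
    using fspan_coeffs[OF B(1)] by blast
  then obtain c where c: "\<And>V x. V \<in> \<C> \<Longrightarrow> \<rho> V (euler_tuple 6 x) $$ (0, 0) = (\<Sum>b\<in>B. c V b * b x)"
    by metis
  obtain l where l: "\<exists>V\<in>\<C>. l V \<noteq> 0" "\<forall>b\<in>B. (\<Sum>V\<in>\<C>. l V * c V b) = 0"
    using underdetermined_system[OF B(1) \<C>(1), of c] \<C>(2) by auto
  then obtain V where V: "V \<in> \<C>" "l V \<noteq> 0"
    by blast
  \<comment> \<open>The multiples l V of the first unit vector turn the scalar relation between
    corner entries into a relation of the kind treated by
    \<open>irr_coeffs_independent\<close>.\<close>
  have "l V \<cdot>\<^sub>v unit_vec n 0 = 0\<^sub>v n"
  proof (rule irr_coeffs_independent[OF group_tuple_group \<C>(1) irr non_iso _ _ V(1)])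
    show "l V \<cdot>\<^sub>v unit_vec n 0 \<in> carrier_vec n" for V
      by simp
    fix g assume "g \<in> carrier tuple_group"
    then obtain x where x: "g = euler_tuple 6 x"
      using euler_tuple_surj by auto
    have "(\<rho> V g *\<^sub>v (l V \<cdot>\<^sub>v unit_vec n 0)) $ 0 = l V * (\<Sum>b\<in>B. c V b * b x)" if "V \<in> \<C>" for V
    proof -
      have "\<rho> V g \<in> carrier_mat n n"
        using irreducible_rep_imp_rep[OF irr[OF that]] \<open>g \<in> carrier tuple_group\<close> by (rule rep_carrier)
      then have "(\<rho> V g *\<^sub>v (l V \<cdot>\<^sub>v unit_vec n 0)) $ 0 = l V * \<rho> V g $$ (0, 0)"
        using n by simp
      then show ?thesis
        unfolding x c[OF that] .
    qed
    then have "(\<Sum>V\<in>\<C>. (\<rho> V g *\<^sub>v (l V \<cdot>\<^sub>v unit_vec n 0)) $ 0) = (\<Sum>V\<in>\<C>. \<Sum>b\<in>B. b x * (l V * c V b))"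
      by (intro sum.cong refl) (simp add: sum_distrib_left mult_ac)
    also have "\<dots> = (\<Sum>b\<in>B. b x * (\<Sum>V\<in>\<C>. l V * c V b))"
      by (subst sum.swap) (simp add: sum_distrib_left)
    also have "\<dots> = 0"
      using l(2) by simp
    finally show "(\<Sum>V\<in>\<C>. (\<rho> V g *\<^sub>v (l V \<cdot>\<^sub>v unit_vec n 0)) $ 0) = 0" .
  qed
  then have "(l V \<cdot>\<^sub>v unit_vec n 0) $ 0 = 0\<^sub>v n $ 0"
    by simp
  then show False
    using V(2) n by simp
qed

section \<open>Smooth functions\<close>

lemma Euclidean_space_top_of_set: "Euclidean_space n = top_of_set {x. \<forall>i\<ge>n. x i = 0}"
  by (simp add: Euclidean_space_def euclidean_product_topology)

lemma continuous_map_Euclidean_subtopology: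
  assumes "openin (Euclidean_space n) S"
  shows "continuous_map (subtopology (Euclidean_space n) S) euclideanreal g \<longleftrightarrow> continuous_on S g"
proof -
  have "S \<subseteq> {x. \<forall>i\<ge>n. x i = 0}"
    using openin_subset[OF assms] by (simp add: topspace_Euclidean_space)
  then show ?thesis
    by (simp add: Euclidean_space_top_of_set subtopology_subtopology Int_absorb1)
qed

lemma eventually_upd_in_open:
  assumes S: "openin (Euclidean_space n) S" and x: "x \<in> S" and i: "i < n"
  shows "\<forall>\<^sub>F t in nhds (x i). x(i := t) \<in> S"
proof -
  obtain U where U: "open U" "S = {x. \<forall>i\<ge>n. x i = 0} \<inter> U"
    using S unfolding Euclidean_space_top_of_set by (auto simp: openin_open)
  have "continuous_on UNIV (\<lambda>t. x(i := t))"
  proof (rule continuous_on_coordinatewise_then_product)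
    show "continuous_on UNIV (\<lambda>t. (x(i := t)) j)" for j
      by (cases "j = i") (simp_all add: continuous_on_id)
  qed
  then have "open ((\<lambda>t. x(i := t)) -` U)"
    using U(1) by (simp add: continuous_on_open_vimage)
  moreover have "x i \<in> (\<lambda>t. x(i := t)) -` U"
    using x U by simp
  ultimately have "\<forall>\<^sub>F t in nhds (x i). t \<in> (\<lambda>t. x(i := t)) -` U"
    by (rule eventually_nhds_in_open)
  then show ?thesis
    by (rule eventually_mono) (use x U i in auto)
qed

text \<open>Moving one coordinate a little stays inside the open set S, so the derivative at a point
  of S sees the values on S only.\<close>

lemma has_partial_deriv_cong:
  assumes S: "openin (Euclidean_space n) S" and x: "x \<in> S" and i: "i < n"
    and eq: "\<And>y. y \<in> S \<Longrightarrow> f y = g y"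
  shows "((\<lambda>t. f (x(i := t))) has_field_derivative d) (at (x i)) \<longleftrightarrow> ((\<lambda>t. g (x(i := t))) has_field_derivative d) (at (x i))"
proof (rule DERIV_cong_ev)
  show "\<forall>\<^sub>F t in nhds (x i). f (x(i := t)) = g (x(i := t))"
    using eventually_upd_in_open[OF S x i] by eventually_elim (rule eq)
qed simp_all

lemma partial_deriv_eqI: "((\<lambda>t. f (x(i := t))) has_field_derivative d) (at (x i)) \<Longrightarrow> partial_deriv i f x = d"
  by (simp add: partial_deriv_def DERIV_imp_deriv)

lemma C_on_SucI:
  assumes "continuous_map (subtopology (Euclidean_space n) S) euclideanreal f"
    and "\<And>i x. i < n \<Longrightarrow> x \<in> S \<Longrightarrow> ((\<lambda>t. f (x(i := t))) has_field_derivative d i x) (at (x i))"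
    and "\<And>i. i < n \<Longrightarrow> C_on n k S (partial_deriv i f)"
  shows "C_on n (Suc k) S f"
  using assms by (auto simp: field_differentiable_def)

lemma C_on_SucD:
  assumes "C_on n (Suc k) S f" "i < n"
  shows "x \<in> S \<Longrightarrow> ((\<lambda>t. f (x(i := t))) has_field_derivative partial_deriv i f x) (at (x i))"
    and "C_on n k S (partial_deriv i f)"
  using assms by (auto simp: partial_deriv_def field_differentiable_derivI)

lemma C_on_imp_continuous_map:
  "C_on n k S f \<Longrightarrow> continuous_map (subtopology (Euclidean_space n) S) euclideanreal f"
  by (cases k) auto

declare C_on.simps(2) [simp del]

lemma C_on_cong:
  assumes S: "openin (Euclidean_space n) S" and "\<And>x. x \<in> S \<Longrightarrow> f x = g x" and "C_on n k S f"
  shows "C_on n k S g"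
  using assms(2,3)
proof (induction k arbitrary: f g)
  case 0
  then show ?case
    using continuous_on_eq[of S f g] unfolding C_on.simps continuous_map_Euclidean_subtopology[OF S] by blast
next
  case (Suc k)
  have d: "((\<lambda>t. g (x(i := t))) has_field_derivative partial_deriv i f x) (at (x i))" if "i < n" "x \<in> S" for i x
    using C_on_SucD(1)[OF Suc.prems(2) that] has_partial_deriv_cong[OF S that(2,1), of f g] Suc.prems(1) by blast
  show ?case
  proof (rule C_on_SucI[OF _ d])
    show "continuous_map (subtopology (Euclidean_space n) S) euclideanreal g"
      using C_on_imp_continuous_map[OF Suc.prems(2)] continuous_on_eq[of S f g] Suc.prems(1)
      unfolding continuous_map_Euclidean_subtopology[OF S] by blast
    show "C_on n k S (partial_deriv i g)" if "i < n" for i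
      by (rule Suc.IH[OF partial_deriv_eqI[OF d[OF that], symmetric] C_on_SucD(2)[OF Suc.prems(2) that]])
  qed
qed

text \<open>The partial derivatives may be given by formulas d that are correct on S only;
  \<open>C_on_cong\<close> exchanges them for \<open>partial_deriv\<close>.\<close>

lemma C_on_SucI':
  assumes S: "openin (Euclidean_space n) S"
    and "continuous_on S f"
    and d: "\<And>i x. i < n \<Longrightarrow> x \<in> S \<Longrightarrow> ((\<lambda>t. f (x(i := t))) has_field_derivative d i x) (at (x i))"
    and C: "\<And>i. i < n \<Longrightarrow> C_on n k S (d i)"
  shows "C_on n (Suc k) S f"
proof (rule C_on_SucI[OF _ d])
  show "continuous_map (subtopology (Euclidean_space n) S) euclideanreal f"
    using assms(2) S by (simp add: continuous_map_Euclidean_subtopology)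
  show "C_on n k S (partial_deriv i f)" if i: "i < n" for i
  proof (rule C_on_cong[OF S _ C[OF i]])
    show "d i x = partial_deriv i f x" if "x \<in> S" for x
      by (rule partial_deriv_eqI[OF d[OF i that], symmetric])
  qed
qed

lemma C_on_imp_continuous_on: "openin (Euclidean_space n) S \<Longrightarrow> C_on n k S f \<Longrightarrow> continuous_on S f"
  using C_on_imp_continuous_map[of n k S f] by (simp add: continuous_map_Euclidean_subtopology)

lemma C_on_Suc_imp: "C_on n (Suc k) S f \<Longrightarrow> C_on n k S f"
proof (induction k arbitrary: f)
  case (Suc k)
  then show ?case
    unfolding C_on.simps(2)[of n "Suc k"] C_on.simps(2)[of n k] by blast
qed (simp add: C_on.simps(2))

lemma C_on_const: "openin (Euclidean_space n) S \<Longrightarrow> C_on n k S (\<lambda>_. c)"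
proof (induction k arbitrary: c)
  case (Suc k)
  show ?case
    by (rule C_on_SucI'[where d = "\<lambda>_ _. 0"]) (use Suc in \<open>auto intro: continuous_intros\<close>)
qed (simp add: continuous_map_Euclidean_subtopology)

lemma continuous_on_coord: "continuous_on A (\<lambda>x :: 'i \<Rightarrow> 'a::topological_space. x i)"
  by (rule continuous_on_subset[OF continuous_on_product_coordinates]) simp

lemma C_on_coord:
  assumes S: "openin (Euclidean_space n) S"
  shows "C_on n k S (\<lambda>x. x j)"
proof (cases k)
  case 0
  then show ?thesis
    using S by (simp add: continuous_map_Euclidean_subtopology continuous_on_coord)
next
  case (Suc k')
  show ?thesis
    unfolding Suc
  proof (rule C_on_SucI'[OF S, where d = "\<lambda>i _. if i = j then 1 else 0"])
    show "continuous_on S (\<lambda>x. x j)"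
      by (rule continuous_on_coord)
    show "((\<lambda>t. (x(i := t)) j) has_field_derivative (if i = j then 1 else 0)) (at (x i))" for i and x :: "nat \<Rightarrow> real"
      by (cases "i = j") simp_all
  qed (rule C_on_const[OF S])
qed

lemma C_on_add:
  assumes S: "openin (Euclidean_space n) S" and "C_on n k S f" "C_on n k S g"
  shows "C_on n k S (\<lambda>x. f x + g x)"
  using assms(2,3)
proof (induction k arbitrary: f g)
  case 0
  then show ?case
    using S by (simp add: continuous_map_Euclidean_subtopology continuous_on_add)
next
  case (Suc k)
  show ?case
  proof (rule C_on_SucI'[OF S, where d = "\<lambda>i x. partial_deriv i f x + partial_deriv i g x"])
    show "continuous_on S (\<lambda>x. f x + g x)"
      using Suc.prems C_on_imp_continuous_on[OF S] by (intro continuous_on_add)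
  next
    fix i x assume ix: "i < n" "x \<in> S"
    show "((\<lambda>t. f (x(i := t)) + g (x(i := t))) has_field_derivative partial_deriv i f x + partial_deriv i g x) (at (x i))"
      by (intro DERIV_add C_on_SucD(1)[OF Suc.prems(1) ix] C_on_SucD(1)[OF Suc.prems(2) ix])
  next
    fix i assume i: "i < n"
    show "C_on n k S (\<lambda>x. partial_deriv i f x + partial_deriv i g x)"
      by (intro Suc.IH C_on_SucD(2)[OF Suc.prems(1) i] C_on_SucD(2)[OF Suc.prems(2) i])
  qed
qed

lemma C_on_mult:
  assumes S: "openin (Euclidean_space n) S" and "C_on n k S f" "C_on n k S g"
  shows "C_on n k S (\<lambda>x. f x * g x)"
  using assms(2,3)
proof (induction k arbitrary: f g)
  case 0
  then show ?case
    using S by (simp add: continuous_map_Euclidean_subtopology continuous_on_mult)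
next
  case (Suc k)
  show ?case
  proof (rule C_on_SucI'[OF S, where d = "\<lambda>i x. partial_deriv i f x * g x + partial_deriv i g x * f x"])
    show "continuous_on S (\<lambda>x. f x * g x)"
      using Suc.prems C_on_imp_continuous_on[OF S] by (intro continuous_on_mult)
  next
    fix i x assume ix: "i < n" "x \<in> S"
    have "((\<lambda>t. f (x(i := t)) * g (x(i := t))) has_field_derivative
        partial_deriv i f x * g (x(i := x i)) + partial_deriv i g x * f (x(i := x i))) (at (x i))"
      by (rule DERIV_mult C_on_SucD(1)[OF Suc.prems(1) ix] C_on_SucD(1)[OF Suc.prems(2) ix])+
    then show "((\<lambda>t. f (x(i := t)) * g (x(i := t))) has_field_derivative
        partial_deriv i f x * g x + partial_deriv i g x * f x) (at (x i))"
      by simp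
  next
    fix i assume i: "i < n"
    show "C_on n k S (\<lambda>x. partial_deriv i f x * g x + partial_deriv i g x * f x)"
      by (intro C_on_add[OF S] Suc.IH C_on_SucD(2)[OF Suc.prems(1) i] C_on_SucD(2)[OF Suc.prems(2) i]
          C_on_Suc_imp[OF Suc.prems(1)] C_on_Suc_imp[OF Suc.prems(2)])
  qed
qed

text \<open>The derivative -f' / f^2 is written as a product of a constant, f' and two factors
  \<open>inverse f\<close>, so that the induction hypothesis and closure under products
  apply.\<close>

lemma C_on_inverse:
  assumes S: "openin (Euclidean_space n) S" and "C_on n k S f" and nz: "\<And>x. x \<in> S \<Longrightarrow> f x \<noteq> 0"
  shows "C_on n k S (\<lambda>x. inverse (f x))"
  using assms(2)
proof (induction k)
  case 0
  then show ?case
    using S nz by (simp add: continuous_map_Euclidean_subtopology continuous_on_inverse)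
next
  case (Suc k)
  show ?case
  proof (rule C_on_SucI'[OF S, where d = "\<lambda>i x. (- 1) * (inverse (f x) * (partial_deriv i f x * inverse (f x)))"])
    show "continuous_on S (\<lambda>x. inverse (f x))"
      using Suc.prems C_on_imp_continuous_on[OF S] nz by (intro continuous_on_inverse) auto
  next
    fix i x assume ix: "i < n" "x \<in> S"
    have "((\<lambda>t. inverse (f (x(i := t)))) has_field_derivative
        - (inverse (f (x(i := x i))) * partial_deriv i f x * inverse (f (x(i := x i))))) (at (x i))"
      using nz[OF ix(2)] by (intro DERIV_inverse' C_on_SucD(1)[OF Suc.prems ix]) simp
    then show "((\<lambda>t. inverse (f (x(i := t)))) has_field_derivative
        (- 1) * (inverse (f x) * (partial_deriv i f x * inverse (f x)))) (at (x i))"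
      by (simp add: mult.assoc)
  next
    fix i assume i: "i < n"
    show "C_on n k S (\<lambda>x. (- 1) * (inverse (f x) * (partial_deriv i f x * inverse (f x))))"
      by (intro C_on_mult[OF S] C_on_const[OF S] Suc.IH C_on_Suc_imp[OF Suc.prems] C_on_SucD(2)[OF Suc.prems i])
  qed
qed

lemma smooth_on_const: "openin (Euclidean_space n) S \<Longrightarrow> smooth_on n S (\<lambda>_. c)"
  and smooth_on_coord: "openin (Euclidean_space n) S \<Longrightarrow> smooth_on n S (\<lambda>x. x j)"
  and smooth_on_add: "openin (Euclidean_space n) S \<Longrightarrow> smooth_on n S f \<Longrightarrow> smooth_on n S g \<Longrightarrow> smooth_on n S (\<lambda>x. f x + g x)"
  and smooth_on_mult: "openin (Euclidean_space n) S \<Longrightarrow> smooth_on n S f \<Longrightarrow> smooth_on n S g \<Longrightarrow> smooth_on n S (\<lambda>x. f x * g x)"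
  and smooth_on_cong: "openin (Euclidean_space n) S \<Longrightarrow> (\<And>x. x \<in> S \<Longrightarrow> f x = g x) \<Longrightarrow> smooth_on n S f \<Longrightarrow> smooth_on n S g"
  by (simp_all add: smooth_on_def C_on_const C_on_coord C_on_add C_on_mult C_on_cong[of n S f g])

lemma smooth_on_divide:
  "openin (Euclidean_space n) S \<Longrightarrow> smooth_on n S f \<Longrightarrow> smooth_on n S g \<Longrightarrow> (\<And>x. x \<in> S \<Longrightarrow> g x \<noteq> 0) \<Longrightarrow>
    smooth_on n S (\<lambda>x. f x / g x)"
  by (simp add: smooth_on_def divide_inverse C_on_mult C_on_inverse)

lemma smooth_on_uminus: "openin (Euclidean_space n) S \<Longrightarrow> smooth_on n S f \<Longrightarrow> smooth_on n S (\<lambda>x. - f x)"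
  using smooth_on_mult[OF _ smooth_on_const[of n S "- 1"]] by simp

lemma smooth_on_diff: "openin (Euclidean_space n) S \<Longrightarrow> smooth_on n S f \<Longrightarrow> smooth_on n S g \<Longrightarrow> smooth_on n S (\<lambda>x. f x - g x)"
  using smooth_on_add[OF _ _ smooth_on_uminus] by simp

section \<open>Smooth quaternion-valued maps and affine coordinates\<close>

definition qsmooth :: "nat \<Rightarrow> (nat \<Rightarrow> real) set \<Rightarrow> ((nat \<Rightarrow> real) \<Rightarrow> quat) \<Rightarrow> bool" where
  "qsmooth n S F \<longleftrightarrow> smooth_on n S (\<lambda>x. Re (fst (F x))) \<and> smooth_on n S (\<lambda>x. Im (fst (F x))) \<and>
     smooth_on n S (\<lambda>x. Re (snd (F x))) \<and> smooth_on n S (\<lambda>x. Im (snd (F x)))"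

lemma qsmooth_const: "openin (Euclidean_space n) S \<Longrightarrow> qsmooth n S (\<lambda>_. q)"
  by (simp add: qsmooth_def smooth_on_const)

lemma qsmooth_qcnj: "openin (Euclidean_space n) S \<Longrightarrow> qsmooth n S F \<Longrightarrow> qsmooth n S (\<lambda>x. qcnj (F x))"
  by (simp add: qsmooth_def qcnj_def smooth_on_uminus)

lemma qsmooth_qm: "openin (Euclidean_space n) S \<Longrightarrow> qsmooth n S F \<Longrightarrow> qsmooth n S H \<Longrightarrow> qsmooth n S (\<lambda>x. qm (F x) (H x))"
  unfolding qsmooth_def qm_def by (auto intro!: smooth_on_add smooth_on_diff smooth_on_mult)

text \<open>The affine coordinates of real projective space. They are unchanged by scaling, in
  particular by a change of sign, so they live on quotients of SU(2)^6 by signs; and they are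
  rational, so their smoothness is elementary.\<close>

definition qcoord :: "nat \<Rightarrow> quat \<Rightarrow> real" where
  "qcoord r p = (if r = 0 then Im (fst p) else if r = 1 then Re (snd p) else Im (snd p)) / Re (fst p)"

lemma qcoord_scaleR [simp]: "c \<noteq> 0 \<Longrightarrow> qcoord r (c *\<^sub>R p) = qcoord r p"
  by (simp add: qcoord_def)

lemma smooth_on_qcoord:
  "openin (Euclidean_space n) S \<Longrightarrow> qsmooth n S F \<Longrightarrow> (\<And>x. x \<in> S \<Longrightarrow> Re (fst (F x)) \<noteq> 0) \<Longrightarrow> smooth_on n S (\<lambda>x. qcoord r (F x))"
  unfolding qcoord_def qsmooth_def by (cases "r = 0"; cases "r = 1") (auto intro!: smooth_on_divide)

text \<open>The representative with real part 1 of the projective point whose affine coordinates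
  form the i-th block of three.\<close>

definition qaffine :: "(nat \<Rightarrow> real) \<Rightarrow> nat \<Rightarrow> quat" where
  "qaffine y i = (Complex 1 (y (3 * i)), Complex (y (3 * i + 1)) (y (3 * i + 2)))"

lemma qaffine_neq_0 [simp]: "norm (qaffine y i) \<noteq> 0" "qaffine y i \<noteq> 0"
  by (auto simp: qaffine_def zero_prod_def complex_eq_iff)

lemma qcoord_qaffine: "qcoord (k mod 3) (qaffine y (k div 3)) = y k"
proof -
  consider "k = 3 * (k div 3)" | "k = 3 * (k div 3) + 1" | "k = 3 * (k div 3) + 2"
    by arith
  then show ?thesis
  proof cases
    case 1
    then have "k mod 3 = 0" by presburger
    then show ?thesis using 1 by (simp add: qcoord_def qaffine_def)
  next
    case 2
    then have "k mod 3 = 1" by presburger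
    then show ?thesis using 2 by (simp add: qcoord_def qaffine_def)
  next
    case 3
    then have "k mod 3 = 2" by presburger
    then show ?thesis using 3 by (simp add: qcoord_def qaffine_def)
  qed
qed

lemma qaffine_qcoord:
  assumes "Re (fst p) \<noteq> 0" "\<And>r. r < 3 \<Longrightarrow> y (3 * i + r) = qcoord r p"
  shows "qaffine y i = (1 / Re (fst p)) *\<^sub>R p"
  using assms(1) assms(2)[of 0] assms(2)[of 1] assms(2)[of 2]
  by (simp add: qaffine_def qcoord_def prod_eq_iff complex_eq_iff)

lemma qsmooth_qaffine: "openin (Euclidean_space n) S \<Longrightarrow> qsmooth n S (\<lambda>y. qaffine y i)"
  by (simp add: qsmooth_def qaffine_def smooth_on_const smooth_on_coord)

lemma qsmooth_qaffine_shift: "openin (Euclidean_space n) S \<Longrightarrow> qsmooth n S (\<lambda>y. qaffine (\<lambda>k. y (k + m)) i)"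
  by (simp add: qsmooth_def qaffine_def smooth_on_const smooth_on_coord)

section \<open>Projective coordinates on tuples\<close>

text \<open>Translation by the inverse of g moves g to 1, so these coordinates are centred at
  g.\<close>

definition proj_coords :: "(nat \<Rightarrow> quat) \<Rightarrow> (nat \<Rightarrow> quat) \<Rightarrow> nat \<Rightarrow> real" where
  "proj_coords g x = (\<lambda>k. if k < 18 then qcoord (k mod 3) (qm (qcnj (g (k div 3))) (x (k div 3))) else 0)"

text \<open>The representative on the unit spheres whose real parts relative to g are
  positive.\<close>

definition proj_lift :: "(nat \<Rightarrow> quat) \<Rightarrow> (nat \<Rightarrow> real) \<Rightarrow> nat \<Rightarrow> quat" where
  "proj_lift g y = (\<lambda>i. if i < 6 then (1 / norm (qaffine y i)) *\<^sub>R qm (g i) (qaffine y i) else (1, 0))"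

text \<open>A sign change at any of the six coordinates leaves this set, so it contains at most one
  point of each orbit of sign changes and maps injectively to the quotient.\<close>

definition halfspace :: "(nat \<Rightarrow> quat) \<Rightarrow> (nat \<Rightarrow> quat) set" where
  "halfspace g = {x \<in> tuples. \<forall>i<6. Re (fst (qm (qcnj (g i)) (x i))) > 0}"

lemma proj_coords_scale:
  assumes "\<And>i. i < 6 \<Longrightarrow> c i \<noteq> 0" "\<And>i. i < 6 \<Longrightarrow> x' i = c i *\<^sub>R x i"
  shows "proj_coords g x' = proj_coords g x"
  using assms by (auto simp: proj_coords_def)

lemma proj_coords_range [simp]: "proj_coords g x \<in> {y. \<forall>i\<ge>18. y i = 0}"
  by (simp add: proj_coords_def)

lemma proj_lift_tuples: "g \<in> tuples \<Longrightarrow> proj_lift g y \<in> tuples"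
  by (simp add: proj_lift_def tuples_def norm_qm)

lemma qcnj_proj_lift:
  "g \<in> tuples \<Longrightarrow> i < 6 \<Longrightarrow> qm (qcnj (g i)) (proj_lift g y i) = (1 / norm (qaffine y i)) *\<^sub>R qaffine y i"
  by (simp add: proj_lift_def norm_tuples)

lemma proj_lift_halfspace:
  assumes "g \<in> tuples"
  shows "proj_lift g y \<in> halfspace g"
proof -
  have "Re (fst (qm (qcnj (g i)) (proj_lift g y i))) = 1 / norm (qaffine y i)" if "i < 6" for i
    unfolding qcnj_proj_lift[OF assms that] by (simp add: qaffine_def)
  moreover have "norm (qaffine y i) > 0" for i
    by simp
  ultimately show ?thesis
    using assms by (simp add: halfspace_def proj_lift_tuples del: zero_less_norm_iff)
qed

lemma proj_coords_lift:
  assumes "g \<in> tuples" "\<forall>i\<ge>18. y i = 0"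
  shows "proj_coords g (proj_lift g y) = y"
proof
  show "proj_coords g (proj_lift g y) k = y k" for k
    using assms by (cases "k < 18") (simp_all add: proj_coords_def qcnj_proj_lift qcoord_qaffine)
qed

lemma proj_lift_coords:
  assumes g: "g \<in> tuples" and x: "x \<in> halfspace g"
  shows "proj_lift g (proj_coords g x) = x"
proof
  fix i
  have xt: "x \<in> tuples"
    using x by (simp add: halfspace_def)
  show "proj_lift g (proj_coords g x) i = x i"
  proof (cases "i < 6")
    case True
    let ?p = "qm (qcnj (g i)) (x i)"
    have p: "Re (fst ?p) > 0" "norm ?p = 1"
      using x True g xt by (auto simp: halfspace_def norm_qm norm_tuples)
    have "qaffine (proj_coords g x) i = (1 / Re (fst ?p)) *\<^sub>R ?p"
    proof (rule qaffine_qcoord)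
      show "proj_coords g x (3 * i + r) = qcoord r ?p" if "r < 3" for r
        using that True by (simp add: proj_coords_def)
    qed (use p in simp)
    then show ?thesis
      using True p g by (simp add: proj_lift_def norm_tuples)
  next
    case False
    then show ?thesis
      using xt by (simp add: proj_lift_def tuples_def)
  qed
qed

lemma openin_halfspace: "openin (top_of_set tuples) (halfspace g)"
proof -
  have "open {x :: nat \<Rightarrow> quat. \<forall>i<6. 0 < Re (fst (qm (qcnj (g i)) (x i)))}"
  proof -
    have "open {x :: nat \<Rightarrow> quat. 0 < Re (fst (qm (qcnj (g i)) (x i)))}" for i
      by (intro open_Collect_less continuous_intros continuous_on_coord)
    then have "open (\<Inter>i<6. {x :: nat \<Rightarrow> quat. 0 < Re (fst (qm (qcnj (g i)) (x i)))})"
      by (intro open_INT) auto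
    moreover have "(\<Inter>i<6. {x :: nat \<Rightarrow> quat. 0 < Re (fst (qm (qcnj (g i)) (x i)))}) = {x. \<forall>i<6. 0 < Re (fst (qm (qcnj (g i)) (x i)))}"
      by auto
    ultimately show ?thesis
      by simp
  qed
  then show ?thesis
    by (auto simp: openin_open halfspace_def)
qed

lemma continuous_on_proj_coords: "continuous_on (halfspace g) (proj_coords g)"
proof (rule continuous_on_coordinatewise_then_product)
  fix k
  show "continuous_on (halfspace g) (\<lambda>x. proj_coords g x k)"
  proof (cases "k < 18")
    case True
    have c: "continuous_on (halfspace g) (\<lambda>x. qm (qcnj (g (k div 3))) (x (k div 3)))"
      by (intro continuous_intros continuous_on_coord)
    have "Re (fst (qm (qcnj (g (k div 3))) (x (k div 3)))) \<noteq> 0" if "x \<in> halfspace g" for x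
    proof -
      have "k div 3 < 6"
        using True by simp
      then have "0 < Re (fst (qm (qcnj (g (k div 3))) (x (k div 3))))"
        using that unfolding halfspace_def by blast
      then show ?thesis
        by simp
    qed
    then show ?thesis
      using True unfolding proj_coords_def qcoord_def
      by (cases "k mod 3 = 0"; cases "k mod 3 = 1") (auto intro!: continuous_intros c)
  qed (simp add: proj_coords_def)
qed

lemma continuous_on_proj_lift: "continuous_on A (proj_lift g)"
proof (rule continuous_on_coordinatewise_then_product)
  fix i
  have "continuous_on A (\<lambda>y. qaffine y i)"
    unfolding qaffine_def Complex_eq
    by (intro continuous_intros continuous_on_coord)
  then show "continuous_on A (\<lambda>y. proj_lift g y i)"
    unfolding proj_lift_def by (cases "i < 6") (auto intro!: continuous_intros)
qed

lemma smooth_on_proj_coords: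
  assumes S: "openin (Euclidean_space n) S" and F: "\<And>i. i < 6 \<Longrightarrow> qsmooth n S (\<lambda>y. F y i)"
    and nz: "\<And>y i. y \<in> S \<Longrightarrow> i < 6 \<Longrightarrow> Re (fst (qm (qcnj (h i)) (F y i))) \<noteq> 0"
  shows "smooth_on n S (\<lambda>y. proj_coords h (F y) k)"
proof (cases "k < 18")
  case True
  then have "k div 3 < 6"
    by simp
  then have "smooth_on n S (\<lambda>y. qcoord (k mod 3) (qm (qcnj (h (k div 3))) (F y (k div 3))))"
    by (intro smooth_on_qcoord[OF S] qsmooth_qm[OF S] qsmooth_const[OF S] F nz)
  then show ?thesis
    using True by (simp add: proj_coords_def)
next
  case False
  then show ?thesis
    using smooth_on_const[OF S] by (simp add: proj_coords_def)
qed

section \<open>Quotients by sign codes\<close>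

definition signs :: "(nat \<Rightarrow> real) set" where
  "signs = {e. (\<forall>i. e i = 1 \<or> e i = - 1) \<and> (\<forall>i\<ge>6. e i = 1)}"

definition act :: "(nat \<Rightarrow> real) \<Rightarrow> (nat \<Rightarrow> quat) \<Rightarrow> nat \<Rightarrow> quat" where
  "act e x = (\<lambda>i. e i *\<^sub>R x i)"

text \<open>The standard matrix of z + w j. It serves to place tuples into the element type
  \<open>lie_elem\<close> and enters through its injectivity; products are computed on
  quaternions.\<close>

definition matrices :: "(nat \<Rightarrow> quat) \<Rightarrow> nat \<Rightarrow> complex mat" where
  "matrices x = (\<lambda>i. mat 2 2 (\<lambda>(r, c).
     if r = 0 then (if c = 0 then fst (x i) else snd (x i))
     else (if c = 0 then - cnj (snd (x i)) else cnj (fst (x i)))))"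

lemma matrices_inj: "matrices x = matrices y \<Longrightarrow> x = y"
proof
  fix i assume "matrices x = matrices y"
  then have "matrices x i $$ (0, 0) = matrices y i $$ (0, 0)" "matrices x i $$ (0, 1) = matrices y i $$ (0, 1)"
    by simp_all
  then show "x i = y i"
    by (simp add: matrices_def prod_eq_iff)
qed

lemma signs_abs: "e \<in> signs \<Longrightarrow> \<bar>e i\<bar> = 1"
proof -
  assume "e \<in> signs"
  then have "e i = 1 \<or> e i = - 1"
    by (simp add: signs_def)
  then show ?thesis
    by auto
qed

lemma signs_nz: "e \<in> signs \<Longrightarrow> e i \<noteq> 0"
  using signs_abs[of e i] by auto

lemma signs_square: "e \<in> signs \<Longrightarrow> e i * e i = 1"
proof -
  assume "e \<in> signs"
  then have "e i = 1 \<or> e i = - 1"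
    by (auto simp: signs_def)
  then show ?thesis
    by auto
qed

lemma signs_mult: "d \<in> signs \<Longrightarrow> e \<in> signs \<Longrightarrow> (\<lambda>i. d i * e i) \<in> signs"
  unfolding signs_def by (simp, metis mult_minus_left mult_1_left minus_minus)

lemma signs_one: "(\<lambda>_. 1) \<in> signs"
  by (simp add: signs_def)

lemma finite_signs: "finite signs"
proof -
  have "signs \<subseteq> (\<lambda>f i. if i < 6 then f i else 1) ` PiE {..<6} (\<lambda>_. {1, - 1})"
  proof
    fix e assume e: "e \<in> signs"
    have "e = (\<lambda>i. if i < 6 then restrict e {..<6} i else 1)"
      using e by (auto simp: signs_def)
    moreover have "restrict e {..<6} \<in> PiE {..<6} (\<lambda>_. {1, - 1})"
      using e by (auto simp: signs_def)
    ultimately show "e \<in> (\<lambda>f i. if i < 6 then f i else 1) ` PiE {..<6} (\<lambda>_. {1, - 1})"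
      by (rule image_eqI)
  qed
  then show ?thesis
    by (rule finite_subset) (intro finite_imageI finite_PiE; simp)
qed

lemma act_tuples: "e \<in> signs \<Longrightarrow> x \<in> tuples \<Longrightarrow> act e x \<in> tuples"
  unfolding tuples_def by (simp add: act_def signs_abs) (simp add: signs_def)

lemma act_one [simp]: "act (\<lambda>_. 1) x = x"
  by (simp add: act_def)

lemma act_act: "act d (act e x) = act (\<lambda>i. d i * e i) x"
  by (simp add: act_def)

lemma act_involution [simp]: "e \<in> signs \<Longrightarrow> act e (act e x) = x"
  by (simp add: act_act signs_square)

lemma tmul_act: "tmul (act e x) y = act e (tmul x y)" "tmul x (act e y) = act e (tmul x y)"
  by (simp_all add: tmul_def act_def)

lemma continuous_on_act: "continuous_on A (act e)"
  unfolding act_def by (intro continuous_on_coordinatewise_then_product continuous_intros continuous_on_coord)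

lemma continuous_on_tinv: "continuous_on A tinv"
  unfolding tinv_def by (intro continuous_on_coordinatewise_then_product continuous_intros continuous_on_coord)

lemma continuous_on_tmul: "continuous_on A (\<lambda>p. tmul (fst p) (snd p))"
proof -
  have "continuous_on A (\<lambda>p. qm (fst p i) (snd p i))" for i
    by (intro continuous_intros continuous_on_compose2[OF continuous_on_coord[of UNIV i] continuous_on_fst]
        continuous_on_compose2[OF continuous_on_coord[of UNIV i] continuous_on_snd]) auto
  then show ?thesis
    unfolding tmul_def by (intro continuous_on_coordinatewise_then_product)
qed

abbreviation euclid :: "nat \<Rightarrow> (nat \<Rightarrow> real) set" where
  "euclid n \<equiv> {y. \<forall>i\<ge>n. y i = 0}"

text \<open>Each sign word is its own inverse, so closure under products makes C a subgroup of the
  centre.\<close>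

locale sign_code =
  fixes C :: "(nat \<Rightarrow> real) set"
  assumes C_signs: "C \<subseteq> signs"
    and C_one: "(\<lambda>_. 1) \<in> C"
    and C_mult: "d \<in> C \<Longrightarrow> e \<in> C \<Longrightarrow> (\<lambda>i. d i * e i) \<in> C"
begin

definition cls :: "(nat \<Rightarrow> quat) \<Rightarrow> lie_elem" where
  "cls x = (\<lambda>e. matrices (act e x)) ` C"

text \<open>An arbitrary representative, determined up to C. Whatever is built on it has to be
  invariant under C.\<close>

definition pick :: "lie_elem \<Rightarrow> nat \<Rightarrow> quat" where
  "pick A = (SOME x. x \<in> tuples \<and> cls x = A)"

definition Gp :: "lie_elem monoid" where
  "Gp = \<lparr>carrier = cls ` tuples, mult = (\<lambda>A B. cls (tmul (pick A) (pick B))), one = cls tone\<rparr>"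

text \<open>The quotient topology.\<close>

definition Tp :: "lie_elem topology" where
  "Tp = topology (\<lambda>U. U \<subseteq> cls ` tuples \<and> openin (top_of_set tuples) {x \<in> tuples. cls x \<in> U})"

definition dom :: "(nat \<Rightarrow> quat) \<Rightarrow> lie_elem set" where
  "dom g = cls ` halfspace g"

definition chart :: "(nat \<Rightarrow> quat) \<Rightarrow> lie_elem \<Rightarrow> nat \<Rightarrow> real" where
  "chart g A = proj_coords g (pick A)"

definition Mf :: "lie_elem manifold" where
  "Mf = \<lparr>mtop = Tp, mdim = 18, atlas = (\<lambda>g. (dom g, chart g)) ` tuples\<rparr>"

lemma C_in_signs: "e \<in> C \<Longrightarrow> e \<in> signs"
  using C_signs by blast

lemma cls_act: "e \<in> C \<Longrightarrow> cls (act e x) = cls x"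
proof -
  assume e: "e \<in> C"
  have "matrices (act d (act e x)) \<in> cls x" if "d \<in> C" for d
    using C_mult[OF that e] by (auto simp: cls_def act_act)
  moreover have "matrices (act d x) \<in> cls (act e x)" if "d \<in> C" for d
  proof -
    have "act d x = act (\<lambda>i. d i * e i) (act e x)"
      using signs_square[OF C_in_signs[OF e]] by (simp add: act_act mult.assoc)
    then show ?thesis
      using C_mult[OF that e] by (auto simp: cls_def)
  qed
  ultimately show ?thesis
    by (auto simp: cls_def)
qed

lemma cls_eq_iff: "cls x = cls y \<longleftrightarrow> (\<exists>e\<in>C. y = act e x)"
proof
  assume "cls x = cls y"
  moreover have "matrices y \<in> cls y"
    using C_one by (auto simp: cls_def intro!: image_eqI[where x = "\<lambda>_. 1"])
  ultimately have "matrices y \<in> cls x"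
    by simp
  then show "\<exists>e\<in>C. y = act e x"
    unfolding cls_def using matrices_inj by blast
qed (auto simp: cls_act)

lemma pick: "x \<in> tuples \<Longrightarrow> pick (cls x) \<in> tuples \<and> cls (pick (cls x)) = cls x"
  unfolding pick_def by (rule someI_ex[of "\<lambda>y. y \<in> tuples \<and> cls y = cls x"]) blast

lemma pick_cls: "x \<in> tuples \<Longrightarrow> \<exists>e\<in>C. pick (cls x) = act e x"
  using pick[of x] cls_eq_iff[of x "pick (cls x)"] by simp

lemma carrier_Gp: "carrier Gp = cls ` tuples"
  by (simp add: Gp_def)

lemma one_Gp: "\<one>\<^bsub>Gp\<^esub> = cls tone"
  by (simp add: Gp_def)

lemma mult_Gp: "x \<in> tuples \<Longrightarrow> y \<in> tuples \<Longrightarrow> cls x \<otimes>\<^bsub>Gp\<^esub> cls y = cls (tmul x y)"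
proof -
  assume xy: "x \<in> tuples" "y \<in> tuples"
  obtain d e where de: "d \<in> C" "e \<in> C" "pick (cls x) = act d x" "pick (cls y) = act e y"
    using pick_cls xy by metis
  have "cls (tmul (act d x) (act e y)) = cls (tmul x y)"
    using de by (simp add: tmul_act cls_act)
  then show ?thesis
    by (simp add: Gp_def de)
qed

lemma group_Gp: "group Gp"
proof (rule groupI)
  fix A assume "A \<in> carrier Gp"
  then obtain x where "x \<in> tuples" "A = cls x"
    by (auto simp: carrier_Gp)
  then show "\<exists>B\<in>carrier Gp. B \<otimes>\<^bsub>Gp\<^esub> A = \<one>\<^bsub>Gp\<^esub>"
    by (intro bexI[of _ "cls (tinv x)"]) (auto simp: carrier_Gp mult_Gp one_Gp)
qed (auto simp: carrier_Gp mult_Gp one_Gp tmul_assoc)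

lemma inv_Gp: "x \<in> tuples \<Longrightarrow> inv\<^bsub>Gp\<^esub> (cls x) = cls (tinv x)"
proof -
  assume x: "x \<in> tuples"
  interpret group Gp by (rule group_Gp)
  show ?thesis
    using x by (intro inv_equality) (auto simp: carrier_Gp mult_Gp one_Gp)
qed

section \<open>Topology of the quotient\<close>

lemma openin_Tp: "openin Tp U \<longleftrightarrow> U \<subseteq> cls ` tuples \<and> openin (top_of_set tuples) {x \<in> tuples. cls x \<in> U}"
proof -
  have "istopology (\<lambda>U. U \<subseteq> cls ` tuples \<and> openin (top_of_set tuples) {x \<in> tuples. cls x \<in> U})"
    unfolding istopology_def
  proof (intro conjI allI impI)
    fix U V assume "U \<subseteq> cls ` tuples \<and> openin (top_of_set tuples) {x \<in> tuples. cls x \<in> U}"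
      "V \<subseteq> cls ` tuples \<and> openin (top_of_set tuples) {x \<in> tuples. cls x \<in> V}"
    moreover have "{x \<in> tuples. cls x \<in> U \<inter> V} = {x \<in> tuples. cls x \<in> U} \<inter> {x \<in> tuples. cls x \<in> V}"
      by auto
    ultimately show "U \<inter> V \<subseteq> cls ` tuples" "openin (top_of_set tuples) {x \<in> tuples. cls x \<in> U \<inter> V}"
      by auto
  next
    fix \<K> assume "\<forall>K\<in>\<K>. K \<subseteq> cls ` tuples \<and> openin (top_of_set tuples) {x \<in> tuples. cls x \<in> K}"
    moreover have "{x \<in> tuples. cls x \<in> \<Union>\<K>} = (\<Union>K\<in>\<K>. {x \<in> tuples. cls x \<in> K})"
      by auto
    ultimately show "\<Union>\<K> \<subseteq> cls ` tuples" "openin (top_of_set tuples) {x \<in> tuples. cls x \<in> \<Union>\<K>}"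
      by auto
  qed
  then show ?thesis
    unfolding Tp_def by (simp add: topology_inverse')
qed

lemma topspace_Tp: "topspace Tp = cls ` tuples"
proof
  show "topspace Tp \<subseteq> cls ` tuples"
    using openin_topspace[of Tp] unfolding openin_Tp by blast
  have "{x \<in> tuples. cls x \<in> cls ` tuples} = tuples"
    by auto
  then have "openin Tp (cls ` tuples)"
    by (simp add: openin_Tp)
  then show "cls ` tuples \<subseteq> topspace Tp"
    by (rule openin_subset)
qed

lemma continuous_map_cls: "continuous_map (top_of_set tuples) Tp cls"
  by (auto simp: continuous_map_def openin_Tp topspace_Tp)

lemma openin_cls_image:
  assumes W: "openin (top_of_set tuples) W"
  shows "openin Tp (cls ` W)"
proof -
  have Wt: "W \<subseteq> tuples"
    using openin_subset[OF W] by simp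
  have "{x \<in> tuples. cls x \<in> cls ` W} = (\<Union>e\<in>C. {x \<in> tuples. act e x \<in> W})"
  proof (intro subset_antisym subsetI)
    fix x assume x: "x \<in> {x \<in> tuples. cls x \<in> cls ` W}"
    then obtain w where "w \<in> W" "cls x = cls w"
      by auto
    then show "x \<in> (\<Union>e\<in>C. {x \<in> tuples. act e x \<in> W})"
      using x cls_eq_iff by auto
  next
    fix x assume "x \<in> (\<Union>e\<in>C. {x \<in> tuples. act e x \<in> W})"
    then show "x \<in> {x \<in> tuples. cls x \<in> cls ` W}"
      using cls_act by (auto intro!: image_eqI[where x = "act _ x"])
  qed
  moreover have "openin (top_of_set tuples) {x \<in> tuples. act e x \<in> W}" if "e \<in> C" for e
  proof -
    have "continuous_map (top_of_set tuples) (top_of_set tuples) (act e)"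
      using act_tuples[OF C_in_signs[OF that]] by (auto simp: continuous_on_act)
    from openin_continuous_map_preimage[OF this W] show ?thesis
      by simp
  qed
  ultimately have "openin (top_of_set tuples) {x \<in> tuples. cls x \<in> cls ` W}"
    by auto
  then show ?thesis
    using Wt by (auto simp: openin_Tp)
qed

text \<open>The code is finite, so x can be separated from all points of the orbit of y at once by
  finite intersections.\<close>

lemma Hausdorff_Tp: "Hausdorff_space Tp"
  unfolding Hausdorff_space_def
proof (intro allI impI, elim conjE)
  fix A B assume "A \<in> topspace Tp" "B \<in> topspace Tp" and ne: "A \<noteq> B"
  then obtain x y where x: "x \<in> tuples" "A = cls x" and y: "y \<in> tuples" "B = cls y"
    by (auto simp: topspace_Tp)
  have "\<exists>U V. open U \<and> open V \<and> x \<in> U \<and> act e y \<in> V \<and> U \<inter> V = {}" if "e \<in> C" for e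
  proof (rule hausdorff)
    show "x \<noteq> act e y"
      using ne x y cls_act[OF that, of y] by auto
  qed
  then obtain U V where UV: "\<And>e. e \<in> C \<Longrightarrow> open (U e) \<and> open (V e) \<and> x \<in> U e \<and> act e y \<in> V e \<and> U e \<inter> V e = {}"
    by metis
  have finC: "finite C"
    using finite_subset[OF C_signs finite_signs] .
  define W where "W = tuples \<inter> (\<Inter>e\<in>C. U e)"
  define Z where "Z = tuples \<inter> (\<Inter>e\<in>C. act e -` V e)"
  have "open (\<Inter>e\<in>C. U e)"
    using UV finC by (intro open_INT) auto
  then have W: "openin (top_of_set tuples) W"
    unfolding W_def by (auto simp: openin_open)
  have "open (act e -` V e)" if "e \<in> C" for e
    using UV[OF that] continuous_on_act[of UNIV e] by (simp add: continuous_on_open_vimage)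
  then have "open (\<Inter>e\<in>C. act e -` V e)"
    using finC by (intro open_INT) auto
  then have Z: "openin (top_of_set tuples) Z"
    unfolding Z_def by (auto simp: openin_open)
  have "disjnt (cls ` W) (cls ` Z)"
  proof -
    have False if wz: "w \<in> W" "z \<in> Z" "cls w = cls z" for w z
    proof -
      obtain e where e: "e \<in> C" "w = act e z"
        using cls_eq_iff[of z w] wz(3) by auto
      have "act e z \<in> V e" "w \<in> U e"
        using wz e(1) by (auto simp: W_def Z_def)
      then show False
        using UV[OF e(1)] e(2) by blast
    qed
    then show ?thesis
      unfolding disjnt_def by blast
  qed
  moreover have "A \<in> cls ` W" "B \<in> cls ` Z"
    using x y UV by (auto simp: W_def Z_def)
  ultimately show "\<exists>U V. openin Tp U \<and> openin Tp V \<and> A \<in> U \<and> B \<in> V \<and> disjnt U V"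
    using openin_cls_image W Z by blast
qed

lemma second_countable_tuples: "second_countable (top_of_set tuples)"
proof -
  obtain B :: "(nat \<Rightarrow> quat) set set" where B: "countable B" "topological_basis B"
    by (rule exE[OF ex_countable_basis[where 'a = "nat \<Rightarrow> quat"]]) (elim conjE)
  have 1: "\<forall>V\<in>B. openin euclidean V"
    using topological_basis_open[OF B(2)] by simp
  have 2: "\<exists>V\<in>B. x \<in> V \<and> V \<subseteq> U" if "openin euclidean U \<and> x \<in> U" for U and x :: "nat \<Rightarrow> quat"
  proof -
    have "open U" "x \<in> U"
      using that by simp_all
    then show ?thesis
      using topological_basisE[OF B(2)] by metis
  qed
  have "second_countable (euclidean :: (nat \<Rightarrow> quat) topology)"
    unfolding second_countable_def using B(1) 1 2 by blast
  then show ?thesis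
    by (rule second_countable_subtopology)
qed

lemma second_countable_Tp: "second_countable Tp"
proof (rule second_countable_open_map_image[OF continuous_map_cls])
  show "open_map (top_of_set tuples) Tp cls"
    using openin_cls_image by (simp add: open_map_def)
qed (simp_all add: topspace_Tp second_countable_tuples)

lemma compact_space_Tp: "compact_space Tp"
proof -
  have "compactin (top_of_set tuples) tuples"
    using compact_tuples by (simp add: compactin_subtopology)
  from image_compactin[OF this continuous_map_cls] show ?thesis
    by (simp add: compact_space_def topspace_Tp)
qed

lemma connected_space_Tp: "connected_space Tp"
proof -
  have "connectedin (top_of_set tuples) tuples"
    using connected_tuples by (simp add: connectedin_subtopology)
  from connectedin_continuous_map_image[OF continuous_map_cls this] show ?thesis
    using connectedin_topspace[of Tp] by (simp add: topspace_Tp)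
qed

text \<open>The universal property of the quotient, stated over the image of an open set W because
  charts are defined on such images.\<close>

lemma continuous_map_from_Tp:
  assumes W: "openin (top_of_set tuples) W"
    and f: "\<And>V. openin Y V \<Longrightarrow> openin (top_of_set tuples) {x \<in> W. f x \<in> V}"
    and fW: "\<And>x. x \<in> W \<Longrightarrow> f x \<in> topspace Y" and F: "\<And>x. x \<in> W \<Longrightarrow> F (cls x) = f x"
  shows "continuous_map (subtopology Tp (cls ` W)) Y F"
  unfolding continuous_map_def
proof (intro conjI allI impI)
  have "W \<subseteq> tuples"
    using openin_subset[OF W] by simp
  then have top: "topspace (subtopology Tp (cls ` W)) = cls ` W"
    by (auto simp: topspace_Tp)
  show "F \<in> topspace (subtopology Tp (cls ` W)) \<rightarrow> topspace Y"
    unfolding top using fW F by auto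
  fix V assume "openin Y V"
  have "{A \<in> topspace (subtopology Tp (cls ` W)). F A \<in> V} = cls ` {x \<in> W. f x \<in> V}"
    unfolding top using F by auto
  moreover have "openin Tp (cls ` {x \<in> W. f x \<in> V})"
    by (rule openin_cls_image[OF f[OF \<open>openin Y V\<close>]])
  ultimately show "openin (subtopology Tp (cls ` W)) {A \<in> topspace (subtopology Tp (cls ` W)). F A \<in> V}"
    by (auto simp: openin_subtopology intro!: exI[of _ "cls ` {x \<in> W. f x \<in> V}"])
qed

text \<open>The representative \<open>pick (cls x)\<close> differs from x by signs, which projective
  coordinates ignore.\<close>

lemma chart_cls: "x \<in> tuples \<Longrightarrow> chart g (cls x) = proj_coords g x"
proof -
  assume "x \<in> tuples"
  then obtain e where e: "e \<in> C" "pick (cls x) = act e x"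
    using pick_cls by blast
  show ?thesis
    unfolding chart_def e(2)
    by (rule proj_coords_scale[where c = e]) (use signs_nz[OF C_in_signs[OF e(1)]] in \<open>simp_all add: act_def\<close>)
qed

lemma halfspace_tuples: "x \<in> halfspace g \<Longrightarrow> x \<in> tuples"
  by (simp add: halfspace_def)

lemma lift_chart: "g \<in> tuples \<Longrightarrow> A \<in> dom g \<Longrightarrow> cls (proj_lift g (chart g A)) = A"
  by (auto simp: dom_def chart_cls halfspace_tuples proj_lift_coords)

lemma chart_lift: "g \<in> tuples \<Longrightarrow> y \<in> euclid 18 \<Longrightarrow> chart g (cls (proj_lift g y)) = y"
  by (simp add: chart_cls proj_lift_tuples proj_coords_lift)

lemma lift_dom: "g \<in> tuples \<Longrightarrow> cls (proj_lift g y) \<in> dom g"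
  by (auto simp: dom_def proj_lift_halfspace)

lemma chart_range: "chart g A \<in> euclid 18"
  unfolding chart_def by (rule proj_coords_range)

lemma chart_image:
  assumes g: "g \<in> tuples"
  shows "chart g ` dom g = euclid 18"
proof (intro subset_antisym image_subsetI subsetI)
  show "chart g A \<in> euclid 18" for A
    by (rule chart_range)
  show "y \<in> chart g ` dom g" if "y \<in> euclid 18" for y
    by (rule image_eqI[of _ _ "cls (proj_lift g y)"]) (simp_all only: chart_lift[OF g that] lift_dom[OF g])
qed

lemma inj_on_chart: "g \<in> tuples \<Longrightarrow> inj_on (chart g) (dom g)"
  by (rule inj_on_inverseI[where g = "\<lambda>y. cls (proj_lift g y)"]) (rule lift_chart)

lemma inv_into_chart: "g \<in> tuples \<Longrightarrow> y \<in> euclid 18 \<Longrightarrow> inv_into (dom g) (chart g) y = cls (proj_lift g y)"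
  by (rule inv_into_f_eq[OF inj_on_chart]) (simp_all only: lift_dom chart_lift)

lemma openin_dom: "openin Tp (dom g)"
  unfolding dom_def by (rule openin_cls_image[OF openin_halfspace])

lemma dom_carrier: "dom g \<subseteq> cls ` tuples"
  by (auto simp: dom_def halfspace_tuples)

lemma continuous_map_lift: "g \<in> tuples \<Longrightarrow> continuous_map (top_of_set A) Tp (\<lambda>y. cls (proj_lift g y))"
proof -
  assume "g \<in> tuples"
  then have "continuous_map (top_of_set A) (top_of_set tuples) (proj_lift g)"
    by (auto simp: continuous_on_proj_lift proj_lift_tuples)
  from continuous_map_compose[OF this continuous_map_cls] show ?thesis
    by (simp add: o_def)
qed

lemma is_chart: 
  assumes g: "g \<in> tuples"
  shows "is_chart Tp 18 (dom g, chart g)"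
proof -
  have E: "subtopology (Euclidean_space 18) (chart g ` dom g) = top_of_set (euclid 18)"
    by (simp add: chart_image[OF g] Euclidean_space_top_of_set subtopology_subtopology)
  have "homeomorphic_maps (subtopology Tp (dom g)) (top_of_set (euclid 18)) (chart g) (\<lambda>y. cls (proj_lift g y))"
    unfolding homeomorphic_maps_def
  proof (intro conjI ballI)
    show "continuous_map (subtopology Tp (dom g)) (top_of_set (euclid 18)) (chart g)"
      unfolding dom_def
    proof (rule continuous_map_from_Tp[OF openin_halfspace])
      fix V assume "openin (top_of_set (euclid 18)) V"
      then obtain V' where V': "open V'" "V = euclid 18 \<inter> V'"
        by (auto simp: openin_open)
      have "openin (top_of_set (halfspace g)) (halfspace g \<inter> proj_coords g -` V')"
        using continuous_on_proj_coords V'(1) by (rule continuous_openin_preimage_gen)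
      from openin_trans[OF this openin_halfspace] have op: "openin (top_of_set tuples) (halfspace g \<inter> proj_coords g -` V')" .
      have eq: "{x \<in> halfspace g. proj_coords g x \<in> V} = halfspace g \<inter> proj_coords g -` V'"
        using V'(2) proj_coords_range by auto
      show "openin (top_of_set tuples) {x \<in> halfspace g. proj_coords g x \<in> V}"
        unfolding eq by (rule op)
    next
      show "proj_coords g x \<in> topspace (top_of_set (euclid 18))" for x
        by (simp only: topspace_euclidean_subtopology proj_coords_range)
      show "chart g (cls x) = proj_coords g x" if "x \<in> halfspace g" for x
        by (rule chart_cls[OF halfspace_tuples[OF that]])
    qed
    show "continuous_map (top_of_set (euclid 18)) (subtopology Tp (dom g)) (\<lambda>y. cls (proj_lift g y))"
      using continuous_map_lift[OF g] lift_dom[OF g] by (auto simp: continuous_map_in_subtopology)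
  qed (use lift_chart[OF g] chart_lift[OF g] dom_carrier in \<open>auto simp: topspace_Tp\<close>)
  then have "homeomorphic_map (subtopology Tp (dom g)) (top_of_set (euclid 18)) (chart g)"
    using homeomorphic_map_maps by blast
  moreover have "openin (Euclidean_space 18) (chart g ` dom g)"
    unfolding chart_image[OF g] by (simp add: Euclidean_space_top_of_set)
  ultimately show ?thesis
    unfolding is_chart_def prod.case E using openin_dom by blast
qed

text \<open>A tuple over the chart domain may lie outside the half-space, but a sign change by a
  word of C brings it there. So its real parts may be negative, but not zero.\<close>

lemma dom_Re_nonzero:
  assumes "x \<in> tuples" "cls x \<in> dom h" "i < 6"
  shows "Re (fst (qm (qcnj (h i)) (x i))) \<noteq> 0"
proof -
  obtain z where z: "z \<in> halfspace h" "cls x = cls z"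
    using assms(2) by (auto simp: dom_def)
  then obtain e where e: "e \<in> C" "x = act e z"
    using cls_eq_iff[of z x] by auto
  have "Re (fst (qm (qcnj (h i)) (x i))) = e i * Re (fst (qm (qcnj (h i)) (z i)))"
    by (simp add: e(2) act_def)
  moreover have "Re (fst (qm (qcnj (h i)) (z i))) > 0"
    using z(1) assms(3) by (simp add: halfspace_def)
  ultimately show ?thesis
    using signs_nz[OF C_in_signs[OF e(1)]] by simp
qed

text \<open>Z is the actual tuple and F an unnormalised multiple of it with polynomial coordinates
  in the applications. Projective coordinates do not see the factor c, so the square root in the
  normalisation never has to be differentiated.\<close>

lemma smooth_on_chart:
  assumes S: "openin (Euclidean_space n) S"
    and Z: "\<And>y. y \<in> S \<Longrightarrow> Z y \<in> tuples" "\<And>y. y \<in> S \<Longrightarrow> cls (Z y) \<in> dom h"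
    and F: "\<And>i. i < 6 \<Longrightarrow> qsmooth n S (\<lambda>y. F y i)"
    and c: "\<And>y i. y \<in> S \<Longrightarrow> i < 6 \<Longrightarrow> c y i \<noteq> 0 \<and> Z y i = c y i *\<^sub>R F y i"
    and u: "\<And>y. y \<in> S \<Longrightarrow> u y = chart h (cls (Z y)) k"
  shows "smooth_on n S u"
proof (rule smooth_on_cong[OF S])
  show "smooth_on n S (\<lambda>y. proj_coords h (F y) k)"
  proof (rule smooth_on_proj_coords[OF S F])
    fix y i assume y: "y \<in> S" "i < (6 :: nat)"
    have "Re (fst (qm (qcnj (h i)) (Z y i))) \<noteq> 0"
      using dom_Re_nonzero Z y by blast
    then show "Re (fst (qm (qcnj (h i)) (F y i))) \<noteq> 0"
      using c[OF y] by simp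
  qed
  show "proj_coords h (F y) k = u y" if "y \<in> S" for y
    using proj_coords_scale[of "c y" "Z y" "F y" h] c[OF that] u[OF that] Z(1)[OF that] by (simp add: chart_cls)
qed

lemma mtop_Mf [simp]: "mtop Mf = Tp" and mdim_Mf [simp]: "mdim Mf = 18"
  and atlas_Mf: "atlas Mf = (\<lambda>g. (dom g, chart g)) ` tuples"
  by (simp_all add: Mf_def)

lemma proj_lift_scale:
  "i < 6 \<Longrightarrow> 1 / norm (qaffine y i) \<noteq> 0 \<and> proj_lift g y i = (1 / norm (qaffine y i)) *\<^sub>R qm (g i) (qaffine y i)"
  by (simp add: proj_lift_def)

lemma openin_chart_preimage:
  assumes "continuous_map (top_of_set (euclid n)) Tp f" "openin Tp V"
  shows "openin (Euclidean_space n) {y \<in> euclid n. f y \<in> V}"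
  using openin_continuous_map_preimage[OF assms] by (simp add: Euclidean_space_top_of_set)

lemma chart_image_subset:
  assumes "g \<in> tuples"
  shows "chart g ` {A \<in> dom g. P A} = {y \<in> euclid 18. P (cls (proj_lift g y))}"
proof (intro subset_antisym subsetI)
  fix y assume y: "y \<in> {y \<in> euclid 18. P (cls (proj_lift g y))}"
  then have "chart g (cls (proj_lift g y)) = y"
    using chart_lift[OF assms] by blast
  then show "y \<in> chart g ` {A \<in> dom g. P A}"
    using y lift_dom[OF assms, of y] by (intro image_eqI[of _ _ "cls (proj_lift g y)"]) auto
next
  fix y assume "y \<in> chart g ` {A \<in> dom g. P A}"
  then show "y \<in> {y \<in> euclid 18. P (cls (proj_lift g y))}"
    using lift_chart[OF assms] chart_range by auto
qed

lemma smooth_manifold_Mf: "smooth_manifold Mf"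
  unfolding smooth_manifold_def
proof (intro conjI ballI)
  show "Hausdorff_space (mtop Mf)" "second_countable (mtop Mf)"
    by (simp_all add: Hausdorff_Tp second_countable_Tp)
  show "is_chart (mtop Mf) (mdim Mf) c" if "c \<in> atlas Mf" for c
    using that is_chart by (auto simp: atlas_Mf)
  show "(\<Union>(U, \<phi>)\<in>atlas Mf. U) = topspace (mtop Mf)"
  proof -
    have "x \<in> halfspace x" if "x \<in> tuples" for x
      using that by (simp add: halfspace_def norm_tuples)
    then have "cls ` tuples \<subseteq> (\<Union>g\<in>tuples. dom g)"
      by (auto simp: dom_def)
    then show ?thesis
      using dom_carrier by (auto simp: atlas_Mf topspace_Tp)
  qed
  show "case c of (U, \<phi>) \<Rightarrow> \<forall>(V, \<psi>)\<in>atlas Mf. \<forall>i<mdim Mf.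
      smooth_on (mdim Mf) (\<phi> ` (U \<inter> V)) (\<lambda>y. \<psi> (inv_into U \<phi> y) i)" if c: "c \<in> atlas Mf" for c
  proof -
    obtain g where g: "g \<in> tuples" "c = (dom g, chart g)"
      using c unfolding atlas_Mf by blast
    have "smooth_on 18 (chart g ` (dom g \<inter> dom h)) (\<lambda>y. chart h (inv_into (dom g) (chart g) y) i)"
      if h: "h \<in> tuples" for h i
    proof -
      let ?S = "{y \<in> euclid 18. cls (proj_lift g y) \<in> dom h}"
      have S: "chart g ` (dom g \<inter> dom h) = ?S"
        using chart_image_subset[OF g(1), of "\<lambda>A. A \<in> dom h"] by (simp add: Int_def)
      have open_S: "openin (Euclidean_space 18) ?S"
        by (rule openin_chart_preimage[OF continuous_map_lift[OF g(1)] openin_dom])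
      show ?thesis
        unfolding S
      proof (rule smooth_on_chart[OF open_S, where Z = "proj_lift g" and F = "\<lambda>y i. qm (g i) (qaffine y i)"
            and c = "\<lambda>y i. 1 / norm (qaffine y i)" and h = h and k = i])
        show "qsmooth 18 ?S (\<lambda>y. qm (g i) (qaffine y i))" for i
          by (intro qsmooth_qm[OF open_S] qsmooth_const[OF open_S] qsmooth_qaffine[OF open_S])
        show "1 / norm (qaffine y i) \<noteq> 0 \<and> proj_lift g y i = (1 / norm (qaffine y i)) *\<^sub>R qm (g i) (qaffine y i)"
          if "i < 6" for y i
          using that by (rule proj_lift_scale)
        show "chart h (inv_into (dom g) (chart g) y) i = chart h (cls (proj_lift g y)) i" if "y \<in> ?S" for y
          using that inv_into_chart[OF g(1), of y] by simp
      qed (simp_all add: g(1) proj_lift_tuples)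
    qed
    then show ?thesis
      unfolding g(2) atlas_Mf by simp
  qed
qed

end

section \<open>The quotients are Lie groups\<close>

text \<open>Only the coordinates below 18 enter, so a point of the product chart, with its 36
  coordinates, can be passed on unchanged for the first factor.\<close>

lemma proj_lift_cong: "(\<And>k. k < 18 \<Longrightarrow> y k = y' k) \<Longrightarrow> proj_lift g y = proj_lift g y'"
  by (auto simp: proj_lift_def qaffine_def)

lemma proj_coords_lift_less: "g \<in> tuples \<Longrightarrow> k < 18 \<Longrightarrow> proj_coords g (proj_lift g y) k = y k"
  by (simp add: proj_coords_def qcnj_proj_lift qcoord_qaffine)

context sign_code
begin

text \<open>A product of quotient maps need not be a quotient map, but \<open>cls\<close> is open: a
  box of tuples on which the product stays in the preimage of V maps onto an open box of
  classes.\<close>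

lemma continuous_map_mult_Gp: "continuous_map (prod_topology Tp Tp) Tp (\<lambda>(A, B). A \<otimes>\<^bsub>Gp\<^esub> B)"
  unfolding continuous_map_def
proof (intro conjI allI impI)
  show "(\<lambda>(A, B). A \<otimes>\<^bsub>Gp\<^esub> B) \<in> topspace (prod_topology Tp Tp) \<rightarrow> topspace Tp"
    by (auto simp: topspace_Tp mult_Gp)
  fix V assume V: "openin Tp V"
  have "continuous_map (prod_topology (top_of_set tuples) (top_of_set tuples)) (top_of_set tuples) (\<lambda>p. tmul (fst p) (snd p))"
    unfolding prod_topology_subtopology_eu continuous_map_in_subtopology continuous_map_iff_continuous
    using continuous_on_tmul by auto
  from continuous_map_compose[OF this continuous_map_cls]
  have c: "continuous_map (prod_topology (top_of_set tuples) (top_of_set tuples)) Tp (\<lambda>p. cls (tmul (fst p) (snd p)))"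
    by (simp add: o_def)
  have op: "openin (prod_topology (top_of_set tuples) (top_of_set tuples)) {p \<in> tuples \<times> tuples. cls (tmul (fst p) (snd p)) \<in> V}"
    using openin_continuous_map_preimage[OF c V] by simp
  show "openin (prod_topology Tp Tp) {p \<in> topspace (prod_topology Tp Tp). (case p of (A, B) \<Rightarrow> A \<otimes>\<^bsub>Gp\<^esub> B) \<in> V}"
    unfolding openin_prod_topology_alt
  proof (intro allI impI)
    fix A B assume "(A, B) \<in> {p \<in> topspace (prod_topology Tp Tp). (case p of (A, B) \<Rightarrow> A \<otimes>\<^bsub>Gp\<^esub> B) \<in> V}"
    then obtain x y where xy: "x \<in> tuples" "y \<in> tuples" "A = cls x" "B = cls y" "cls (tmul x y) \<in> V"
      by (auto simp: topspace_Tp mult_Gp)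
    then have "(x, y) \<in> {p \<in> tuples \<times> tuples. cls (tmul (fst p) (snd p)) \<in> V}"
      by simp
    then obtain U W where UW: "openin (top_of_set tuples) U" "openin (top_of_set tuples) W" "x \<in> U" "y \<in> W"
      "U \<times> W \<subseteq> {p \<in> tuples \<times> tuples. cls (tmul (fst p) (snd p)) \<in> V}"
      using op unfolding openin_prod_topology_alt by meson
    have "cls ` U \<times> cls ` W \<subseteq> {p \<in> topspace (prod_topology Tp Tp). (case p of (A, B) \<Rightarrow> A \<otimes>\<^bsub>Gp\<^esub> B) \<in> V}"
    proof
      fix p assume "p \<in> cls ` U \<times> cls ` W"
      then obtain a b where "a \<in> U" "b \<in> W" "p = (cls a, cls b)"
        by auto
      then show "p \<in> {p \<in> topspace (prod_topology Tp Tp). (case p of (A, B) \<Rightarrow> A \<otimes>\<^bsub>Gp\<^esub> B) \<in> V}"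
        using UW(5) by (auto simp: topspace_Tp mult_Gp)
    qed
    then show "\<exists>U W. openin Tp U \<and> openin Tp W \<and> A \<in> U \<and> B \<in> W \<and>
        U \<times> W \<subseteq> {p \<in> topspace (prod_topology Tp Tp). (case p of (A, B) \<Rightarrow> A \<otimes>\<^bsub>Gp\<^esub> B) \<in> V}"
      using openin_cls_image[OF UW(1)] openin_cls_image[OF UW(2)] UW(3,4) xy(3,4) by blast
  qed
qed

lemma continuous_map_inv_Gp: "continuous_map Tp Tp (\<lambda>A. inv\<^bsub>Gp\<^esub> A)"
proof -
  have "continuous_map (top_of_set tuples) (top_of_set tuples) tinv"
    using continuous_on_tinv by auto
  from continuous_map_compose[OF this continuous_map_cls]
  have c: "continuous_map (top_of_set tuples) Tp (\<lambda>x. cls (tinv x))"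
    by (simp add: o_def)
  have "continuous_map (subtopology Tp (cls ` tuples)) Tp (\<lambda>A. inv\<^bsub>Gp\<^esub> A)"
  proof (rule continuous_map_from_Tp)
    show "openin (top_of_set tuples) {x \<in> tuples. cls (tinv x) \<in> V}" if "openin Tp V" for V
      using openin_continuous_map_preimage[OF c that] by simp
  qed (simp_all add: inv_Gp topspace_Tp)
  then show ?thesis
    using subtopology_topspace[of Tp] by (simp add: topspace_Tp)
qed

lemma smooth_map_inv_Gp: "smooth_map Mf Mf (\<lambda>A. inv\<^bsub>Gp\<^esub> A)"
proof -
  have "smooth_on 18 (chart g ` {A \<in> dom g. inv\<^bsub>Gp\<^esub> A \<in> dom h}) (\<lambda>y. chart h (inv\<^bsub>Gp\<^esub> (inv_into (dom g) (chart g) y)) i)"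
    if g: "g \<in> tuples" and h: "h \<in> tuples" for g h i
  proof -
    let ?S = "{y \<in> euclid 18. inv\<^bsub>Gp\<^esub> (cls (proj_lift g y)) \<in> dom h}"
    have open_S: "openin (Euclidean_space 18) ?S"
      using continuous_map_compose[OF continuous_map_lift[OF g] continuous_map_inv_Gp]
      by (intro openin_chart_preimage openin_dom) (simp add: o_def)
    show ?thesis
      unfolding chart_image_subset[OF g]
    proof (rule smooth_on_chart[OF open_S, where Z = "\<lambda>y. tinv (proj_lift g y)" and F = "\<lambda>y i. qcnj (qm (g i) (qaffine y i))"
          and c = "\<lambda>y i. 1 / norm (qaffine y i)" and h = h and k = i])
      show "qsmooth 18 ?S (\<lambda>y. qcnj (qm (g i) (qaffine y i)))" for i
        by (intro qsmooth_qcnj[OF open_S] qsmooth_qm[OF open_S] qsmooth_const[OF open_S] qsmooth_qaffine[OF open_S])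
      show "1 / norm (qaffine y i) \<noteq> 0 \<and> tinv (proj_lift g y) i = (1 / norm (qaffine y i)) *\<^sub>R qcnj (qm (g i) (qaffine y i))"
        if "i < 6" for y i
        using proj_lift_scale[OF that, of y g] by (simp add: tinv_def)
      show "chart h (inv\<^bsub>Gp\<^esub> (inv_into (dom g) (chart g) y)) i = chart h (cls (tinv (proj_lift g y))) i" if "y \<in> ?S" for y
        using that inv_into_chart[OF g, of y] inv_Gp[OF proj_lift_tuples[OF g]] by simp
    qed (simp_all add: g proj_lift_tuples inv_Gp)
  qed
  then show ?thesis
    using continuous_map_inv_Gp unfolding smooth_map_def mtop_Mf mdim_Mf atlas_Mf by simp
qed

lemma smooth_map_mult_Gp: "smooth_map (prod_manifold Mf Mf) Mf (\<lambda>(A, B). A \<otimes>\<^bsub>Gp\<^esub> B)"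
proof -
  have smooth: "smooth_on 36 (\<phi> ` {p \<in> U. (case p of (A, B) \<Rightarrow> A \<otimes>\<^bsub>Gp\<^esub> B) \<in> dom h})
      (\<lambda>y. chart h (case inv_into U \<phi> y of (A, B) \<Rightarrow> A \<otimes>\<^bsub>Gp\<^esub> B) i)"
    if g: "g \<in> tuples" and g': "g' \<in> tuples" and h: "h \<in> tuples"
      and c: "(U, \<phi>) = prod_chart 18 18 (dom g, chart g) (dom g', chart g')" for g g' h i U \<phi>
  proof -
    have U: "U = dom g \<times> dom g'"
      and \<phi>: "\<phi> = (\<lambda>(a, b) i. if i < 18 then chart g a i else if i < 18 + 18 then chart g' b (i - 18) else 0)"
      using c by (simp_all add: prod_chart_def)
    \<comment> \<open>The inverse of the product chart: the coordinates below 18 belong to the first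
      factor and those from 18 on, shifted down, to the second.\<close>
    define \<psi> where "\<psi> y = (cls (proj_lift g y), cls (proj_lift g' (\<lambda>k. y (k + 18))))" for y
    have \<psi>\<phi>: "\<psi> (\<phi> p) = p" "\<phi> p \<in> euclid 36" if "p \<in> U" for p
    proof -
      obtain a b where ab: "p = (a, b)" "a \<in> dom g" "b \<in> dom g'"
        using \<open>p \<in> U\<close> by (auto simp: U)
      have "proj_lift g (\<phi> p) = proj_lift g (chart g a)" "proj_lift g' (\<lambda>k. \<phi> p (k + 18)) = proj_lift g' (chart g' b)"
        by (rule proj_lift_cong, simp add: \<phi> ab(1))+
      then show "\<psi> (\<phi> p) = p"
        using lift_chart[OF g ab(2)] lift_chart[OF g' ab(3)] by (simp add: \<psi>_def ab(1))
      show "\<phi> p \<in> euclid 36"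
        by (simp add: \<phi> ab(1))
    qed
    have \<psi>U: "\<psi> y \<in> U" for y
      by (simp add: \<psi>_def U lift_dom g g')
    have \<phi>\<psi>: "\<phi> (\<psi> y) = y" if "y \<in> euclid 36" for y
    proof
      fix k
      show "\<phi> (\<psi> y) k = y k"
        using that by (cases "k < 18"; cases "k < 36")
          (simp_all add: \<phi> \<psi>_def chart_cls proj_lift_tuples g g' proj_coords_lift_less)
    qed
    have image: "\<phi> ` {p \<in> U. P p} = {y \<in> euclid 36. P (\<psi> y)}" for P
    proof (intro subset_antisym subsetI)
      fix y assume "y \<in> {y \<in> euclid 36. P (\<psi> y)}"
      then show "y \<in> \<phi> ` {p \<in> U. P p}"
        using \<phi>\<psi>[of y] \<psi>U[of y] by (intro image_eqI[of _ _ "\<psi> y"]) auto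
    next
      fix y assume "y \<in> \<phi> ` {p \<in> U. P p}"
      then show "y \<in> {y \<in> euclid 36. P (\<psi> y)}"
        using \<psi>\<phi> by auto
    qed
    have inv: "inv_into U \<phi> y = \<psi> y" if "y \<in> euclid 36" for y
    proof (rule inv_into_f_eq)
      show "inj_on \<phi> U"
        by (rule inj_on_inverseI[where g = \<psi>]) (rule \<psi>\<phi>(1))
    qed (use \<psi>U \<phi>\<psi>[OF that] in auto)
    let ?Z = "\<lambda>y. tmul (proj_lift g y) (proj_lift g' (\<lambda>k. y (k + 18)))"
    have mult: "(case \<psi> y of (A, B) \<Rightarrow> A \<otimes>\<^bsub>Gp\<^esub> B) = cls (?Z y)" for y
      by (simp add: \<psi>_def mult_Gp proj_lift_tuples g g')
    let ?S = "{y \<in> euclid 36. cls (?Z y) \<in> dom h}"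
    have "continuous_on (euclid 36) (\<lambda>y. \<lambda>k. y (k + 18) :: real)"
      by (intro continuous_on_coordinatewise_then_product continuous_on_coord)
    then have "continuous_on (euclid 36) (\<lambda>y. (proj_lift g y, proj_lift g' (\<lambda>k. y (k + 18))))"
      by (intro continuous_on_Pair continuous_on_proj_lift continuous_on_compose2[OF continuous_on_proj_lift[of UNIV]]) auto
    from continuous_on_compose2[OF continuous_on_tmul[of UNIV] this]
    have "continuous_map (top_of_set (euclid 36)) (top_of_set tuples) ?Z"
      by (auto simp: proj_lift_tuples g g')
    from continuous_map_compose[OF this continuous_map_cls]
    have open_S: "openin (Euclidean_space 36) ?S"
      by (intro openin_chart_preimage openin_dom) (simp add: o_def)
    show ?thesis
      unfolding image mult
    proof (rule smooth_on_chart[OF open_S, where Z = ?Z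
          and F = "\<lambda>y i. qm (qm (g i) (qaffine y i)) (qm (g' i) (qaffine (\<lambda>k. y (k + 18)) i))"
          and c = "\<lambda>y i. 1 / norm (qaffine y i) * (1 / norm (qaffine (\<lambda>k. y (k + 18)) i))" and h = h and k = i])
      show "qsmooth 36 ?S (\<lambda>y. qm (qm (g i) (qaffine y i)) (qm (g' i) (qaffine (\<lambda>k. y (k + 18)) i)))" for i
        by (intro qsmooth_qm[OF open_S] qsmooth_const[OF open_S] qsmooth_qaffine[OF open_S] qsmooth_qaffine_shift[OF open_S])
      show "1 / norm (qaffine y i) * (1 / norm (qaffine (\<lambda>k. y (k + 18)) i)) \<noteq> 0 \<and>
          ?Z y i = (1 / norm (qaffine y i) * (1 / norm (qaffine (\<lambda>k. y (k + 18)) i))) *\<^sub>R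
            qm (qm (g i) (qaffine y i)) (qm (g' i) (qaffine (\<lambda>k. y (k + 18)) i))" if "i < 6" for y i
        using that by (simp add: tmul_def proj_lift_def)
      show "chart h (case inv_into U \<phi> y of (A, B) \<Rightarrow> A \<otimes>\<^bsub>Gp\<^esub> B) i = chart h (cls (?Z y)) i" if "y \<in> ?S" for y
        using that inv[of y] mult[of y] by simp
    qed (simp_all add: g g' proj_lift_tuples)
  qed
  show ?thesis
    unfolding smooth_map_def
  proof (intro conjI ballI)
    show "continuous_map (mtop (prod_manifold Mf Mf)) (mtop Mf) (\<lambda>(A, B). A \<otimes>\<^bsub>Gp\<^esub> B)"
      using continuous_map_mult_Gp by (simp add: prod_manifold_def)
    fix u assume "u \<in> atlas (prod_manifold Mf Mf)"
    then obtain g g' where g: "g \<in> tuples" "g' \<in> tuples" "u = prod_chart 18 18 (dom g, chart g) (dom g', chart g')"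
      by (auto simp: prod_manifold_def atlas_Mf)
    obtain U \<phi> where u: "u = (U, \<phi>)"
      by (cases u)
    show "case u of (U, \<phi>) \<Rightarrow> \<forall>(V, \<psi>)\<in>atlas Mf. \<forall>i<mdim Mf.
        smooth_on (mdim (prod_manifold Mf Mf)) (\<phi> ` {x \<in> U. (case x of (A, B) \<Rightarrow> A \<otimes>\<^bsub>Gp\<^esub> B) \<in> V})
          (\<lambda>y. \<psi> (case inv_into U \<phi> y of (A, B) \<Rightarrow> A \<otimes>\<^bsub>Gp\<^esub> B) i)"
      unfolding u atlas_Mf using smooth[OF g(1,2) _ g(3)[unfolded u]] by (simp add: prod_manifold_def)
  qed
qed

lemma lie_group_Gp: "lie_group Gp Mf"
  unfolding lie_group_def using group_Gp smooth_manifold_Mf smooth_map_mult_Gp smooth_map_inv_Gp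
  by (simp add: topspace_Tp carrier_Gp)

end

section \<open>The Lie algebra\<close>

text \<open>The i-th block of a tangent vector at 1, as an imaginary quaternion.\<close>

definition qimag :: "(nat \<Rightarrow> real) \<Rightarrow> nat \<Rightarrow> quat" where
  "qimag y i = (Complex 0 (y (3 * i)), Complex (y (3 * i + 1)) (y (3 * i + 2)))"

definition imag_part :: "nat \<Rightarrow> quat \<Rightarrow> real" where
  "imag_part r p = (if r = 0 then Im (fst p) else if r = 1 then Re (snd p) else Im (snd p))"

lemma imag_part_linear:
  "imag_part r (p + q) = imag_part r p + imag_part r q" "imag_part r (p - q) = imag_part r p - imag_part r q"
  "imag_part r (c *\<^sub>R p) = c * imag_part r p"
  by (simp_all add: imag_part_def)

lemma qaffine_eq: "qaffine (\<lambda>k. t * y k) i = (1, 0) + t *\<^sub>R qimag y i"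
  by (simp add: qaffine_def qimag_def prod_eq_iff complex_eq_iff)

text \<open>With u and v imaginary, the conjugate of p = 1 + s u is 1 - s u, a multiple of its
  inverse. The conjugated 1 + t v has real part |p|^2, free of t, and its imaginary part is t times
  a quadratic polynomial in s with the commutator of u and v as linear coefficient.\<close>

lemma conj_qaffine:
  assumes "p = (1, 0) + s *\<^sub>R qimag u i" and "v = qimag w i"
  shows "qcoord r (qm (qm p ((1, 0) + t *\<^sub>R v)) (qcnj p)) =
    t * (imag_part r v + s * imag_part r (qm (qimag u i) v - qm v (qimag u i)) - s\<^sup>2 * imag_part r (qm (qm (qimag u i) v) (qimag u i)))
      / (1 + s\<^sup>2 * (norm (qimag u i))\<^sup>2)"
proof -
  let ?u = "qimag u i"
  have cnj_u: "qcnj ?u = - ?u"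
    by (simp add: qimag_def qcnj_def complex_eq_iff)
  have uu: "qm ?u ?u = - (complex_of_real ((norm ?u)\<^sup>2), 0)"
    using arg_cong[OF qm_qcnj(1)[of ?u, unfolded cnj_u qm_uminus], of uminus] by simp
  have cnj_p: "qcnj p = (1, 0) - s *\<^sub>R ?u"
    using cnj_u by (simp add: assms(1) qcnj_def prod_eq_iff)
  have diff: "qm a (b - c) = qm a b - qm a c" "qm (a - b) c = qm a c - qm b c" for a b c
    by (simp_all add: qm_def algebra_simps)
  have eq: "qm (qm p ((1, 0) + t *\<^sub>R v)) (qcnj p) =
      (1, 0) - s\<^sup>2 *\<^sub>R qm ?u ?u + t *\<^sub>R (v + s *\<^sub>R (qm ?u v - qm v ?u) - s\<^sup>2 *\<^sub>R qm (qm ?u v) ?u)"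
    unfolding cnj_p unfolding assms(1) by (simp add: qm_add diff algebra_simps power2_eq_square)
  have "Re (fst (v + s *\<^sub>R (qm ?u v - qm v ?u) - s\<^sup>2 *\<^sub>R qm (qm ?u v) ?u)) = 0"
    unfolding assms(2) by (simp add: qimag_def qm_def algebra_simps)
  then have "Re (fst (qm (qm p ((1, 0) + t *\<^sub>R v)) (qcnj p))) = 1 + s\<^sup>2 * (norm ?u)\<^sup>2"
    unfolding eq uu by simp
  moreover have "imag_part r (qm (qm p ((1, 0) + t *\<^sub>R v)) (qcnj p)) =
      t * (imag_part r v + s * imag_part r (qm ?u v - qm v ?u) - s\<^sup>2 * imag_part r (qm (qm ?u v) ?u))"
    unfolding eq uu by (simp only: imag_part_linear) (simp add: imag_part_def)
  ultimately show ?thesis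
    by (simp add: qcoord_def imag_part_def)
qed

text \<open>At s = 0 both the denominator and the quadratic term have derivative 0, so only the
  linear coefficient survives.\<close>

lemma deriv_conj_formula:
  "deriv (\<lambda>s. deriv (\<lambda>t. t * (a + s * b - s\<^sup>2 * c) / (1 + s\<^sup>2 * m\<^sup>2)) 0) 0 = (b :: real)"
proof -
  have nz: "1 + s\<^sup>2 * m\<^sup>2 \<noteq> 0" for s
    using add_pos_nonneg[of 1 "s\<^sup>2 * m\<^sup>2"] by simp
  have "((\<lambda>t. t * (a + s * b - s\<^sup>2 * c) / (1 + s\<^sup>2 * m\<^sup>2)) has_field_derivative (a + s * b - s\<^sup>2 * c) / (1 + s\<^sup>2 * m\<^sup>2)) (at 0)" for s
    using nz by (auto intro!: derivative_eq_intros)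
  then have inner: "deriv (\<lambda>t. t * (a + s * b - s\<^sup>2 * c) / (1 + s\<^sup>2 * m\<^sup>2)) 0 = (a + s * b - s\<^sup>2 * c) / (1 + s\<^sup>2 * m\<^sup>2)" for s
    by (rule DERIV_imp_deriv)
  have "((\<lambda>s. (a + s * b - s\<^sup>2 * c) / (1 + s\<^sup>2 * m\<^sup>2)) has_field_derivative b) (at 0)"
    using nz by (auto intro!: derivative_eq_intros)
  then show ?thesis
    unfolding inner by (rule DERIV_imp_deriv)
qed

lemma imag_part_commutator:
  "imag_part 0 (qm (qimag u i) (qimag v i) - qm (qimag v i) (qimag u i)) = 2 * (u (3 * i + 1) * v (3 * i + 2) - u (3 * i + 2) * v (3 * i + 1))"
  "imag_part 1 (qm (qimag u i) (qimag v i) - qm (qimag v i) (qimag u i)) = 2 * (u (3 * i + 2) * v (3 * i) - u (3 * i) * v (3 * i + 2))"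
  "imag_part 2 (qm (qimag u i) (qimag v i) - qm (qimag v i) (qimag u i)) = 2 * (u (3 * i) * v (3 * i + 1) - u (3 * i + 1) * v (3 * i))"
  by (simp_all add: imag_part_def qimag_def qm_def algebra_simps)

text \<open>The Lie algebra of SU(2)^6 in the basis i, j, k of each factor: six copies of twice the
  cross product.\<close>

definition cross_bracket :: "((nat \<Rightarrow> real) \<Rightarrow> (nat \<Rightarrow> real) \<Rightarrow> nat \<Rightarrow> real) \<Rightarrow> bool" where
  "cross_bracket br \<longleftrightarrow> (\<forall>u\<in>euclid 18. \<forall>v\<in>euclid 18. br u v \<in> euclid 18 \<and> (\<forall>i<6.
     br u v (3 * i) = 2 * (u (3 * i + 1) * v (3 * i + 2) - u (3 * i + 2) * v (3 * i + 1)) \<and>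
     br u v (3 * i + 1) = 2 * (u (3 * i + 2) * v (3 * i) - u (3 * i) * v (3 * i + 2)) \<and>
     br u v (3 * i + 2) = 2 * (u (3 * i) * v (3 * i + 1) - u (3 * i + 1) * v (3 * i))))"

context sign_code
begin

lemma lie_bracket_Gp:
  assumes u: "u \<in> euclid 18" and v: "v \<in> euclid 18" and i: "i < 6" and r: "r < 3"
  shows "lie_bracket Gp 18 (dom tone, chart tone) u v (3 * i + r) =
    imag_part r (qm (qimag u i) (qimag v i) - qm (qimag v i) (qimag u i))"
proof -
  have t1: "tone \<in> tuples"
    by simp
  have "chart tone (cls tone) = (\<lambda>_. 0)"
    unfolding chart_cls[OF t1] by (simp add: fun_eq_iff proj_coords_def qcoord_def tone_def)
  then have curve: "chart_curve Gp (dom tone, chart tone) w t = cls (proj_lift tone (\<lambda>k. t * w k))" if "w \<in> euclid 18" for w t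
    using inv_into_chart[OF t1, of "\<lambda>k. t * w k"] that by (simp add: chart_curve_def one_Gp)
  have "chart tone (chart_curve Gp (dom tone, chart tone) u s \<otimes>\<^bsub>Gp\<^esub> chart_curve Gp (dom tone, chart tone) v t
        \<otimes>\<^bsub>Gp\<^esub> inv\<^bsub>Gp\<^esub> chart_curve Gp (dom tone, chart tone) u s) (3 * i + r) =
      t * (imag_part r (qimag v i) + s * imag_part r (qm (qimag u i) (qimag v i) - qm (qimag v i) (qimag u i))
        - s\<^sup>2 * imag_part r (qm (qm (qimag u i) (qimag v i)) (qimag u i))) / (1 + s\<^sup>2 * (norm (qimag u i))\<^sup>2)" for s t
  proof -
    let ?p = "qaffine (\<lambda>k. s * u k) i" and ?q = "qaffine (\<lambda>k. t * v k) i"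
    let ?x = "proj_lift tone (\<lambda>k. s * u k)" and ?y = "proj_lift tone (\<lambda>k. t * v k)"
    have "3 * i + r < 18" "(3 * i + r) mod 3 = r" "(3 * i + r) div 3 = i"
      using i r by simp_all
    then have "proj_coords tone (tmul (tmul ?x ?y) (tinv ?x)) (3 * i + r) =
        qcoord r (qm (qm (?x i) (?y i)) (qcnj (?x i)))"
      by (simp add: proj_coords_def tmul_def tinv_def tone_def)
    \<comment> \<open>Projective coordinates ignore norms, so the normalised lifts may be replaced
      by 1 + s u and 1 + t v.\<close>
    also have "\<dots> = qcoord r (qm (qm ?p ?q) (qcnj ?p))"
      using i by (simp add: proj_lift_def tone_def)
    also have "\<dots> = t * (imag_part r (qimag v i) + s * imag_part r (qm (qimag u i) (qimag v i) - qm (qimag v i) (qimag u i))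
        - s\<^sup>2 * imag_part r (qm (qm (qimag u i) (qimag v i)) (qimag u i))) / (1 + s\<^sup>2 * (norm (qimag u i))\<^sup>2)"
      unfolding qaffine_eq by (rule conj_qaffine[OF refl refl])
    finally show ?thesis
      by (simp add: curve[OF u] curve[OF v] mult_Gp inv_Gp proj_lift_tuples chart_cls)
  qed
  then show ?thesis
    using i r by (simp add: lie_bracket_def deriv_conj_formula)
qed

lemma cross_bracket_Gp: "cross_bracket (lie_bracket Gp 18 (dom tone, chart tone))"
  unfolding cross_bracket_def
proof (intro ballI conjI allI impI)
  fix u v :: "nat \<Rightarrow> real" assume uv: "u \<in> euclid 18" "v \<in> euclid 18"
  show "lie_bracket Gp 18 (dom tone, chart tone) u v \<in> euclid 18"
    by (simp add: lie_bracket_def)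
  fix i :: nat assume i: "i < 6"
  show "lie_bracket Gp 18 (dom tone, chart tone) u v (3 * i) = 2 * (u (3 * i + 1) * v (3 * i + 2) - u (3 * i + 2) * v (3 * i + 1))"
    using lie_bracket_Gp[OF uv i, of 0] imag_part_commutator(1)[of u i v] by simp
  show "lie_bracket Gp 18 (dom tone, chart tone) u v (3 * i + 1) = 2 * (u (3 * i + 2) * v (3 * i) - u (3 * i) * v (3 * i + 2))"
    using lie_bracket_Gp[OF uv i, of 1] imag_part_commutator(2)[of u i v] by simp
  show "lie_bracket Gp 18 (dom tone, chart tone) u v (3 * i + 2) = 2 * (u (3 * i) * v (3 * i + 1) - u (3 * i + 1) * v (3 * i))"
    using lie_bracket_Gp[OF uv i, of 2] imag_part_commutator(3)[of u i v] by simp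
qed

end

section \<open>Semisimplicity of six copies of the cross product\<close>

definition block_vec :: "nat \<Rightarrow> real \<Rightarrow> real \<Rightarrow> real \<Rightarrow> nat \<Rightarrow> real" where
  "block_vec i a b c = (\<lambda>k. if k = 3 * i then a else if k = 3 * i + 1 then b else if k = 3 * i + 2 then c else 0)"

lemma block_vec_simps:
  "block_vec i a b c (3 * j) = (if j = i then a else 0)"
  "block_vec i a b c (3 * j + 1) = (if j = i then b else 0)"
  "block_vec i a b c (3 * j + 2) = (if j = i then c else 0)"
  unfolding block_vec_def by (auto, (presburger+)?)

lemma block_vec_euclid: "i < 6 \<Longrightarrow> block_vec i a b c \<in> euclid 18"
  by (auto simp: block_vec_def)

lemma block_vec_scale: "(\<lambda>k. t * block_vec i a b c k) = block_vec i (t * a) (t * b) (t * c)"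
  by (auto simp: block_vec_def)

lemma cross_bracketD:
  assumes "cross_bracket br" "u \<in> euclid 18" "v \<in> euclid 18"
  shows "br u v \<in> euclid 18"
    and "i < 6 \<Longrightarrow> br u v (3 * i) = 2 * (u (3 * i + 1) * v (3 * i + 2) - u (3 * i + 2) * v (3 * i + 1))"
    and "i < 6 \<Longrightarrow> br u v (3 * i + 1) = 2 * (u (3 * i + 2) * v (3 * i) - u (3 * i) * v (3 * i + 2))"
    and "i < 6 \<Longrightarrow> br u v (3 * i + 2) = 2 * (u (3 * i) * v (3 * i + 1) - u (3 * i + 1) * v (3 * i))"
  using assms unfolding cross_bracket_def by blast+

text \<open>Distinct blocks commute, so bracketing with a vector of block i also projects to that
  block.\<close>

lemma cross_bracket_block_vec:
  assumes br: "cross_bracket br" and i: "i < 6" and x: "x \<in> euclid 18"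
  shows "br (block_vec i a b c) x = block_vec i
    (2 * (b * x (3 * i + 2) - c * x (3 * i + 1))) (2 * (c * x (3 * i) - a * x (3 * i + 2))) (2 * (a * x (3 * i + 1) - b * x (3 * i)))"
    (is "_ = ?rhs")
proof
  fix k :: nat
  note D = cross_bracketD[OF br block_vec_euclid[OF i] x]
  have *: "br (block_vec i a b c) x \<in> euclid 18"
    by (rule D(1))
  have **: "br (block_vec i a b c) x (3 * j) = ?rhs (3 * j)"
    "br (block_vec i a b c) x (3 * j + 1) = ?rhs (3 * j + 1)"
    "br (block_vec i a b c) x (3 * j + 2) = ?rhs (3 * j + 2)" if "j < 6" for j
    unfolding D(2-4)[OF that] block_vec_simps by (cases "j = i"; simp)+
  show "br (block_vec i a b c) x k = ?rhs k"
  proof (cases "k < 18")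
    case True
    then have "k div 3 < 6"
      by simp
    moreover consider "k = 3 * (k div 3)" | "k = 3 * (k div 3) + 1" | "k = 3 * (k div 3) + 2"
      by arith
    ultimately show ?thesis
      using ** by metis
  next
    case False
    then show ?thesis
      using * block_vec_euclid[OF i] by simp
  qed
qed

lemma hull_lin_subspace_scale: "x \<in> lin_subspace n hull S \<Longrightarrow> (\<lambda>k. a * x k) \<in> lin_subspace n hull S"
  unfolding hull_def lin_subspace_def by blast

text \<open>A nonzero ideal contains a basis vector of some block and hence, by the cyclic
  relations, the whole block. A block is its own derived algebra, so it survives in every term of
  the derived series.\<close>

lemma cross_bracket_semisimple:
  assumes br: "cross_bracket br"
  shows "lie_algebra_semisimple 18 br"
  unfolding lie_algebra_semisimple_def
proof (intro allI impI, elim conjE)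
  fix I assume ideal: "lie_ideal 18 br I" and solv: "lie_solvable 18 br I"
  have E: "topspace (Euclidean_space 18) = euclid 18"
    by (simp add: topspace_Euclidean_space)
  have sub: "I \<subseteq> euclid 18" and zero: "(\<lambda>i. 0) \<in> I" and scale: "\<And>a x. x \<in> I \<Longrightarrow> (\<lambda>i. a * x i) \<in> I"
    and absorb: "\<And>x y. x \<in> euclid 18 \<Longrightarrow> y \<in> I \<Longrightarrow> br x y \<in> I"
    using ideal unfolding lie_ideal_def lin_subspace_def E by auto
  have "x = (\<lambda>_. 0)" if x: "x \<in> I" for x
  proof (rule ccontr)
    assume "x \<noteq> (\<lambda>_. 0)"
    then obtain k where k: "x k \<noteq> 0"
      by auto
    have x18: "x \<in> euclid 18"
      using x sub by blast
    then have "k < 18"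
      using k not_less by auto
    define i where "i = k div 3"
    have i: "i < 6"
      using \<open>k < 18\<close> by (simp add: i_def)
    have "k = 3 * i \<or> k = 3 * i + 1 \<or> k = 3 * i + 2"
      unfolding i_def by arith
    then have nz: "x (3 * i) \<noteq> 0 \<or> x (3 * i + 1) \<noteq> 0 \<or> x (3 * i + 2) \<noteq> 0"
      using k by auto
    note B = block_vec_euclid[OF i]
    note br_block = cross_bracket_block_vec[OF br i] and br_simps = block_vec_simps if_True mult_zero_left mult_zero_right mult_1_left mult_1_right diff_0 diff_0_right
    have unscale: "block_vec i (a / t) (b / t) (c / t) \<in> I" if "block_vec i a b c \<in> I" for a b c t
      using scale[OF that, of "1 / t"] unfolding block_vec_scale by simp
    \<comment> \<open>A first bracket with a basis vector discards the other blocks and one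
      coordinate of block i; a second one isolates a single coordinate, up to the factor 4.\<close>
    let ?y = "br (block_vec i 1 0 0) x" and ?z = "br (block_vec i 0 1 0) x"
    have yz: "?y \<in> I" "?z \<in> I"
      by (rule absorb[OF B x])+
    have y: "?y = block_vec i 0 (- 2 * x (3 * i + 2)) (2 * x (3 * i + 1))"
      and z: "?z = block_vec i (2 * x (3 * i + 2)) 0 (- 2 * x (3 * i))"
      using br_block[OF x18] by simp_all
    have "br (block_vec i 0 1 0) ?y \<in> I" "br (block_vec i 0 0 1) ?y \<in> I" "br (block_vec i 1 0 0) ?z \<in> I"
      by (rule absorb[OF B yz(1)] absorb[OF B yz(2)])+
    then have "block_vec i (4 * x (3 * i + 1)) 0 0 \<in> I" "block_vec i (4 * x (3 * i + 2)) 0 0 \<in> I" "block_vec i 0 (4 * x (3 * i)) 0 \<in> I"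
      unfolding y z br_block[OF B] by (simp_all add: block_vec_simps(1) block_vec_simps(2)[simplified] block_vec_simps(3)[simplified])
    then have "block_vec i 1 0 0 \<in> I \<or> block_vec i 0 1 0 \<in> I"
      using nz unscale[of "4 * x (3 * i + 1)" 0 0 "4 * x (3 * i + 1)"] unscale[of "4 * x (3 * i + 2)" 0 0 "4 * x (3 * i + 2)"]
        unscale[of 0 "4 * x (3 * i)" 0 "4 * x (3 * i)"] by auto
    have next_vec: "br (block_vec i 1 0 0) (block_vec i 0 1 0) = block_vec i 0 0 2"
      "br (block_vec i 0 1 0) (block_vec i 0 0 1) = block_vec i 2 0 0"
      "br (block_vec i 0 0 1) (block_vec i 1 0 0) = block_vec i 0 2 0"
      unfolding br_block[OF B] by (simp_all add: block_vec_simps(1) block_vec_simps(2)[simplified] block_vec_simps(3)[simplified])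
    have step: "block_vec i 0 0 1 \<in> I" if "block_vec i 0 1 0 \<in> I"
      using absorb[OF B[of 1 0 0] that] unscale[of 0 0 2 2] unfolding next_vec by simp
    have step': "block_vec i 1 0 0 \<in> I" if "block_vec i 0 0 1 \<in> I"
      using absorb[OF B[of 0 1 0] that] unscale[of 2 0 0 2] unfolding next_vec by simp
    have step'': "block_vec i 0 1 0 \<in> I" if "block_vec i 1 0 0 \<in> I"
      using absorb[OF B[of 0 0 1] that] unscale[of 0 2 0 2] unfolding next_vec by simp
    have all: "block_vec i 1 0 0 \<in> I \<and> block_vec i 0 1 0 \<in> I \<and> block_vec i 0 0 1 \<in> I"
      using \<open>block_vec i 1 0 0 \<in> I \<or> block_vec i 0 1 0 \<in> I\<close> step step' step'' by blast
    have derived: "block_vec i 1 0 0 \<in> derived_algebra 18 br J \<and> block_vec i 0 1 0 \<in> derived_algebra 18 br J \<and>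
        block_vec i 0 0 1 \<in> derived_algebra 18 br J"
      if J: "block_vec i 1 0 0 \<in> J \<and> block_vec i 0 1 0 \<in> J \<and> block_vec i 0 0 1 \<in> J" for J
    proof -
      have br_mem: "br p q \<in> derived_algebra 18 br J" if "p \<in> J" "q \<in> J" for p q
        unfolding derived_algebra_def by (rule hull_inc) (use that in blast)
      have half: "block_vec i (a / 2) (b / 2) (c / 2) \<in> derived_algebra 18 br J" if "block_vec i a b c \<in> derived_algebra 18 br J" for a b c
        using hull_lin_subspace_scale[OF that[unfolded derived_algebra_def], of "1 / 2"]
        unfolding block_vec_scale derived_algebra_def by simp
      have "block_vec i 0 0 2 \<in> derived_algebra 18 br J" "block_vec i 2 0 0 \<in> derived_algebra 18 br J" "block_vec i 0 2 0 \<in> derived_algebra 18 br J"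
        unfolding next_vec[symmetric] using J br_mem by blast+
      then show ?thesis
        using half[of 0 0 2] half[of 2 0 0] half[of 0 2 0] by simp
    qed
    have "block_vec i 1 0 0 \<in> (derived_algebra 18 br ^^ m) I \<and> block_vec i 0 1 0 \<in> (derived_algebra 18 br ^^ m) I \<and>
        block_vec i 0 0 1 \<in> (derived_algebra 18 br ^^ m) I" for m
      by (induction m) (use all derived in auto)
    then have "block_vec i 1 0 0 = (\<lambda>_. 0)"
      using solv unfolding lie_solvable_def by blast
    then have "block_vec i 1 0 0 (3 * i) = 0"
      by simp
    then show False
      by (simp add: block_vec_def)
  qed
  then show "I = {\<lambda>i. 0}"
    using zero by blast
qed

context sign_code
begin

lemma semisimple_Gp: "connected_compact_semisimple_lie_group Gp Mf"
proof -
  have "tone \<in> halfspace tone"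
    by (simp add: halfspace_def norm_tuples)
  then have "\<one>\<^bsub>Gp\<^esub> \<in> dom tone"
    by (auto simp: one_Gp dom_def)
  then have "\<exists>c\<in>atlas Mf. \<one>\<^bsub>Gp\<^esub> \<in> fst c \<and> lie_algebra_semisimple (mdim Mf) (lie_bracket Gp (mdim Mf) c)"
    using cross_bracket_semisimple[OF cross_bracket_Gp] by (intro bexI[of _ "(dom tone, chart tone)"]) (simp_all add: atlas_Mf)
  then show ?thesis
    unfolding connected_compact_semisimple_lie_group_def semisimple_lie_group_def
    using lie_group_Gp compact_space_Tp connected_space_Tp by simp
qed

end

section \<open>Non-isomorphic quotients\<close>

text \<open>
  If every index shares its sign with another index in all words of the code, a flexible
  involution has only purely imaginary coordinates, and these are all conjugate. For the other
  code, \<open>(i, i, i, i, i, i)\<close> and \<open>(i, i, i, i, 1, 1)\<close> are flexible involutions, but not conjugate.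
\<close>

definition flexible_involutions :: "'a monoid \<Rightarrow> 'a set" where
  "flexible_involutions G = {g \<in> carrier G. g \<otimes>\<^bsub>G\<^esub> g = \<one>\<^bsub>G\<^esub> \<and>
     (\<forall>z\<in>carrier G. (\<forall>x\<in>carrier G. z \<otimes>\<^bsub>G\<^esub> x = x \<otimes>\<^bsub>G\<^esub> z) \<longrightarrow>
       (\<exists>x\<in>carrier G. x \<otimes>\<^bsub>G\<^esub> g = (g \<otimes>\<^bsub>G\<^esub> z) \<otimes>\<^bsub>G\<^esub> x))}"

definition flexible_involutions_conj :: "'a monoid \<Rightarrow> bool" where
  "flexible_involutions_conj G \<longleftrightarrow>
     (\<forall>g\<in>flexible_involutions G. \<forall>h\<in>flexible_involutions G. \<exists>x\<in>carrier G. x \<otimes>\<^bsub>G\<^esub> g = h \<otimes>\<^bsub>G\<^esub> x)"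

text \<open>The property speaks only of products and the unit, so it transports along every
  isomorphism of abstract groups.\<close>

lemma flexible_involutions_conj_iso:
  assumes G: "group G" and H: "group H" and f: "f \<in> iso G H" and conj: "flexible_involutions_conj G"
  shows "flexible_involutions_conj H"
proof -
  interpret G: group G by (rule G)
  interpret H: group H by (rule H)
  have hom: "f (x \<otimes>\<^bsub>G\<^esub> y) = f x \<otimes>\<^bsub>H\<^esub> f y" if "x \<in> carrier G" "y \<in> carrier G" for x y
    using f that by (simp add: iso_def hom_def)
  have closed: "f x \<in> carrier H" if "x \<in> carrier G" for x
    using f that by (auto simp: iso_def hom_def)
  have bij: "bij_betw f (carrier G) (carrier H)"
    using f by (simp add: iso_def)
  have inj: "x = y" if "f x = f y" "x \<in> carrier G" "y \<in> carrier G" for x y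
    using f that by (auto simp: iso_def bij_betw_def inj_on_def)
  have surj: "\<exists>x\<in>carrier G. f x = y" if "y \<in> carrier H" for y
    using that unfolding bij_betw_imp_surj_on[OF bij, symmetric] by blast
  have one: "f \<one>\<^bsub>G\<^esub> = \<one>\<^bsub>H\<^esub>"
    using f hom_one[OF _ G H] by (simp add: iso_def)
  have flex: "g \<in> flexible_involutions G" if g: "g \<in> carrier G" and fg: "f g \<in> flexible_involutions H" for g
  proof -
    have "f (g \<otimes>\<^bsub>G\<^esub> g) = f \<one>\<^bsub>G\<^esub>"
      using fg g by (simp add: flexible_involutions_def hom one)
    then have "g \<otimes>\<^bsub>G\<^esub> g = \<one>\<^bsub>G\<^esub>"
      by (rule inj) (simp_all add: g)
    moreover have "\<exists>x\<in>carrier G. x \<otimes>\<^bsub>G\<^esub> g = (g \<otimes>\<^bsub>G\<^esub> z) \<otimes>\<^bsub>G\<^esub> x"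
      if z: "z \<in> carrier G" and central: "\<forall>x\<in>carrier G. z \<otimes>\<^bsub>G\<^esub> x = x \<otimes>\<^bsub>G\<^esub> z" for z
    proof -
      have "f z \<otimes>\<^bsub>H\<^esub> y = y \<otimes>\<^bsub>H\<^esub> f z" if "y \<in> carrier H" for y
      proof -
        obtain x where x: "x \<in> carrier G" "f x = y"
          using surj[OF \<open>y \<in> carrier H\<close>] by blast
        then have "f (z \<otimes>\<^bsub>G\<^esub> x) = f (x \<otimes>\<^bsub>G\<^esub> z)"
          using central by simp
        then show ?thesis
          using hom z x by simp
      qed
      then obtain y where y: "y \<in> carrier H" "y \<otimes>\<^bsub>H\<^esub> f g = (f g \<otimes>\<^bsub>H\<^esub> f z) \<otimes>\<^bsub>H\<^esub> y"
        using fg closed[OF z] unfolding flexible_involutions_def by blast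
      obtain x where x: "x \<in> carrier G" "f x = y"
        using surj[OF y(1)] by blast
      have "f (x \<otimes>\<^bsub>G\<^esub> g) = f ((g \<otimes>\<^bsub>G\<^esub> z) \<otimes>\<^bsub>G\<^esub> x)"
        using y(2) x g z by (simp add: hom)
      then have "x \<otimes>\<^bsub>G\<^esub> g = (g \<otimes>\<^bsub>G\<^esub> z) \<otimes>\<^bsub>G\<^esub> x"
        by (rule inj) (simp_all add: x g z)
      then show ?thesis
        using x by blast
    qed
    ultimately show ?thesis
      using g unfolding flexible_involutions_def by blast
  qed
  show ?thesis
    unfolding flexible_involutions_conj_def
  proof (intro ballI)
    fix g' h' assume g': "g' \<in> flexible_involutions H" and h': "h' \<in> flexible_involutions H"
    then have "g' \<in> carrier H" "h' \<in> carrier H"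
      by (auto simp: flexible_involutions_def)
    then obtain g h where g: "g \<in> carrier G" "f g = g'" and h: "h \<in> carrier G" "f h = h'"
      using surj by meson
    then obtain x where x: "x \<in> carrier G" "x \<otimes>\<^bsub>G\<^esub> g = h \<otimes>\<^bsub>G\<^esub> x"
      using conj flex g' h' unfolding flexible_involutions_conj_def by blast
    have "f x \<otimes>\<^bsub>H\<^esub> g' = h' \<otimes>\<^bsub>H\<^esub> f x"
      using arg_cong[OF x(2), of f] x(1) g h by (simp add: hom)
    then show "\<exists>x\<in>carrier H. x \<otimes>\<^bsub>H\<^esub> g' = h' \<otimes>\<^bsub>H\<^esub> x"
      using closed[OF x(1)] by blast
  qed
qed

section \<open>Centre and flexible involutions of a quotient\<close>

definition flip :: "nat \<Rightarrow> nat \<Rightarrow> real" where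
  "flip p = (\<lambda>i. if i = p then - 1 else 1)"

lemma flip_signs: "p < 6 \<Longrightarrow> flip p \<in> signs"
  by (auto simp: flip_def signs_def)

text \<open>A unit quaternion with square 1 equals its conjugate and is therefore real.\<close>

lemma qm_sqrt_one:
  assumes "norm q = 1" "qm q q = (1, 0)"
  shows "qm y q = qm q y"
proof -
  have "qm (qcnj q) (qm q q) = q"
    using assms(1) by simp
  then have "qcnj q = q"
    using assms(2) by simp
  then have "Im (fst q) = 0" "snd q = 0"
    by (simp_all add: qcnj_def prod_eq_iff complex_eq_iff)
  then have "q = (complex_of_real (Re (fst q)), 0)"
    by (simp add: prod_eq_iff complex_eq_iff)
  then obtain r where "q = (complex_of_real r, 0)"
    by blast
  then show ?thesis
    by (simp add: qm_def mult.commute)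
qed

lemma qm_sqrt_minus_one:
  assumes "norm q = 1" "qm q q = - (1, 0)"
  shows "Re (fst q) = 0"
proof -
  have "qm (qcnj q) (qm q q) = q"
    using assms(1) by simp
  then have "- qcnj q = q"
    unfolding assms(2) qm_uminus qm_one .
  then have "fst (- qcnj q) = fst q"
    by simp
  then show ?thesis
    by (simp add: qcnj_def complex_eq_iff)
qed

text \<open>Conjugation preserves the real part, so no u with nonzero real part is conjugate to -u.
  Hence the sign is plus at 1 + i and at 1 + j, and commuting with both makes D real.\<close>

lemma qm_sign_central:
  assumes D: "norm D = 1" and central: "\<And>u. norm u = 1 \<Longrightarrow> qm D u = qm u D \<or> qm D u = - qm u D"
  shows "\<exists>r. (r = 1 \<or> r = - 1) \<and> D = r *\<^sub>R (1, 0)"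
proof -
  have central': "qm D q = qm q D \<or> qm D q = - qm q D" if "q \<noteq> 0" for q
  proof -
    define u where "u = (1 / norm q) *\<^sub>R q"
    have u: "norm u = 1" and q: "q = norm q *\<^sub>R u"
      using that by (simp_all add: u_def)
    show ?thesis
      using central[OF u] by (subst (1 2 3 4) q) auto
  qed
  obtain z w where zw: "D = (z, w)"
    by (cases D)
  have ne: "z \<noteq> 0 \<or> w \<noteq> 0"
    using D by (auto simp: zw norm_Pair)
  have "w = 0"
  proof -
    have "qm D (Complex 1 1, 0) = qm (Complex 1 1, 0) D \<or> qm D (Complex 1 1, 0) = - qm (Complex 1 1, 0) D"
      by (rule central') (simp add: zero_prod_def complex_eq_iff)
    then show ?thesis
      using ne unfolding zw qm_Pair by (auto simp: complex_eq_iff algebra_simps)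
  qed
  moreover have "Im z = 0"
  proof -
    have "qm D (1, 1) = qm (1, 1) D \<or> qm D (1, 1) = - qm (1, 1) D"
      by (rule central') (simp add: zero_prod_def)
    then show ?thesis
      using ne \<open>w = 0\<close> unfolding zw qm_Pair by (auto simp: complex_eq_iff)
  qed
  ultimately have eq: "D = Re z *\<^sub>R (1, 0)"
    by (simp add: zw complex_eq_iff)
  then have "\<bar>Re z\<bar> = 1"
    using D by (simp add: norm_Pair)
  then have "Re z = 1 \<or> Re z = - 1"
    by linarith
  with eq show ?thesis
    by blast
qed

context sign_code
begin

lemma cls_mult_eq_iff:
  assumes "a \<in> tuples" "b \<in> tuples" "c \<in> tuples" "d \<in> tuples"
  shows "cls a \<otimes>\<^bsub>Gp\<^esub> cls b = cls c \<otimes>\<^bsub>Gp\<^esub> cls d \<longleftrightarrow> (\<exists>e\<in>C. tmul a b = act e (tmul c d))"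
  unfolding mult_Gp[OF assms(1,2)] mult_Gp[OF assms(3,4)] using cls_eq_iff[of "tmul c d" "tmul a b"] by metis

text \<open>An equation in the quotient holds for tuples up to a word of C. So a central class is
  represented by a tuple that commutes with each element of a single factor up to sign, which makes
  all its coordinates 1 or -1.\<close>

lemma central_signs:
  assumes d: "d \<in> tuples" and central: "\<And>x. x \<in> tuples \<Longrightarrow> cls d \<otimes>\<^bsub>Gp\<^esub> cls x = cls x \<otimes>\<^bsub>Gp\<^esub> cls d"
  shows "\<exists>s\<in>signs. d = act s tone"
proof -
  have "\<exists>r. (r = 1 \<or> r = - 1) \<and> d i = r *\<^sub>R (1, 0)" if i: "i < 6" for i
  proof (rule qm_sign_central)
    show "norm (d i) = 1"
      by (rule norm_tuples[OF d])
    fix u :: quat assume u: "norm u = 1"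
    have c: "coord i u \<in> tuples"
      using i u by simp
    obtain e where e: "e \<in> C" "tmul d (coord i u) = act e (tmul (coord i u) d)"
      using central[OF c] cls_mult_eq_iff[OF d c c d] by blast
    from fun_cong[OF e(2), of i] have "qm (d i) u = e i *\<^sub>R qm u (d i)"
      by (simp add: tmul_def act_def coord_def)
    moreover have "e i = 1 \<or> e i = - 1"
      using C_in_signs[OF e(1)] by (simp add: signs_def)
    ultimately show "qm (d i) u = qm u (d i) \<or> qm (d i) u = - qm u (d i)"
      by auto
  qed
  then obtain r where r: "\<And>i. i < 6 \<Longrightarrow> (r i = 1 \<or> r i = - 1) \<and> d i = r i *\<^sub>R (1, 0)"
    by metis
  define s where "s i = (if i < 6 then r i else 1)" for i
  have "s \<in> signs"
    using r by (simp add: signs_def s_def)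
  moreover have "d i = act s tone i" for i
    using r[of i] d by (cases "i < 6") (simp_all add: s_def act_def tone_def tuples_def)
  ultimately show ?thesis
    by blast
qed

lemma cls_sign_central:
  assumes s: "s \<in> signs" and x: "x \<in> tuples"
  shows "cls (act s tone) \<otimes>\<^bsub>Gp\<^esub> cls x = cls x \<otimes>\<^bsub>Gp\<^esub> cls (act s tone)"
  using act_tuples[OF s, of tone] x by (simp add: mult_Gp tmul_act)

text \<open>Conjugation by j changes i into -i, so at the coordinates i any sign s can be produced.
  At the coordinates 1 conjugation has no effect, and the sign has to come from a code word d; this
  is the condition \<open>twist\<close>.\<close>

lemma flexible_involution_cls:
  assumes x: "x \<in> tuples" and sq: "e \<in> C" "tmul x x = act e tone"
    and twist: "\<And>s. s \<in> signs \<Longrightarrow> \<exists>d\<in>C. \<forall>i<6. x i = (\<i>, 0) \<or> x i = (1, 0) \<and> d i = s i"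
  shows "cls x \<in> flexible_involutions Gp"
proof -
  have "cls x \<otimes>\<^bsub>Gp\<^esub> cls x = \<one>\<^bsub>Gp\<^esub>"
    using x sq by (simp add: mult_Gp one_Gp cls_act)
  moreover have "\<exists>y\<in>carrier Gp. y \<otimes>\<^bsub>Gp\<^esub> cls x = (cls x \<otimes>\<^bsub>Gp\<^esub> z) \<otimes>\<^bsub>Gp\<^esub> y"
    if z: "z \<in> carrier Gp" and central: "\<forall>y\<in>carrier Gp. z \<otimes>\<^bsub>Gp\<^esub> y = y \<otimes>\<^bsub>Gp\<^esub> z" for z
  proof -
    obtain c where c: "c \<in> tuples" "z = cls c"
      using z by (auto simp: carrier_Gp)
    have "cls c \<otimes>\<^bsub>Gp\<^esub> cls y = cls y \<otimes>\<^bsub>Gp\<^esub> cls c" if "y \<in> tuples" for y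
      using central that unfolding c(2) carrier_Gp by blast
    then obtain s where s: "s \<in> signs" "c = act s tone"
      using central_signs[OF c(1)] by blast
    obtain d where d: "d \<in> C" "\<forall>i<6. x i = (\<i>, 0) \<or> x i = (1, 0) \<and> d i = s i"
      using twist[OF s(1)] by blast
    \<comment> \<open>The conjugating tuple has j where the code word d leaves a sign to be
      corrected.\<close>
    define y where "y i = (if i < 6 \<and> s i * d i = - 1 then (0, 1) else (1, 0) :: quat)" for i
    have y: "y \<in> tuples"
      by (simp add: y_def tuples_def norm_Pair)
    have "tmul y x i = act d (tmul (tmul x c) y) i" for i
    proof (cases "i < 6")
      case True
      have sd: "d i * s i = 1 \<or> d i * s i = - 1"
        using signs_mult[OF C_in_signs[OF d(1)] s(1)] by (simp add: signs_def)
      have "act d (tmul (tmul x c) y) i = (d i * s i) *\<^sub>R qm (x i) (y i)"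
        unfolding s(2) tmul_act tmul_one by (simp add: act_def tmul_def)
      moreover have "qm (y i) (x i) = (d i * s i) *\<^sub>R qm (x i) (y i)"
        using d(2) True sd signs_square[OF s(1), of i] by (auto simp: y_def qm_Pair mult.commute)
      ultimately show ?thesis
        by (simp add: tmul_def)
    next
      case False
      then show ?thesis
        using x c y C_in_signs[OF d(1)] by (simp add: tmul_def act_def tuples_def signs_def)
    qed
    then have "tmul y x = act d (tmul (tmul x c) y)"
      by (rule ext)
    then have "cls y \<otimes>\<^bsub>Gp\<^esub> cls x = cls (tmul x c) \<otimes>\<^bsub>Gp\<^esub> cls y"
      using cls_mult_eq_iff[OF y x tuples_closed(2)[OF x c(1)] y] d(1) by blast
    then show ?thesis
      using y x c by (intro bexI[of _ "cls y"]) (simp_all add: mult_Gp carrier_Gp)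
  qed
  ultimately show ?thesis
    using x unfolding flexible_involutions_def carrier_Gp by blast
qed

text \<open>The square of x has the signs of a code word, so the coordinates p and q both square to
  1 or both to -1. If they square to 1 they are real, and conjugation cannot change them; then a
  sign change at p alone would need a code word that differs at p and q. So the square is -1 and the
  coordinate is imaginary.\<close>

lemma flexible_involution_coords:
  assumes partner: "\<And>p. p < 6 \<Longrightarrow> \<exists>q<6. q \<noteq> p \<and> (\<forall>e\<in>C. e p = e q)"
    and x: "x \<in> tuples" "cls x \<in> flexible_involutions Gp" and p: "p < 6"
  shows "Re (fst (x p)) = 0"
proof -
  have "cls (tmul x x) = cls tone"
    using x by (simp add: flexible_involutions_def mult_Gp one_Gp)
  then obtain e where e: "e \<in> C" "tmul x x = act e tone"
    using cls_eq_iff[of tone "tmul x x"] by auto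
  have sq: "qm (x i) (x i) = e i *\<^sub>R (1, 0)" for i
    using fun_cong[OF e(2), of i] by (simp add: tmul_def act_def tone_def)
  have "e p \<noteq> 1"
  proof
    assume ep: "e p = 1"
    obtain q where q: "q < 6" "q \<noteq> p" "\<And>e. e \<in> C \<Longrightarrow> e p = e q"
      using partner[OF p] by blast
    have comm: "qm y (x i) = qm (x i) y" if "i = p \<or> i = q" for y i
    proof (rule qm_sqrt_one[OF norm_tuples[OF x(1)]])
      have "e i = 1"
        using that q(3)[OF e(1)] ep by auto
      then show "qm (x i) (x i) = (1, 0)"
        using sq[of i] by simp
    qed
    \<comment> \<open>The central element that changes the sign at p alone.\<close>
    let ?z = "act (flip p) tone"
    have z: "?z \<in> tuples"
      by (intro act_tuples flip_signs p tuples_closed)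
    have zc: "cls ?z \<in> carrier Gp" "\<forall>y\<in>carrier Gp. cls ?z \<otimes>\<^bsub>Gp\<^esub> y = y \<otimes>\<^bsub>Gp\<^esub> cls ?z"
      using z cls_sign_central[OF flip_signs[OF p]] by (auto simp: carrier_Gp)
    then have "\<exists>y\<in>carrier Gp. y \<otimes>\<^bsub>Gp\<^esub> cls x = (cls x \<otimes>\<^bsub>Gp\<^esub> cls ?z) \<otimes>\<^bsub>Gp\<^esub> y"
      using x(2) unfolding flexible_involutions_def by blast
    then obtain y where y: "y \<in> tuples" "cls y \<otimes>\<^bsub>Gp\<^esub> cls x = cls (tmul x ?z) \<otimes>\<^bsub>Gp\<^esub> cls y"
      using x z by (auto simp: carrier_Gp mult_Gp)
    then obtain d where d: "d \<in> C" "tmul y x = act d (tmul (tmul x ?z) y)"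
      using cls_mult_eq_iff[OF y(1) x(1) tuples_closed(2)[OF x(1) z] y(1)] by blast
    have eq: "qm (y i) (x i) = (d i * flip p i) *\<^sub>R qm (x i) (y i)" for i
      using fun_cong[OF d(2), of i] unfolding tmul_act tmul_one by (simp add: tmul_def act_def)
    have one: "d i * flip p i = 1" if "i = p \<or> i = q" for i
    proof -
      have "(d i * flip p i - 1) *\<^sub>R qm (x i) (y i) = 0"
        using eq[of i] unfolding comm[OF that] scaleR_diff_left by simp
      moreover have "norm (qm (x i) (y i)) = 1"
        by (simp add: norm_qm norm_tuples[OF x(1)] norm_tuples[OF y(1)])
      then have "qm (x i) (y i) \<noteq> 0"
        by auto
      ultimately show ?thesis
        by (simp only: scaleR_eq_0_iff) simp
    qed
    show False
      using one[of p] one[of q] q(3)[OF d(1)] q(2) by (simp add: flip_def)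
  qed
  then have "e p = - 1"
    using C_in_signs[OF e(1)] by (auto simp: signs_def)
  then show ?thesis
    using qm_sqrt_minus_one[OF norm_tuples[OF x(1), of p]] sq[of p] by simp
qed

lemma flexible_involutions_conj_if_partner:
  assumes partner: "\<And>p. p < 6 \<Longrightarrow> \<exists>q<6. q \<noteq> p \<and> (\<forall>e\<in>C. e p = e q)"
  shows "flexible_involutions_conj Gp"
  unfolding flexible_involutions_conj_def
proof (intro ballI)
  fix g h assume gh: "g \<in> flexible_involutions Gp" "h \<in> flexible_involutions Gp"
  then have "g \<in> cls ` tuples" "h \<in> cls ` tuples"
    by (simp_all add: flexible_involutions_def carrier_Gp)
  then obtain x y where x: "x \<in> tuples" "g = cls x" and y: "y \<in> tuples" "h = cls y"
    by blast
  have "\<exists>u. norm u = 1 \<and> y i = qm u (qm (x i) (qcnj u))" if i: "i < 6" for i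
  proof -
    have "Re (fst (x i)) = 0" "Re (fst (y i)) = 0"
      using flexible_involution_coords[OF partner _ _ i] x y gh by blast+
    then show ?thesis
      using SU2_conj_if_Re_eq[OF norm_tuples[OF y(1), of i] norm_tuples[OF x(1), of i]] by metis
  qed
  then obtain u where u: "\<And>i. i < 6 \<Longrightarrow> norm (u i) = 1 \<and> y i = qm (u i) (qm (x i) (qcnj (u i)))"
    by metis
  define v where "v i = (if i < 6 then u i else (1, 0))" for i
  have v: "v \<in> tuples"
    using u by (simp add: v_def tuples_def)
  have "tmul v x i = tmul y v i" for i
  proof (cases "i < 6")
    case True
    have "qm (qm (u i) (qm (x i) (qcnj (u i)))) (u i) = qm (u i) (x i)"
      using u[OF True] by (simp add: qm_assoc)
    then show ?thesis
      using True u[OF True] by (simp add: tmul_def v_def)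
  next
    case False
    then show ?thesis
      using x(1) y(1) by (simp add: tmul_def v_def tuples_def)
  qed
  then have "tmul v x = tmul y v"
    by (rule ext)
  then show "\<exists>x\<in>carrier Gp. x \<otimes>\<^bsub>Gp\<^esub> g = h \<otimes>\<^bsub>Gp\<^esub> x"
    using v x y by (intro bexI[of _ "cls v"]) (simp_all add: mult_Gp carrier_Gp)
qed

end

section \<open>The two codes\<close>

definition pair_code :: "(nat \<Rightarrow> real) set" where
  "pair_code = {e \<in> signs. e 0 = e 1 \<and> e 2 = e 3 \<and> e 4 = e 5}"

text \<open>The coordinates 3, 4, 5 are tied only through their product, so the signs at any two of
  them can be prescribed with 1 at 0, 1, 2. This freedom makes (i, i, i, i, 1, 1) flexible.\<close>

definition triple_code :: "(nat \<Rightarrow> real) set" where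
  "triple_code = {e \<in> signs. e 0 = e 1 \<and> e 1 = e 2 \<and> e 3 * e 4 * e 5 = e 0}"

interpretation pair: sign_code pair_code
  by standard (auto simp: pair_code_def signs_one signs_mult)

interpretation triple: sign_code triple_code
proof
  show "(\<lambda>i. d i * e i) \<in> triple_code" if "d \<in> triple_code" "e \<in> triple_code" for d e
  proof -
    have "d 3 * e 3 * (d 4 * e 4) * (d 5 * e 5) = (d 3 * d 4 * d 5) * (e 3 * e 4 * e 5)"
      by (simp add: mult_ac)
    also have "\<dots> = d 0 * e 0"
      using that by (simp add: triple_code_def)
    finally show ?thesis
      using that by (simp add: triple_code_def signs_mult)
  qed
qed (auto simp: triple_code_def signs_one)

lemma pair_conj: "flexible_involutions_conj pair.Gp"
proof (rule pair.flexible_involutions_conj_if_partner)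
  fix p :: nat assume "p < 6"
  then consider "p = 0" | "p = 1" | "p = 2" | "p = 3" | "p = 4" | "p = 5"
    by linarith
  then show "\<exists>q<6. q \<noteq> p \<and> (\<forall>e\<in>pair_code. e p = e q)"
  proof cases
    case 1 then show ?thesis by (intro exI[of _ 1]) (simp add: pair_code_def)
  next
    case 2 then show ?thesis by (intro exI[of _ 0]) (simp add: pair_code_def)
  next
    case 3 then show ?thesis by (intro exI[of _ 3]) (simp add: pair_code_def)
  next
    case 4 then show ?thesis by (intro exI[of _ 2]) (simp add: pair_code_def)
  next
    case 5 then show ?thesis by (intro exI[of _ 5]) (simp add: pair_code_def)
  next
    case 6 then show ?thesis by (intro exI[of _ 4]) (simp add: pair_code_def)
  qed
qed

lemma triple_not_conj: "\<not> flexible_involutions_conj triple.Gp"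
proof
  assume conj: "flexible_involutions_conj triple.Gp"
  \<comment> \<open>The entry is i in the first m coordinates and 1 afterwards. For m = 4 and m = 6
    the square is a word of the code: the signs at 3, 4, 5 have product -1, which is the sign at 0,
    1, 2.\<close>
  define x where "x m i = (if i < m then (\<i>, 0) else (1, 0) :: quat)" for m i :: nat
  define e where "e m i = (if i < m then - 1 else 1 :: real)" for m i :: nat
  have x: "x m \<in> tuples" if "m \<le> 6" for m
    using that by (auto simp: x_def tuples_def norm_Pair)
  have sq: "tmul (x m) (x m) = act (e m) tone" for m
    by (auto simp: x_def e_def tmul_def act_def tone_def qm_Pair)
  have e: "e 4 \<in> triple_code" "e 6 \<in> triple_code"
    by (auto simp: e_def triple_code_def signs_def)
  have flex6: "triple.cls (x 6) \<in> flexible_involutions triple.Gp"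
  proof (rule triple.flexible_involution_cls[OF x e(2) sq])
    show "\<exists>d\<in>triple_code. \<forall>i<6. x 6 i = (\<i>, 0) \<or> x 6 i = (1, 0) \<and> d i = s i" for s
      using triple.C_one by (intro bexI[of _ "\<lambda>_. 1"]) (simp_all add: x_def)
  qed simp
  have flex4: "triple.cls (x 4) \<in> flexible_involutions triple.Gp"
  proof (rule triple.flexible_involution_cls[OF x e(1) sq])
    fix s assume s: "s \<in> signs"
    \<comment> \<open>The word d has to agree with s at 4 and 5, where the tuple is 1. Its sign at 3
      makes the product of the last three coordinates equal to 1.\<close>
    define d where "d i = (if i = 3 then s 4 * s 5 else if i = 4 \<or> i = 5 then s i else 1)" for i
    have "s 4 * s 5 * s 4 * s 5 = (s 4 * s 4) * (s 5 * s 5)"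
      by (simp add: mult_ac)
    then have "s 4 * s 5 * s 4 * s 5 = 1"
      by (simp add: signs_square[OF s])
    moreover have "d i = 1 \<or> d i = - 1" for i
    proof -
      have "s k = 1 \<or> s k = - 1" for k
        using s by (simp add: signs_def)
      from this[of 4] this[of 5] show ?thesis
        by (auto simp: d_def)
    qed
    ultimately have "d \<in> triple_code"
      by (simp add: triple_code_def signs_def) (simp add: d_def)
    moreover have "x 4 i = (\<i>, 0) \<or> x 4 i = (1, 0) \<and> d i = s i" if "i < 6" for i
    proof (cases "i < 4")
      case False
      then have "i = 4 \<or> i = 5"
        using that by linarith
      then show ?thesis
        by (auto simp: x_def d_def)
    qed (simp add: x_def)
    ultimately show "\<exists>d\<in>triple_code. \<forall>i<6. x 4 i = (\<i>, 0) \<or> x 4 i = (1, 0) \<and> d i = s i"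
      by blast
  qed simp
  obtain Y where "Y \<in> carrier triple.Gp" "Y \<otimes>\<^bsub>triple.Gp\<^esub> triple.cls (x 6) = triple.cls (x 4) \<otimes>\<^bsub>triple.Gp\<^esub> Y"
    using conj flex6 flex4 unfolding flexible_involutions_conj_def by blast
  then obtain y where y: "y \<in> tuples" "triple.cls y \<otimes>\<^bsub>triple.Gp\<^esub> triple.cls (x 6) = triple.cls (x 4) \<otimes>\<^bsub>triple.Gp\<^esub> triple.cls y"
    by (auto simp: triple.carrier_Gp)
  then obtain d where d: "tmul y (x 6) = act d (tmul (x 4) y)"
    using triple.cls_mult_eq_iff[OF y(1) x x y(1), of 6 4] by auto
  \<comment> \<open>At coordinate 5 a conjugation would turn i into a real number.\<close>
  have "qm (y 5) (\<i>, 0) = d 5 *\<^sub>R y 5"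
    using fun_cong[OF d, of 5] by (simp add: tmul_def act_def x_def)
  then have "qm (qcnj (y 5)) (qm (y 5) (\<i>, 0)) = qm (qcnj (y 5)) (d 5 *\<^sub>R y 5)"
    by (rule arg_cong)
  then have "(\<i>, 0) = d 5 *\<^sub>R (1 :: complex, 0 :: complex)"
    using norm_tuples[OF y(1), of 5] by simp
  then show False
    by (simp add: complex_eq_iff)
qed

lemma not_lie_group_isomorphic: "\<not> lie_group_isomorphic pair.Gp pair.Mf triple.Gp triple.Mf"
  using flexible_involutions_conj_iso[OF pair.group_Gp triple.group_Gp _ pair_conj] triple_not_conj
  unfolding lie_group_isomorphic_def by blast

section \<open>Comparing the irreducible representations\<close>

text \<open>An injection on classes is enough: two of them in opposite directions, between finite
  sets, give equal cardinalities.\<close>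

lemma irr_classes_embed:
  assumes f: "\<And>\<rho>. irreducible_rep G M n \<rho> \<Longrightarrow> irreducible_rep H N n (f \<rho>)"
    and iff: "\<And>\<rho> \<sigma>. irreducible_rep G M n \<rho> \<Longrightarrow> irreducible_rep G M n \<sigma> \<Longrightarrow>
      rep_isomorphic G n \<rho> \<sigma> \<longleftrightarrow> rep_isomorphic H n (f \<rho>) (f \<sigma>)"
  shows "\<exists>F. inj_on F (irr_classes G M n) \<and> F ` irr_classes G M n \<subseteq> irr_classes H N n"
proof -
  define r where "r V = (SOME \<rho>. \<rho> \<in> V)" for V :: "('a \<Rightarrow> complex mat) set"
  have r: "r V \<in> V" if "V \<in> irr_classes G M n" for V
  proof -
    have "V \<noteq> {}"
      using in_quotient_imp_non_empty[OF equiv_irr_iso that[unfolded irr_classes_def]] .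
    then show ?thesis
      unfolding r_def by (simp add: some_in_eq)
  qed
  have irr: "irreducible_rep G M n (r V)" if "V \<in> irr_classes G M n" for V
    using in_quotient_imp_subset[OF equiv_irr_iso that[unfolded irr_classes_def]] r[OF that] by blast
  define F where "F V = irr_iso H N n `` {f (r V)}" for V
  have "V = W" if VW: "V \<in> irr_classes G M n" "W \<in> irr_classes G M n" and eq: "F V = F W" for V W
  proof -
    have "(f (r V), f (r W)) \<in> irr_iso H N n"
      using eq_equiv_class[OF eq[unfolded F_def] equiv_irr_iso] f[OF irr[OF VW(2)]] by blast
    then have "(r V, r W) \<in> irr_iso G M n"
      using iff[OF irr[OF VW(1)] irr[OF VW(2)]] irr VW by simp
    then show ?thesis
      by (rule quotient_eqI[OF equiv_irr_iso VW[unfolded irr_classes_def] r[OF VW(1)] r[OF VW(2)]])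
  qed
  moreover have "F V \<in> irr_classes H N n" if "V \<in> irr_classes G M n" for V
    unfolding F_def irr_classes_def by (rule quotientI) (use f[OF irr[OF that]] in simp)
  ultimately show ?thesis
    by (intro exI[of _ F]) (auto simp: inj_on_def)
qed

section \<open>Central characters\<close>

lemma irreducible_repI:
  assumes "representation G M n \<rho>" "n > 0"
    and "\<And>W. vec_subspace n W \<Longrightarrow> (\<And>x w. x \<in> carrier G \<Longrightarrow> w \<in> W \<Longrightarrow> \<rho> x *\<^sub>v w \<in> W) \<Longrightarrow> W = {0\<^sub>v n} \<or> W = carrier_vec n"
  shows "irreducible_rep G M n \<rho>"
  unfolding irreducible_rep_def using assms(1,2) assms(3) by presburger

lemma irreducible_rep_pos: "irreducible_rep G M n \<rho> \<Longrightarrow> n > 0"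
  by (simp add: irreducible_rep_def)

text \<open>Schur's lemma for an involution: the vectors fixed by z form an invariant subspace. If
  it is zero, then v + z v, which is fixed, vanishes for every v, so z acts as -1.\<close>

lemma irr_central_involution:
  assumes irr: "irreducible_rep G M n \<sigma>" and z: "z \<in> carrier G" and sq: "z \<otimes>\<^bsub>G\<^esub> z = \<one>\<^bsub>G\<^esub>"
    and central: "\<And>x. x \<in> carrier G \<Longrightarrow> z \<otimes>\<^bsub>G\<^esub> x = x \<otimes>\<^bsub>G\<^esub> z"
  shows "\<sigma> z = 1\<^sub>m n \<or> \<sigma> z = (- 1) \<cdot>\<^sub>m 1\<^sub>m n"
proof -
  note rep = irreducible_rep_imp_rep[OF irr]
  note c = rep_carrier[OF rep z]
  let ?W = "{v \<in> carrier_vec n. \<sigma> z *\<^sub>v v = v}"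
  have subspace: "vec_subspace n ?W"
    unfolding vec_subspace_def
  proof (intro conjI ballI allI)
    show "0\<^sub>v n \<in> ?W"
      using c by auto
    show "v + w \<in> ?W" if "v \<in> ?W" "w \<in> ?W" for v w
      using that mult_add_distrib_mat_vec[OF c, of v w] by simp
    show "a \<cdot>\<^sub>v v \<in> ?W" if "v \<in> ?W" for a v
      using that mult_mat_vec[OF c, of v a] by simp
  qed auto
  have invariant: "\<sigma> x *\<^sub>v w \<in> ?W" if x: "x \<in> carrier G" and w: "w \<in> ?W" for x w
  proof -
    note cx = rep_carrier[OF rep x]
    have wc: "w \<in> carrier_vec n" "\<sigma> z *\<^sub>v w = w"
      using w by auto
    have "\<sigma> z * \<sigma> x = \<sigma> x * \<sigma> z"
      using rep_mult[OF rep z x] rep_mult[OF rep x z] central[OF x] by simp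
    then have "\<sigma> z *\<^sub>v (\<sigma> x *\<^sub>v w) = \<sigma> x *\<^sub>v w"
      using assoc_mult_mat_vec[OF c cx wc(1)] assoc_mult_mat_vec[OF cx c wc(1)] wc(2) by simp
    then show ?thesis
      using mult_mat_vec_carrier[OF cx wc(1)] by simp
  qed
  have "\<sigma> z * \<sigma> z = 1\<^sub>m n"
    using rep_mult[OF rep z z] rep_one[OF rep] unfolding sq by simp
  then have zz: "\<sigma> z *\<^sub>v (\<sigma> z *\<^sub>v v) = v" if "v \<in> carrier_vec n" for v
    using assoc_mult_mat_vec[OF c c that] that by simp
  consider "?W = {0\<^sub>v n}" | "?W = carrier_vec n"
    using irreducible_rep_subspace[OF irr subspace invariant] by blast
  then show ?thesis
  proof cases
    case 1
    have "\<sigma> z *\<^sub>v v = ((- 1) \<cdot>\<^sub>m 1\<^sub>m n) *\<^sub>v v" if v: "v \<in> carrier_vec n" for v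
    proof -
      have zv: "\<sigma> z *\<^sub>v v \<in> carrier_vec n"
        by (rule mult_mat_vec_carrier[OF c v])
      have "\<sigma> z *\<^sub>v (v + \<sigma> z *\<^sub>v v) = v + \<sigma> z *\<^sub>v v"
        using mult_add_distrib_mat_vec[OF c v zv] zz[OF v] comm_add_vec[OF v zv] by simp
      then have "v + \<sigma> z *\<^sub>v v \<in> ?W"
        using v zv by simp
      then have "v + \<sigma> z *\<^sub>v v = 0\<^sub>v n"
        unfolding 1 by simp
      then have "(v + \<sigma> z *\<^sub>v v) $ i = 0" if "i < n" for i
        using that by simp
      then have "(\<sigma> z *\<^sub>v v) $ i = - v $ i" if "i < n" for i
        using that v zv c by (simp add: eq_neg_iff_add_eq_0 add.commute del: index_mult_mat_vec)
      moreover have "(((- 1) \<cdot>\<^sub>m 1\<^sub>m n) *\<^sub>v v) $ i = - v $ i" if "i < n" for i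
      proof -
        have "row ((- 1) \<cdot>\<^sub>m 1\<^sub>m n) i = (- 1 :: complex) \<cdot>\<^sub>v unit_vec n i"
          using that by (intro eq_vecI) (auto simp: unit_vec_def)
        then show ?thesis
          using that v smult_scalar_prod_distrib[of "unit_vec n i" n v "- 1 :: complex"] by simp
      qed
      ultimately show ?thesis
        using zv v c by (intro eq_vecI) simp_all
    qed
    then show ?thesis
      using eq_mat_if_mult_vec_eq[OF c, of "(- 1) \<cdot>\<^sub>m 1\<^sub>m n"] by simp
  next
    case 2
    have "\<sigma> z *\<^sub>v v = 1\<^sub>m n *\<^sub>v v" if "v \<in> carrier_vec n" for v
    proof -
      have "v \<in> ?W"
        unfolding 2 by (rule that)
      then show ?thesis
        by simp
    qed
    then show ?thesis
      using eq_mat_if_mult_vec_eq[OF c one_carrier_mat] by blast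
  qed
qed

text \<open>The central character of an irreducible representation, as a subset of the six coordinates.\<close>

definition neg_coords :: "nat \<Rightarrow> ((nat \<Rightarrow> quat) \<Rightarrow> complex mat) \<Rightarrow> nat set" where
  "neg_coords n \<sigma> = {i. i < 6 \<and> \<sigma> (act (flip i) tone) \<noteq> 1\<^sub>m n}"

text \<open>The character of the sign group that is attached to the subset D.\<close>

definition char_val :: "nat set \<Rightarrow> (nat \<Rightarrow> real) \<Rightarrow> real" where
  "char_val D e = (\<Prod>i<6. if i \<in> D then e i else 1)"

abbreviation irr_tuples :: "nat \<Rightarrow> ((nat \<Rightarrow> quat) \<Rightarrow> complex mat) \<Rightarrow> bool" where
  "irr_tuples n \<equiv> irreducible_rep tuple_group tuple_space n"

lemma act_tone_tuples [simp]: "e \<in> signs \<Longrightarrow> act e tone \<in> tuples"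
  by (simp add: act_tuples)

lemma irr_tuples_flip:
  assumes irr: "irr_tuples n \<sigma>" and i: "i < 6"
  shows "\<sigma> (act (flip i) tone) = (if i \<in> neg_coords n \<sigma> then - 1 else 1) \<cdot>\<^sub>m 1\<^sub>m n"
proof -
  have "\<sigma> (act (flip i) tone) = 1\<^sub>m n \<or> \<sigma> (act (flip i) tone) = (- 1) \<cdot>\<^sub>m 1\<^sub>m n"
    by (rule irr_central_involution[OF irr])
      (use flip_signs[OF i] in \<open>simp_all add: tmul_act\<close>)
  moreover have "(1 :: complex) \<cdot>\<^sub>m 1\<^sub>m n = 1\<^sub>m n"
    by (intro eq_matI) auto
  ultimately show ?thesis
    using i by (auto simp: neg_coords_def)
qed

lemma smult_one_mult: "(a \<cdot>\<^sub>m 1\<^sub>m n) * (b \<cdot>\<^sub>m 1\<^sub>m n) = (a * b :: complex) \<cdot>\<^sub>m 1\<^sub>m n"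
proof -
  have "(a \<cdot>\<^sub>m 1\<^sub>m n) * (b \<cdot>\<^sub>m 1\<^sub>m n) = a \<cdot>\<^sub>m (1\<^sub>m n * (b \<cdot>\<^sub>m 1\<^sub>m n))"
    by (rule mult_smult_assoc_mat[of _ n n _ n]) auto
  then show ?thesis
    by (intro eq_matI) auto
qed

text \<open>A sign word is the product of the flips at its negative places; the induction adds one
  place at a time.\<close>

lemma irr_tuples_signs:
  assumes irr: "irr_tuples n \<sigma>" and e: "e \<in> signs"
  shows "\<sigma> (act e tone) = complex_of_real (char_val (neg_coords n \<sigma>) e) \<cdot>\<^sub>m 1\<^sub>m n"
proof -
  let ?D = "neg_coords n \<sigma>"
  note rep = irreducible_rep_imp_rep[OF irr]
  define em where "em m i = (if i < m then e i else 1)" for m i :: nat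
  have em: "em m \<in> signs" for m
    using e by (simp add: signs_def em_def)
  have "\<sigma> (act (em m) tone) = complex_of_real (\<Prod>i<m. if i \<in> ?D then e i else 1) \<cdot>\<^sub>m 1\<^sub>m n" if "m \<le> 6" for m
    using that
  proof (induction m)
    case 0
    have "em 0 = (\<lambda>_. 1)"
      by (simp add: em_def fun_eq_iff)
    moreover have "(1 :: complex) \<cdot>\<^sub>m 1\<^sub>m n = 1\<^sub>m n"
      by (intro eq_matI) auto
    ultimately show ?case
      using rep_one[OF rep] by simp
  next
    case (Suc m)
    then have IH: "\<sigma> (act (em m) tone) = complex_of_real (\<Prod>i<m. if i \<in> ?D then e i else 1) \<cdot>\<^sub>m 1\<^sub>m n" and m: "m < 6"
      by simp_all
    have "e m = 1 \<or> e m = - 1"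
      using e by (simp add: signs_def)
    then show ?case
    proof
      assume "e m = 1"
      then have "em (Suc m) = em m"
        by (auto simp: em_def fun_eq_iff less_Suc_eq)
      then show ?case
        using IH \<open>e m = 1\<close> by simp
    next
      assume "e m = - 1"
      then have "em (Suc m) = (\<lambda>i. em m i * flip m i)"
        by (auto simp: em_def fun_eq_iff less_Suc_eq flip_def)
      then have "act (em (Suc m)) tone = tmul (act (em m) tone) (act (flip m) tone)"
        by (simp add: tmul_act act_act mult.commute)
      then have "\<sigma> (act (em (Suc m)) tone) = \<sigma> (act (em m) tone) * \<sigma> (act (flip m) tone)"
        using rep_mult[OF rep, of "act (em m) tone" "act (flip m) tone"] em flip_signs[OF m] by simp
      then show ?case
        unfolding IH irr_tuples_flip[OF irr m] smult_one_mult using \<open>e m = - 1\<close> by (simp add: mult.commute)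
    qed
  qed
  from this[of 6] have "\<sigma> (act (em 6) tone) = complex_of_real (char_val ?D e) \<cdot>\<^sub>m 1\<^sub>m n"
    by (simp add: char_val_def)
  moreover have "em 6 = e"
    using e by (auto simp: em_def signs_def fun_eq_iff)
  ultimately show ?thesis
    by simp
qed

lemma smult_one_eq_one: "n > 0 \<Longrightarrow> (c :: complex) \<cdot>\<^sub>m 1\<^sub>m n = 1\<^sub>m n \<Longrightarrow> c = 1"
proof -
  assume n: "n > 0" and eq: "c \<cdot>\<^sub>m 1\<^sub>m n = 1\<^sub>m n"
  have "(c \<cdot>\<^sub>m 1\<^sub>m n) $$ (0, 0) = (1\<^sub>m n :: complex mat) $$ (0, 0)"
    by (simp only: eq)
  then show ?thesis
    using n by simp
qed

lemma irr_tuples_trivial_iff: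
  assumes irr: "irr_tuples n \<sigma>" and e: "e \<in> signs"
  shows "\<sigma> (act e tone) = 1\<^sub>m n \<longleftrightarrow> char_val (neg_coords n \<sigma>) e = 1"
proof
  assume one: "\<sigma> (act e tone) = 1\<^sub>m n"
  have "complex_of_real (char_val (neg_coords n \<sigma>) e) = 1"
    by (rule smult_one_eq_one[OF irreducible_rep_pos[OF irr] one[unfolded irr_tuples_signs[OF irr e]]])
  then show "char_val (neg_coords n \<sigma>) e = 1"
    by simp
next
  assume "char_val (neg_coords n \<sigma>) e = 1"
  then show "\<sigma> (act e tone) = 1\<^sub>m n"
    unfolding irr_tuples_signs[OF irr e] by (intro eq_matI) auto
qed

lemma neg_coords_iso_subset:
  assumes iso: "rep_isomorphic tuple_group n \<sigma> \<tau>" and \<tau>: "irr_tuples n \<tau>"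
  shows "neg_coords n \<tau> \<subseteq> neg_coords n \<sigma>"
proof -
  obtain P where P: "P \<in> carrier_mat n n" "invertible_mat P" "\<And>x. x \<in> tuples \<Longrightarrow> P * \<sigma> x = \<tau> x * P"
    using iso unfolding rep_isomorphic_def by auto
  obtain Q where Q: "Q \<in> carrier_mat n n" "P * Q = 1\<^sub>m n"
    using invertible_mat_obtain_inverse[OF P(1,2)] by metis
  have "\<tau> z = 1\<^sub>m n" if z: "z \<in> tuples" and one: "\<sigma> z = 1\<^sub>m n" for z
  proof -
    have c: "\<tau> z \<in> carrier_mat n n"
      using rep_carrier[OF irreducible_rep_imp_rep[OF \<tau>], of z] z by simp
    have "\<tau> z = \<tau> z * (P * Q)"
      using c Q by simp
    also have "\<dots> = (P * \<sigma> z) * Q"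
      using assoc_mult_mat[OF c P(1) Q(1)] P(3)[OF z] by simp
    also have "\<dots> = 1\<^sub>m n"
      using P(1) Q one by simp
    finally show ?thesis .
  qed
  then show ?thesis
    using flip_signs by (auto simp: neg_coords_def)
qed

lemma neg_coords_iso:
  assumes iso: "rep_isomorphic tuple_group n \<sigma> \<tau>" and \<sigma>: "irr_tuples n \<sigma>" and \<tau>: "irr_tuples n \<tau>"
  shows "neg_coords n \<sigma> = neg_coords n \<tau>"
  using neg_coords_iso_subset[OF iso \<tau>]
    neg_coords_iso_subset[OF rep_isomorphic_sym[OF iso irreducible_rep_imp_rep[OF \<sigma>] irreducible_rep_imp_rep[OF \<tau>]] \<sigma>]
  by (rule subset_antisym[rotated])

section \<open>Permutations of the coordinates\<close>

definition permute :: "(nat \<Rightarrow> nat) \<Rightarrow> (nat \<Rightarrow> quat) \<Rightarrow> nat \<Rightarrow> quat" where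
  "permute \<pi> x = (\<lambda>i. x (\<pi> i))"

text \<open>For an involution, permuting tuples and permuting subsets of coordinates need no
  distinction between \<pi> and its inverse.\<close>

definition coord_involution :: "(nat \<Rightarrow> nat) \<Rightarrow> bool" where
  "coord_involution \<pi> \<longleftrightarrow> (\<forall>i. \<pi> (\<pi> i) = i) \<and> (\<forall>i. \<pi> i < 6 \<longleftrightarrow> i < 6)"

lemma permute_tuples: "coord_involution \<pi> \<Longrightarrow> x \<in> tuples \<Longrightarrow> permute \<pi> x \<in> tuples"
  unfolding tuples_def coord_involution_def permute_def using not_less by blast

lemma permute_permute: "coord_involution \<pi> \<Longrightarrow> permute \<pi> (permute \<pi> x) = x"
  by (simp add: coord_involution_def permute_def)

lemma permute_flip: "coord_involution \<pi> \<Longrightarrow> permute \<pi> (act (flip i) tone) = act (flip (\<pi> i)) tone"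
  by (auto simp: permute_def act_def tone_def flip_def coord_involution_def fun_eq_iff)

lemma irr_tuples_permute:
  assumes \<pi>: "coord_involution \<pi>" and irr: "irr_tuples n \<sigma>"
  shows "irr_tuples n (\<lambda>x. \<sigma> (permute \<pi> x))"
proof (rule irreducible_repI)
  note rep = irreducible_rep_imp_rep[OF irr]
  show "representation tuple_group tuple_space n (\<lambda>x. \<sigma> (permute \<pi> x))"
    unfolding representation_def
  proof (intro conjI ballI allI impI)
    fix x assume x: "x \<in> carrier tuple_group"
    then show "\<sigma> (permute \<pi> x) \<in> carrier_mat n n"
      using rep_carrier[OF rep, of "permute \<pi> x"] permute_tuples[OF \<pi>] by simp
    fix y assume y: "y \<in> carrier tuple_group"
    have "permute \<pi> (tmul x y) = tmul (permute \<pi> x) (permute \<pi> y)"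
      by (simp add: permute_def tmul_def)
    then show "\<sigma> (permute \<pi> (x \<otimes>\<^bsub>tuple_group\<^esub> y)) = \<sigma> (permute \<pi> x) * \<sigma> (permute \<pi> y)"
      using rep_mult[OF rep, of "permute \<pi> x" "permute \<pi> y"] permute_tuples[OF \<pi>] x y by simp
  next
    have "permute \<pi> tone = tone"
      by (simp add: permute_def tone_def)
    then show "\<sigma> (permute \<pi> \<one>\<^bsub>tuple_group\<^esub>) = 1\<^sub>m n"
      using rep_one[OF rep] by simp
  next
    fix i j assume ij: "i < n" "j < n"
    have "continuous_on tuples (\<lambda>x. \<sigma> x $$ (i, j))"
      using rep ij by (simp add: representation_def tuple_space_def)
    moreover have "continuous_on tuples (permute \<pi>)"
      unfolding permute_def by (intro continuous_on_coordinatewise_then_product continuous_on_coord)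
    ultimately have "continuous_on tuples (\<lambda>x. \<sigma> (permute \<pi> x) $$ (i, j))"
      by (rule continuous_on_compose2) (use permute_tuples[OF \<pi>] in blast)
    then show "continuous_map (mtop tuple_space) euclidean (\<lambda>x. \<sigma> (permute \<pi> x) $$ (i, j))"
      by (simp add: tuple_space_def)
  qed
  show "n > 0"
    by (rule irreducible_rep_pos[OF irr])
  fix W assume W: "vec_subspace n W" and inv: "\<And>x w. x \<in> carrier tuple_group \<Longrightarrow> w \<in> W \<Longrightarrow> \<sigma> (permute \<pi> x) *\<^sub>v w \<in> W"
  show "W = {0\<^sub>v n} \<or> W = carrier_vec n"
  proof (rule irreducible_rep_subspace[OF irr W])
    fix x w assume "x \<in> carrier tuple_group" "w \<in> W"
    then show "\<sigma> x *\<^sub>v w \<in> W"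
      using inv[of "permute \<pi> x" w] permute_tuples[OF \<pi>] by (simp add: permute_permute[OF \<pi>])
  qed
qed

lemma neg_coords_permute:
  "coord_involution \<pi> \<Longrightarrow> neg_coords n (\<lambda>x. \<sigma> (permute \<pi> x)) = {i. \<pi> i \<in> neg_coords n \<sigma>}"
  by (auto simp: neg_coords_def permute_flip) (auto simp: coord_involution_def)

lemma rep_isomorphic_permute:
  assumes \<pi>: "coord_involution \<pi>"
  shows "rep_isomorphic tuple_group n (\<lambda>x. \<sigma> (permute \<pi> x)) (\<lambda>x. \<tau> (permute \<pi> x)) \<longleftrightarrow> rep_isomorphic tuple_group n \<sigma> \<tau>"
proof -
  have "(\<forall>x\<in>tuples. P * \<sigma> (permute \<pi> x) = \<tau> (permute \<pi> x) * P) \<longleftrightarrow> (\<forall>x\<in>tuples. P * \<sigma> x = \<tau> x * P)" for P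
    using permute_tuples[OF \<pi>] permute_permute[OF \<pi>] by metis
  then show ?thesis
    by (simp add: rep_isomorphic_def)
qed

section \<open>Passing between a quotient and SU(2)^6\<close>

context sign_code
begin

lemma irr_pullback:
  assumes irr: "irreducible_rep Gp Mf n \<rho>"
  shows "irr_tuples n (\<lambda>x. \<rho> (cls x))"
proof (rule irreducible_repI)
  note rep = irreducible_rep_imp_rep[OF irr]
  show "representation tuple_group tuple_space n (\<lambda>x. \<rho> (cls x))"
    unfolding representation_def
  proof (intro conjI ballI allI impI)
    fix x assume x: "x \<in> carrier tuple_group"
    then show "\<rho> (cls x) \<in> carrier_mat n n"
      using rep_carrier[OF rep] by (simp add: carrier_Gp)
    fix y assume "y \<in> carrier tuple_group"
    then show "\<rho> (cls (x \<otimes>\<^bsub>tuple_group\<^esub> y)) = \<rho> (cls x) * \<rho> (cls y)"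
      using rep_mult[OF rep, of "cls x" "cls y"] x by (simp add: carrier_Gp mult_Gp)
  next
    show "\<rho> (cls \<one>\<^bsub>tuple_group\<^esub>) = 1\<^sub>m n"
      using rep_one[OF rep] by (simp add: one_Gp)
  next
    fix i j assume "i < n" "j < n"
    then have "continuous_map Tp euclidean (\<lambda>A. \<rho> A $$ (i, j))"
      using rep by (simp add: representation_def)
    from continuous_map_compose[OF continuous_map_cls this]
    show "continuous_map (mtop tuple_space) euclidean (\<lambda>x. \<rho> (cls x) $$ (i, j))"
      by (simp add: tuple_space_def o_def)
  qed
  show "n > 0"
    by (rule irreducible_rep_pos[OF irr])
  fix W assume W: "vec_subspace n W" and inv: "\<And>x w. x \<in> carrier tuple_group \<Longrightarrow> w \<in> W \<Longrightarrow> \<rho> (cls x) *\<^sub>v w \<in> W"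
  show "W = {0\<^sub>v n} \<or> W = carrier_vec n"
    by (rule irreducible_rep_subspace[OF irr W]) (use inv in \<open>auto simp: carrier_Gp\<close>)
qed

lemma rep_isomorphic_pullback:
  "rep_isomorphic Gp n \<rho> \<sigma> \<longleftrightarrow> rep_isomorphic tuple_group n (\<lambda>x. \<rho> (cls x)) (\<lambda>x. \<sigma> (cls x))"
  by (simp add: rep_isomorphic_def carrier_Gp)

lemma finite_irr_classes_Gp: "finite (irr_classes Gp Mf n)"
proof -
  obtain F where "inj_on F (irr_classes Gp Mf n)" "F ` irr_classes Gp Mf n \<subseteq> irr_classes tuple_group tuple_space n"
    using irr_classes_embed[OF irr_pullback rep_isomorphic_pullback] by blast
  then show ?thesis
    using finite_irr_classes_tuple_group by (rule inj_on_finite)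
qed

text \<open>The dual code, with a word given by its support: the characters of the sign group that
  are trivial on C.\<close>

definition dual :: "nat set set" where
  "dual = {D. D \<subseteq> {..<6} \<and> (\<forall>e\<in>C. char_val D e = 1)}"

lemma neg_coords_dual:
  assumes irr: "irreducible_rep Gp Mf n \<rho>"
  shows "neg_coords n (\<lambda>x. \<rho> (cls x)) \<in> dual"
proof -
  have "char_val (neg_coords n (\<lambda>x. \<rho> (cls x))) e = 1" if e: "e \<in> C" for e
  proof -
    have "\<rho> (cls (act e tone)) = 1\<^sub>m n"
      using cls_act[OF e] rep_one[OF irreducible_rep_imp_rep[OF irr]] by (simp add: one_Gp)
    then show ?thesis
      using irr_tuples_trivial_iff[OF irr_pullback[OF irr] C_in_signs[OF e]] by blast
  qed
  then show ?thesis
    by (auto simp: dual_def neg_coords_def)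
qed

text \<open>The representative differs from x by an element of C, on which \<sigma> is trivial
  because its central character lies in the dual code. So \<sigma> descends to the quotient.\<close>

lemma irr_tuples_pick:
  assumes irr: "irr_tuples n \<sigma>" and D: "neg_coords n \<sigma> \<in> dual" and x: "x \<in> tuples"
  shows "\<sigma> (pick (cls x)) = \<sigma> x"
proof -
  note rep = irreducible_rep_imp_rep[OF irr]
  obtain e where e: "e \<in> C" "pick (cls x) = act e x"
    using pick_cls[OF x] by blast
  have "\<sigma> (act e tone) = 1\<^sub>m n"
    using D e(1) irr_tuples_trivial_iff[OF irr C_in_signs[OF e(1)]] by (simp add: dual_def)
  moreover have "\<sigma> (act e x) = \<sigma> (act e tone) * \<sigma> x"
    using rep_mult[OF rep, of "act e tone" x] C_in_signs[OF e(1)] x by (simp add: tmul_act)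
  ultimately show ?thesis
    using rep_carrier[OF rep, of x] x e by simp
qed

lemma irr_pushforward:
  assumes irr: "irr_tuples n \<sigma>" and D: "neg_coords n \<sigma> \<in> dual"
  shows "irreducible_rep Gp Mf n (\<lambda>A. \<sigma> (pick A))"
proof (rule irreducible_repI)
  note rep = irreducible_rep_imp_rep[OF irr]
  note pick_eq = irr_tuples_pick[OF irr D]
  show "representation Gp Mf n (\<lambda>A. \<sigma> (pick A))"
    unfolding representation_def
  proof (intro conjI ballI allI impI)
    fix A assume "A \<in> carrier Gp"
    then obtain x where x: "x \<in> tuples" "A = cls x"
      by (auto simp: carrier_Gp)
    then show "\<sigma> (pick A) \<in> carrier_mat n n"
      using rep_carrier[OF rep, of x] by (simp add: pick_eq)
    fix B assume "B \<in> carrier Gp"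
    then obtain y where y: "y \<in> tuples" "B = cls y"
      by (auto simp: carrier_Gp)
    show "\<sigma> (pick (A \<otimes>\<^bsub>Gp\<^esub> B)) = \<sigma> (pick A) * \<sigma> (pick B)"
      using rep_mult[OF rep, of x y] x y by (simp add: mult_Gp pick_eq)
  next
    show "\<sigma> (pick \<one>\<^bsub>Gp\<^esub>) = 1\<^sub>m n"
      using rep_one[OF rep] by (simp add: one_Gp pick_eq)
  next
    fix i j assume ij: "i < n" "j < n"
    have c: "continuous_map (top_of_set tuples) euclidean (\<lambda>x. \<sigma> x $$ (i, j))"
      using rep ij by (simp add: representation_def tuple_space_def)
    have "continuous_map (subtopology Tp (cls ` tuples)) euclidean (\<lambda>A. \<sigma> (pick A) $$ (i, j))"
    proof (rule continuous_map_from_Tp)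
      show "openin (top_of_set tuples) {x \<in> tuples. \<sigma> x $$ (i, j) \<in> V}" if "openin euclidean V" for V
        using openin_continuous_map_preimage[OF c that] by simp
    qed (simp_all add: pick_eq)
    then show "continuous_map (mtop Mf) euclidean (\<lambda>A. \<sigma> (pick A) $$ (i, j))"
      using subtopology_topspace[of Tp] by (simp add: topspace_Tp)
  qed
  show "n > 0"
    by (rule irreducible_rep_pos[OF irr])
  fix W assume W: "vec_subspace n W" and inv: "\<And>A w. A \<in> carrier Gp \<Longrightarrow> w \<in> W \<Longrightarrow> \<sigma> (pick A) *\<^sub>v w \<in> W"
  show "W = {0\<^sub>v n} \<or> W = carrier_vec n"
  proof (rule irreducible_rep_subspace[OF irr W])
    fix x w assume "x \<in> carrier tuple_group" "w \<in> W"
    then show "\<sigma> x *\<^sub>v w \<in> W"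
      using inv[of "cls x" w] by (simp add: carrier_Gp pick_eq)
  qed
qed

end

text \<open>
  Permuting the coordinates of \<open>SU(2)\<^sup>6\<close> by \<open>\<pi> D\<close>, where \<open>D\<close> is the central character, turns the
  irreducible representations that are trivial on \<open>C\<close> into ones that are trivial on \<open>C'\<close>.
\<close>

lemma card_irr_classes_le:
  assumes "sign_code C" "sign_code C'"
    and \<pi>: "\<And>D. D \<in> sign_code.dual C \<Longrightarrow> coord_involution (\<pi> D) \<and> {i. \<pi> D i \<in> D} \<in> sign_code.dual C'"
    and inj: "\<And>D E. D \<in> sign_code.dual C \<Longrightarrow> E \<in> sign_code.dual C \<Longrightarrow> {i. \<pi> D i \<in> D} = {i. \<pi> E i \<in> E} \<Longrightarrow> D = E"
  shows "card (irr_classes (sign_code.Gp C) (sign_code.Mf C) n) \<le> card (irr_classes (sign_code.Gp C') (sign_code.Mf C') n)"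
proof -
  interpret C: sign_code C by (rule assms(1))
  interpret C': sign_code C' by (rule assms(2))
  define D where "D \<rho> = neg_coords n (\<lambda>x. \<rho> (C.cls x))" for \<rho> :: "lie_elem \<Rightarrow> complex mat"
  define \<sigma> where "\<sigma> \<rho> x = \<rho> (C.cls (permute (\<pi> (D \<rho>)) x))" for \<rho> :: "lie_elem \<Rightarrow> complex mat" and x
  define f where "f \<rho> = (\<lambda>A. \<sigma> \<rho> (C'.pick A))" for \<rho>
  have D: "D \<rho> \<in> C.dual" if "irreducible_rep C.Gp C.Mf n \<rho>" for \<rho>
    unfolding D_def by (rule C.neg_coords_dual[OF that])
  have \<sigma>: "irr_tuples n (\<sigma> \<rho>)" "neg_coords n (\<sigma> \<rho>) = {i. \<pi> (D \<rho>) i \<in> D \<rho>}" "neg_coords n (\<sigma> \<rho>) \<in> C'.dual"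
    if \<rho>: "irreducible_rep C.Gp C.Mf n \<rho>" for \<rho>
  proof -
    note inv = \<pi>[OF D[OF \<rho>]]
    have eq: "\<sigma> \<rho> = (\<lambda>x. \<rho> (C.cls (permute (\<pi> (D \<rho>)) x)))"
      by (simp add: \<sigma>_def fun_eq_iff)
    show "irr_tuples n (\<sigma> \<rho>)"
      unfolding eq using inv C.irr_pullback[OF \<rho>] by (intro irr_tuples_permute) auto
    show "neg_coords n (\<sigma> \<rho>) = {i. \<pi> (D \<rho>) i \<in> D \<rho>}"
      using neg_coords_permute[of "\<pi> (D \<rho>)" n "\<lambda>x. \<rho> (C.cls x)"] inv unfolding eq D_def[symmetric] by blast
    with inv show "neg_coords n (\<sigma> \<rho>) \<in> C'.dual"
      by simp
  qed
  have "\<exists>F. inj_on F (irr_classes C.Gp C.Mf n) \<and> F ` irr_classes C.Gp C.Mf n \<subseteq> irr_classes C'.Gp C'.Mf n"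
  proof (rule irr_classes_embed)
    show "irreducible_rep C'.Gp C'.Mf n (f \<rho>)" if "irreducible_rep C.Gp C.Mf n \<rho>" for \<rho>
      unfolding f_def by (rule C'.irr_pushforward[OF \<sigma>(1)[OF that] \<sigma>(3)[OF that]])
    fix \<rho> \<tau> assume \<rho>: "irreducible_rep C.Gp C.Mf n \<rho>" and \<tau>: "irreducible_rep C.Gp C.Mf n \<tau>"
    have "rep_isomorphic C'.Gp n (f \<rho>) (f \<tau>) \<longleftrightarrow> rep_isomorphic tuple_group n (\<sigma> \<rho>) (\<sigma> \<tau>)"
      unfolding C'.rep_isomorphic_pullback[of n "f \<rho>" "f \<tau>"] unfolding f_def rep_isomorphic_def tuple_group_simps
      using C'.irr_tuples_pick[OF \<sigma>(1)[OF \<rho>] \<sigma>(3)[OF \<rho>]] C'.irr_tuples_pick[OF \<sigma>(1)[OF \<tau>] \<sigma>(3)[OF \<tau>]] by simp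
    also have "\<dots> \<longleftrightarrow> rep_isomorphic C.Gp n \<rho> \<tau>"
    \<comment> \<open>With equal central characters both representations undergo the same
      permutation, which preserves equivalence in both directions. With different ones neither pair
      is equivalent: the injectivity of the map on words keeps the permuted characters
      apart.\<close>
    proof (cases "D \<rho> = D \<tau>")
      case True
      have "rep_isomorphic tuple_group n (\<sigma> \<rho>) (\<sigma> \<tau>) \<longleftrightarrow>
          rep_isomorphic tuple_group n (\<lambda>x. \<rho> (C.cls x)) (\<lambda>x. \<tau> (C.cls x))"
        using rep_isomorphic_permute[of "\<pi> (D \<tau>)" n "\<lambda>x. \<rho> (C.cls x)" "\<lambda>x. \<tau> (C.cls x)"] \<pi>[OF D[OF \<tau>]] True
        unfolding \<sigma>_def[abs_def] by simp
      then show ?thesis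
        unfolding C.rep_isomorphic_pullback .
    next
      case False
      then have "\<not> rep_isomorphic C.Gp n \<rho> \<tau>"
        using neg_coords_iso[OF _ C.irr_pullback[OF \<rho>] C.irr_pullback[OF \<tau>]] unfolding C.rep_isomorphic_pullback D_def by blast
      moreover have "\<not> rep_isomorphic tuple_group n (\<sigma> \<rho>) (\<sigma> \<tau>)"
        using neg_coords_iso[OF _ \<sigma>(1)[OF \<rho>] \<sigma>(1)[OF \<tau>]] inj[OF D[OF \<rho>] D[OF \<tau>]] False
        unfolding \<sigma>(2)[OF \<rho>] \<sigma>(2)[OF \<tau>] by blast
      ultimately show ?thesis
        by blast
    qed
    finally show "rep_isomorphic C.Gp n \<rho> \<tau> \<longleftrightarrow> rep_isomorphic C'.Gp n (f \<rho>) (f \<tau>)" ..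
  qed
  then obtain F where "inj_on F (irr_classes C.Gp C.Mf n)" "F ` irr_classes C.Gp C.Mf n \<subseteq> irr_classes C'.Gp C'.Mf n"
    by (elim exE conjE)
  then show ?thesis
    using C'.finite_irr_classes_Gp by (rule card_inj_on_le)
qed

section \<open>The two dual codes and the matching of their words\<close>

lemma char_val_expand:
  "char_val D e = (if 0 \<in> D then e 0 else 1) * (if 1 \<in> D then e 1 else 1) * (if 2 \<in> D then e 2 else 1) *
     (if 3 \<in> D then e 3 else 1) * (if 4 \<in> D then e 4 else 1) * (if 5 \<in> D then e 5 else 1)"
proof -
  have "{..<6 :: nat} = {0, 1, 2, 3, 4, 5}"
    by auto
  then show ?thesis
    by (simp add: char_val_def mult.assoc)
qed

lemma pair_dual_iff:
  "D \<in> pair.dual \<longleftrightarrow> D \<subseteq> {..<6} \<and> (0 \<in> D \<longleftrightarrow> 1 \<in> D) \<and> (2 \<in> D \<longleftrightarrow> 3 \<in> D) \<and> (4 \<in> D \<longleftrightarrow> 5 \<in> D)"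
proof (rule iffI)
  assume D: "D \<in> pair.dual"
  have one: "char_val D (\<lambda>i. if i = a \<or> i = b then - 1 else 1) = 1" if "(a, b) \<in> {(0, 1), (2, 3), (4, 5)}" for a b
  proof -
    have "(\<lambda>i. if i = a \<or> i = b then - 1 else 1) \<in> pair_code"
      using that by (auto simp: pair_code_def signs_def)
    then show ?thesis
      using D by (simp add: pair.dual_def)
  qed
  have "D \<subseteq> {..<6}"
    using D by (simp add: pair.dual_def)
  then show "D \<subseteq> {..<6} \<and> (0 \<in> D \<longleftrightarrow> 1 \<in> D) \<and> (2 \<in> D \<longleftrightarrow> 3 \<in> D) \<and> (4 \<in> D \<longleftrightarrow> 5 \<in> D)"
    using one[of 0 1] one[of 2 3] one[of 4 5] by (simp add: char_val_expand split: if_splits)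
next
  assume D: "D \<subseteq> {..<6} \<and> (0 \<in> D \<longleftrightarrow> 1 \<in> D) \<and> (2 \<in> D \<longleftrightarrow> 3 \<in> D) \<and> (4 \<in> D \<longleftrightarrow> 5 \<in> D)"
  have "char_val D e = 1" if e: "e \<in> pair_code" for e
  proof -
    have sq: "e i * e i = 1" for i
      using e by (intro signs_square) (simp add: pair_code_def)
    have "e 1 = e 0" "e 3 = e 2" "e 5 = e 4"
      using e by (simp_all add: pair_code_def)
    then show ?thesis
      using D sq[of 0] sq[of 2] sq[of 4] by (cases "0 \<in> D"; cases "2 \<in> D"; cases "4 \<in> D") (simp_all add: char_val_expand)
  qed
  then show "D \<in> pair.dual"
    using D by (simp add: pair.dual_def)
qed

lemma triple_dual_iff:
  "D \<in> triple.dual \<longleftrightarrow> D \<subseteq> {..<6} \<and> (3 \<in> D \<longleftrightarrow> 4 \<in> D) \<and> (3 \<in> D \<longleftrightarrow> 5 \<in> D) \<and>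
     (3 \<in> D \<longleftrightarrow> ((0 \<in> D) \<noteq> ((1 \<in> D) \<noteq> (2 \<in> D))))"
proof (intro iffI)
  assume D: "D \<in> triple.dual"
  \<comment> \<open>The words with -1 at 0, 1, 2 and at one of 3, 4, 5 generate the code, so testing
    D against them is enough.\<close>
  have one: "char_val D (\<lambda>i. if i < 3 \<or> i = a then - 1 else 1) = 1" if "a \<in> {3, 4, 5}" for a
  proof -
    have "(\<lambda>i. if i < 3 \<or> i = a then - 1 else 1) \<in> triple_code"
      using that by (auto simp: triple_code_def signs_def)
    then show ?thesis
      using D by (simp add: triple.dual_def)
  qed
  have "D \<subseteq> {..<6}"
    using D by (simp add: triple.dual_def)
  then show "D \<subseteq> {..<6} \<and> (3 \<in> D \<longleftrightarrow> 4 \<in> D) \<and> (3 \<in> D \<longleftrightarrow> 5 \<in> D) \<and>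
     (3 \<in> D \<longleftrightarrow> ((0 \<in> D) \<noteq> ((1 \<in> D) \<noteq> (2 \<in> D))))"
    using one[of 3] one[of 4] one[of 5] by (simp add: char_val_expand split: if_splits)
next
  assume D: "D \<subseteq> {..<6} \<and> (3 \<in> D \<longleftrightarrow> 4 \<in> D) \<and> (3 \<in> D \<longleftrightarrow> 5 \<in> D) \<and>
     (3 \<in> D \<longleftrightarrow> ((0 \<in> D) \<noteq> ((1 \<in> D) \<noteq> (2 \<in> D))))"
  have "char_val D e = 1" if e: "e \<in> triple_code" for e
  proof -
    have sq: "e 0 * e 0 = 1"
      using e by (intro signs_square) (simp add: triple_code_def)
    have "e 1 = e 0" "e 2 = e 0" "e 3 * e 4 * e 5 = e 0"
      using e by (simp_all add: triple_code_def)
    then have "e 1 = e 0" "e 2 = e 0" "e 0 * e 3 * e 4 * e 5 = 1"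
      using sq by (simp_all add: mult.assoc)
    then show ?thesis
      using D sq by (cases "0 \<in> D"; cases "1 \<in> D"; cases "2 \<in> D") (simp_all add: char_val_expand)
  qed
  then show "D \<in> triple.dual"
    using D by (simp add: triple.dual_def)
qed

definition swap13 :: "nat \<Rightarrow> nat" where
  "swap13 i = (if i = 1 then 3 else if i = 3 then 1 else i)"

definition swap04_25 :: "nat \<Rightarrow> nat" where
  "swap04_25 i = (if i = 0 then 4 else if i = 4 then 0 else if i = 2 then 5 else if i = 5 then 2 else i)"

text \<open>
  The words of the first dual code are \<open>a a b b c c\<close>, and two of \<open>a, b, c\<close> agree; those of the
  second are \<open>p q r t t t\<close> with \<open>t = p + q + r\<close>, so \<open>t\<close> and one of \<open>p, q, r\<close> are equal to each other
  and the other two are equal to each other.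
\<close>

definition pair_perm :: "nat set \<Rightarrow> nat \<Rightarrow> nat" where
  "pair_perm D = (if (2 \<in> D) = (4 \<in> D) then id else if (0 \<in> D) = (4 \<in> D) then swap13 else swap04_25)"

definition triple_perm :: "nat set \<Rightarrow> nat \<Rightarrow> nat" where
  "triple_perm D = (if (0 \<in> D) = (1 \<in> D) then id else if (1 \<in> D) = (2 \<in> D) then swap13 else swap04_25)"

lemma coord_involution_perms: "coord_involution id" "coord_involution swap13" "coord_involution swap04_25"
  by (auto simp: coord_involution_def swap13_def swap04_25_def)

lemma perms_subset:
  assumes "coord_involution \<pi>" "D \<subseteq> {..<6}"
  shows "{i. \<pi> i \<in> D} \<subseteq> {..<6}"
  using assms unfolding coord_involution_def by blast

lemma perm_values:
  "swap13 0 = 0" "swap13 1 = 3" "swap13 2 = 2" "swap13 3 = 1" "swap13 4 = 4" "swap13 5 = 5"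
  "swap04_25 0 = 4" "swap04_25 1 = 1" "swap04_25 2 = 5" "swap04_25 3 = 3" "swap04_25 4 = 0" "swap04_25 5 = 2"
  by (simp_all add: swap13_def swap04_25_def)

lemma coords_eqI:
  assumes "D \<subseteq> {..<6}" "E \<subseteq> {..<6}" "\<And>i. i \<in> {0, 1, 2, 3, 4, 5 :: nat} \<Longrightarrow> i \<in> D \<longleftrightarrow> i \<in> E"
  shows "D = E"
proof -
  have "{..<6 :: nat} = {0, 1, 2, 3, 4, 5}"
    by auto
  then show ?thesis
    using assms by blast
qed

lemma pair_perm_coord_involution: "coord_involution (pair_perm D)"
  and triple_perm_coord_involution: "coord_involution (triple_perm D)"
  using coord_involution_perms by (simp_all add: pair_perm_def triple_perm_def)

lemma pair_perm_dual:
  assumes "D \<in> pair.dual"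
  shows "{i. pair_perm D i \<in> D} \<in> triple.dual"
proof -
  have D: "D \<subseteq> {..<6}" "0 \<in> D \<longleftrightarrow> 1 \<in> D" "2 \<in> D \<longleftrightarrow> 3 \<in> D" "4 \<in> D \<longleftrightarrow> 5 \<in> D"
    using assms unfolding pair_dual_iff by blast+
  show ?thesis
    unfolding triple_dual_iff mem_Collect_eq
  proof (intro conjI perms_subset pair_perm_coord_involution D(1))
  qed (use D(2-4) in \<open>cases "0 \<in> D"; cases "2 \<in> D"; cases "4 \<in> D"; simp add: pair_perm_def perm_values perm_values[simplified]\<close>)+
qed

lemma triple_perm_dual:
  assumes "D \<in> triple.dual"
  shows "{i. triple_perm D i \<in> D} \<in> pair.dual"
proof -
  have D: "D \<subseteq> {..<6}" "3 \<in> D \<longleftrightarrow> 4 \<in> D" "3 \<in> D \<longleftrightarrow> 5 \<in> D" "3 \<in> D \<longleftrightarrow> ((0 \<in> D) \<noteq> ((1 \<in> D) \<noteq> (2 \<in> D)))"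
    using assms unfolding triple_dual_iff by blast+
  show ?thesis
    unfolding pair_dual_iff mem_Collect_eq
  proof (intro conjI perms_subset triple_perm_coord_involution D(1))
  qed (use D(2-4) in \<open>cases "0 \<in> D"; cases "1 \<in> D"; cases "2 \<in> D"; simp add: triple_perm_def perm_values perm_values[simplified]\<close>)+
qed

text \<open>On the permuted word, the tests of \<open>triple_perm\<close> recognise the case from
  which the word came. So the same involution is applied twice.\<close>

lemma triple_perm_pair_perm:
  assumes "D \<in> pair.dual"
  shows "{i. triple_perm {i. pair_perm D i \<in> D} i \<in> {i. pair_perm D i \<in> D}} = D"
proof (rule coords_eqI)
  have D: "D \<subseteq> {..<6}" "0 \<in> D \<longleftrightarrow> 1 \<in> D" "2 \<in> D \<longleftrightarrow> 3 \<in> D" "4 \<in> D \<longleftrightarrow> 5 \<in> D"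
    using assms unfolding pair_dual_iff by blast+
  show "D \<subseteq> {..<6}"
    by (rule D(1))
  show "{i. triple_perm {i. pair_perm D i \<in> D} i \<in> {i. pair_perm D i \<in> D}} \<subseteq> {..<6}"
    by (intro perms_subset triple_perm_coord_involution pair_perm_coord_involution D(1))
  fix i :: nat assume "i \<in> {0, 1, 2, 3, 4, 5}"
  then show "i \<in> {i. triple_perm {i. pair_perm D i \<in> D} i \<in> {i. pair_perm D i \<in> D}} \<longleftrightarrow> i \<in> D"
    using D(2-4) by (cases "0 \<in> D"; cases "2 \<in> D"; cases "4 \<in> D")
      (auto simp: pair_perm_def triple_perm_def perm_values perm_values[simplified])
qed

lemma pair_perm_triple_perm:
  assumes "D \<in> triple.dual"
  shows "{i. pair_perm {i. triple_perm D i \<in> D} i \<in> {i. triple_perm D i \<in> D}} = D"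
proof (rule coords_eqI)
  have D: "D \<subseteq> {..<6}" "3 \<in> D \<longleftrightarrow> 4 \<in> D" "3 \<in> D \<longleftrightarrow> 5 \<in> D" "3 \<in> D \<longleftrightarrow> ((0 \<in> D) \<noteq> ((1 \<in> D) \<noteq> (2 \<in> D)))"
    using assms unfolding triple_dual_iff by blast+
  show "D \<subseteq> {..<6}"
    by (rule D(1))
  show "{i. pair_perm {i. triple_perm D i \<in> D} i \<in> {i. triple_perm D i \<in> D}} \<subseteq> {..<6}"
    by (intro perms_subset triple_perm_coord_involution pair_perm_coord_involution D(1))
  fix i :: nat assume "i \<in> {0, 1, 2, 3, 4, 5}"
  then show "i \<in> {i. pair_perm {i. triple_perm D i \<in> D} i \<in> {i. triple_perm D i \<in> D}} \<longleftrightarrow> i \<in> D"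
    using D(2-4) by (cases "0 \<in> D"; cases "1 \<in> D"; cases "2 \<in> D")
      (auto simp: pair_perm_def triple_perm_def perm_values perm_values[simplified])
qed

lemma card_irr_classes_eq:
  "card (irr_classes pair.Gp pair.Mf n) = card (irr_classes triple.Gp triple.Mf n)"
proof (rule antisym)
  show "card (irr_classes pair.Gp pair.Mf n) \<le> card (irr_classes triple.Gp triple.Mf n)"
  proof (rule card_irr_classes_le[OF pair.sign_code_axioms triple.sign_code_axioms, of pair_perm])
    show "coord_involution (pair_perm D) \<and> {i. pair_perm D i \<in> D} \<in> triple.dual" if "D \<in> pair.dual" for D
      using pair_perm_coord_involution pair_perm_dual[OF that] by blast
    show "D = E" if "D \<in> pair.dual" "E \<in> pair.dual" "{i. pair_perm D i \<in> D} = {i. pair_perm E i \<in> E}" for D E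
      using triple_perm_pair_perm[OF that(1)] triple_perm_pair_perm[OF that(2)] unfolding that(3) by simp
  qed
  show "card (irr_classes triple.Gp triple.Mf n) \<le> card (irr_classes pair.Gp pair.Mf n)"
  proof (rule card_irr_classes_le[OF triple.sign_code_axioms pair.sign_code_axioms, of triple_perm])
    show "coord_involution (triple_perm D) \<and> {i. triple_perm D i \<in> D} \<in> pair.dual" if "D \<in> triple.dual" for D
      using triple_perm_coord_involution triple_perm_dual[OF that] by blast
    show "D = E" if "D \<in> triple.dual" "E \<in> triple.dual" "{i. triple_perm D i \<in> D} = {i. triple_perm E i \<in> E}" for D E
      using pair_perm_triple_perm[OF that(1)] pair_perm_triple_perm[OF that(2)] unfolding that(3) by simp
  qed
qed

text \<open>A bijection of the index sets that preserves dimension reindexes the sum. This holds for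
  every s, including those where the series diverges and both sides take the default value of the
  infinite sum.\<close>

lemma witten_zeta_eqI:
  assumes "\<And>n. finite (irr_classes G M n)" "\<And>n. finite (irr_classes H N n)"
    and "\<And>n. card (irr_classes G M n) = card (irr_classes H N n)"
  shows "witten_zeta G M = witten_zeta H N"
proof (rule ext)
  fix s
  have "\<exists>b. bij_betw b (irr_classes G M n) (irr_classes H N n)" for n
    by (rule finite_same_card_bij[OF assms])
  then obtain b where b: "\<And>n. bij_betw (b n) (irr_classes G M n) (irr_classes H N n)"
    by metis
  have "bij_betw (\<lambda>(n, V). (n, b n V)) (SIGMA n:UNIV. irr_classes G M n) (SIGMA n:UNIV. irr_classes H N n)"
    unfolding bij_betw_def
  proof
    show "inj_on (\<lambda>(n, V). (n, b n V)) (SIGMA n:UNIV. irr_classes G M n)"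
      using bij_betw_imp_inj_on[OF b] by (auto simp: inj_on_def)
    show "(\<lambda>(n, V). (n, b n V)) ` (SIGMA n:UNIV. irr_classes G M n) = (SIGMA n:UNIV. irr_classes H N n)"
      using bij_betw_imp_surj_on[OF b] by (auto simp: image_iff) blast+
  qed
  from infsum_reindex_bij_betw[OF this, of "\<lambda>(n, V). of_nat n powr (- s)"]
  show "witten_zeta G M s = witten_zeta H N s"
    unfolding witten_zeta_def by (simp add: case_prod_unfold)
qed

theorem theorem5p2:
  shows "\<exists>(G1 :: lie_elem monoid) (M1 :: lie_elem manifold)
          (G2 :: lie_elem monoid) (M2 :: lie_elem manifold).
     connected_compact_semisimple_lie_group G1 M1 \<and>
     connected_compact_semisimple_lie_group G2 M2 \<and>
     \<not> lie_group_isomorphic G1 M1 G2 M2 \<and>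
     witten_zeta G1 M1 = witten_zeta G2 M2 \<and>
     (\<forall>n>0. finite (irr_classes G1 M1 n) \<and> finite (irr_classes G2 M2 n) \<and>
            card (irr_classes G1 M1 n) = card (irr_classes G2 M2 n))"
proof (intro exI conjI allI impI)
  show "connected_compact_semisimple_lie_group pair.Gp pair.Mf"
    by (rule pair.semisimple_Gp)
  show "connected_compact_semisimple_lie_group triple.Gp triple.Mf"
    by (rule triple.semisimple_Gp)
  show "\<not> lie_group_isomorphic pair.Gp pair.Mf triple.Gp triple.Mf"
    by (rule not_lie_group_isomorphic)
  show "witten_zeta pair.Gp pair.Mf = witten_zeta triple.Gp triple.Mf"
    by (rule witten_zeta_eqI[OF pair.finite_irr_classes_Gp triple.finite_irr_classes_Gp card_irr_classes_eq])
  show "finite (irr_classes pair.Gp pair.Mf n)" "finite (irr_classes triple.Gp triple.Mf n)" for n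
    by (rule pair.finite_irr_classes_Gp triple.finite_irr_classes_Gp)+
  show "card (irr_classes pair.Gp pair.Mf n) = card (irr_classes triple.Gp triple.Mf n)" for n
    by (rule card_irr_classes_eq)
qed

end
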